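(* Let $A\in\mathbb{R}^{n\times n}$, $B\in\mathbb{R}^{n\times m}$, let $U\subset\mathbb{R}^m$ be a compact convex neighborhood of $0$, and consider the control system induced on the Poincaré sphere $\mathbb{S}^n$ by the linear control system $\dot x(t)=Ax(t)+Bu(t)$, $u\in\mathcal{U}$. Let $u\in\mathcal{U}$, $x_0\in\mathbb{R}^n$ and $s_0=h^1(x_0)\in\mathbb{S}^{n,+}$. Then each of the limit sets $\alpha(s_0,u)$ and $\omega(s_0,u)$ of the trajectory $\pi\varphi^1(t,s_0,u)=h^1(\varphi(t,x_0,u))$, $t\in\mathbb{R}$, is contained in one of the central chain control sets ${}_{\mathbb{S}}E_c^j$ ($j=0$ or $j=1,2$) or in one of the sets ${}_{\mathbb{S}}L(\lambda_i)_j^\infty\subset\mathbb{S}^{n,0}$ ($j=0$ or $j=1,2$) with $\lambda_i\neq0$.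
   Context: $\mathcal{U}=\{u\in L^\infty(\mathbb{R},\mathbb{R}^m)\mid u(t)\in U\text{ for a.a. }t\in\mathbb{R}\}$. $\varphi(t,x_0,u)$, $t\in\mathbb{R}$, is the solution of $\dot x=Ax+Bu$ with $x(0)=x_0$. The distinct real parts of the eigenvalues of $A$ are $\lambda_1>\dots>\lambda_\ell$; the Lyapunov space $L(\lambda_i)\subset\mathbb{R}^n$ is the sum of the real generalized eigenspaces for eigenvalues with real part $\lambda_i$, and $L(\lambda_i)^\infty:=L(\lambda_i)\times\{0\}\subset\mathbb{R}^{n+1}$. Lift to $\mathbb{R}^{n+1}=\mathbb{R}^n\times\mathbb{R}$: the bilinear control system $\dot x=Ax+x_{n+1}Bu$, $\dot x_{n+1}=0$, has solutions $\varphi^1(t,x,r,u)=\big(e^{At}x+r\int_0^te^{A(t-\sigma)}Bu(\sigma)\,d\sigma,\;r\big)$. Let $\pi(y)=y/\|y\|$ be the projection of $\mathbb{R}^{n+1}\setminus\{0\}$ onto the unit sphere $\mathbb{S}^n$ (the Poincaré sphere). The induced control system on $\mathbb{S}^n$ has trajectories $\pi\varphi^1(t,\pi(x,r),u)=\varphi^1(t,x,r,u)/\|\varphi^1(t,x,r,u)\|$; the induced system on projective space $\mathbb{P}^n$ has trajectories $\mathbb{P}\varphi^1(t,x,r,u)$, where $\mathbb{P}$ denotes the projection to projective space. Put $\mathbb{S}^{n,+}=\{(x,r)\in\mathbb{S}^n\mid r>0\}$, $\mathbb{S}^{n,0}=\{(x,0)\in\mathbb{S}^n\}$ (equator), $\mathbb{P}^{n,1}=\{\mathbb{P}(x,r)\mid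 x\in\mathbb{R}^n,\ r\ne0\}$, and $h^1:\mathbb{R}^n\to\mathbb{S}^{n,+}$, $h^1(x)=(x,1)/\|(x,1)\|$. Limit sets: $\omega(s_0,u)$ (resp. $\alpha(s_0,u)$) is the set of all $s\in\mathbb{S}^n$ for which there are $t_k\to\infty$ (resp. $t_k\to-\infty$) with $\pi\varphi^1(t_k,s_0,u)\to s$ for $k\to\infty$. Chain control sets: for a control system with solutions $\varphi(t,x,u)$ on a metric space $(M,d)$ and $\varepsilon,\tau>0$, a controlled $(\varepsilon,\tau)$-chain from $x$ to $y$ is given by $k\in\mathbb{N}$, $x_0=x,\dots,x_k=y\in M$, $u_0,\dots,u_{k-1}\in\mathcal{U}$, $T_0,\dots,T_{k-1}\ge\tau$ with $d(\varphi(T_j,x_j,u_j),x_{j+1})<\varepsilon$ for all $j$. A chain control set is a nonvoid set $E\subset M$ such that for all $x,y\in E$ and all $\varepsilon,\tau>0$ there is a controlled $(\varepsilon,\tau)$-chain from $x$ to $y$, and which is maximal with this property. There is a unique chain control set ${}_{\mathbb{P}}E_c$ of the induced system on $\mathbb{P}^n$ with ${}_{\mathbb{P}}E_c\cap\mathbb{P}^{n,1}\ne\varnothing$. The central chain control sets ${}_{\mathbb{S}}E_c^j$ are the chain control sets on $\mathbb{S}^n$ that project onto ${}_{\mathbb{P}}E_c$; there is either exactly one (denoted with $j=0$, equal to $\{s\in\mathbb{S}^n\mid\mathbb{P}s\in{}_{\mathbb{P}}E_c\}$) or exactly two (denoted with $j=1,2$, with ${}_{\mathbb{S}}E_c^1=-{}_{\mathbb{S}}E_c^2$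 and union $\{s\in\mathbb{S}^n\mid\mathbb{P}s\in{}_{\mathbb{P}}E_c\}$). For $\lambda_i\ne0$ the sets ${}_{\mathbb{S}}L(\lambda_i)_j^\infty$ are the maximal chain transitive sets contained in $L(\lambda_i)^\infty\cap\mathbb{S}^n$ of the flow induced by $e^{At}$ on the equator $\mathbb{S}^{n,0}$ (on which the controls act trivially); there is one ($j=0$) or there are two ($j=1,2$), with union $L(\lambda_i)^\infty\cap\mathbb{S}^n$. *)

theory Defs
  imports "HOL-Analysis.Analysis"
begin

section \<open>Control systems on metric spaces\<close>

text \<open>
  A control system is given by a carrier \<open>M\<close>, a metric \<open>d\<close> on it, a set \<open>V\<close> of control functions,
  and the solution map \<open>\<Phi> t x u\<close>.  Chains have at least one segment (\<open>k \<ge> 1\<close>): otherwise every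
  point would trivially be connected to itself.
\<close>

definition controlled_chain ::
  "'x set \<Rightarrow> ('x \<Rightarrow> 'x \<Rightarrow> real) \<Rightarrow> 'u set \<Rightarrow> (real \<Rightarrow> 'x \<Rightarrow> 'u \<Rightarrow> 'x) \<Rightarrow> real \<Rightarrow> real \<Rightarrow> 'x \<Rightarrow> 'x \<Rightarrow> bool"
where
  "controlled_chain M d V \<Phi> \<epsilon> \<tau> x y \<longleftrightarrow>
     (\<exists>(k::nat) (p :: nat \<Rightarrow> 'x) (v :: nat \<Rightarrow> 'u) (T :: nat \<Rightarrow> real).
        k \<ge> 1 \<and> p 0 = x \<and> p k = y \<and> (\<forall>j\<le>k. p j \<in> M) \<and>
        (\<forall>j<k. v j \<in> V \<and> T j \<ge> \<tau> \<and> d (\<Phi> (T j) (p j) (v j)) (p (Suc j)) < \<epsilon>))"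

definition chain_controllable_on ::
  "'x set \<Rightarrow> ('x \<Rightarrow> 'x \<Rightarrow> real) \<Rightarrow> 'u set \<Rightarrow> (real \<Rightarrow> 'x \<Rightarrow> 'u \<Rightarrow> 'x) \<Rightarrow> 'x set \<Rightarrow> bool"
where
  "chain_controllable_on M d V \<Phi> E \<longleftrightarrow>
     E \<subseteq> M \<and> E \<noteq> {} \<and>
     (\<forall>x\<in>E. \<forall>y\<in>E. \<forall>\<epsilon>>0. \<forall>\<tau>>0. controlled_chain M d V \<Phi> \<epsilon> \<tau> x y)"

definition chain_control_set ::
  "'x set \<Rightarrow> ('x \<Rightarrow> 'x \<Rightarrow> real) \<Rightarrow> 'u set \<Rightarrow> (real \<Rightarrow> 'x \<Rightarrow> 'u \<Rightarrow> 'x) \<Rightarrow> 'x set \<Rightarrow> bool"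
where
  "chain_control_set M d V \<Phi> E \<longleftrightarrow>
     chain_controllable_on M d V \<Phi> E \<and>
     (\<forall>F. chain_controllable_on M d V \<Phi> F \<and> E \<subseteq> F \<longrightarrow> F = E)"

text \<open>A flow is a control system whose control set is a singleton.\<close>

definition maximal_chain_transitive ::
  "'x set \<Rightarrow> ('x \<Rightarrow> 'x \<Rightarrow> real) \<Rightarrow> (real \<Rightarrow> 'x \<Rightarrow> 'x) \<Rightarrow> 'x set \<Rightarrow> bool"
where
  "maximal_chain_transitive M d \<psi> E \<longleftrightarrow> chain_control_set M d {()} (\<lambda>t x _. \<psi> t x) E"


section \<open>The linear control system and its lift\<close>

text \<open>
  Control functions are Lebesgue measurable representatives of the elements of $L^\infty$.
\<close>

definition admissible_controls :: "(real^'m) set \<Rightarrow> (real \<Rightarrow> real^'m) set" where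
  "admissible_controls U =
     {u. u \<in> borel_measurable lebesgue \<and> (\<exists>C. AE t in lebesgue. norm (u t) \<le> C) \<and>
         (AE t in lebesgue. u t \<in> U)}"

text \<open>
  Solutions are meant in the sense of Caratheodory, that is, as continuous solutions of the
  integral equation on the whole real line; the integral is oriented, so that negative times
  are covered.
\<close>

definition is_solution ::
  "real^'n^'n \<Rightarrow> real^'m^'n \<Rightarrow> real^'n \<Rightarrow> (real \<Rightarrow> real^'m) \<Rightarrow> (real \<Rightarrow> real^'n) \<Rightarrow> bool"
where
  "is_solution A B x0 u x \<longleftrightarrow>
     continuous_on UNIV x \<and>
     (\<forall>t. x t = x0 + (LINT s=ereal 0..ereal t|lebesgue. (A *v x s + B *v u s)))"

definition lin_sol ::
  "real^'n^'n \<Rightarrow> real^'m^'n \<Rightarrow> real \<Rightarrow> real^'n \<Rightarrow> (real \<Rightarrow> real^'m) \<Rightarrow> real^'n"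
where
  "lin_sol A B t x0 u = (THE x. is_solution A B x0 u x) t"

text \<open>
  The type \<open>real^'n^'n\<close> carries no ring structure with matrix multiplication as product, so the
  library's \<open>exp\<close> is not available on it.
\<close>

definition mat_exp :: "real^'n^'n \<Rightarrow> real^'n^'n" where
  "mat_exp A = (\<Sum>k. (((**) A ^^ k) (mat 1)) /\<^sub>R fact k)"

text \<open>The lifted system lives on \<open>(real^'n) \<times> real\<close>, whose product norm is the Euclidean norm.\<close>

definition lift_sol ::
  "real^'n^'n \<Rightarrow> real^'m^'n \<Rightarrow> real \<Rightarrow> (real^'n) \<times> real \<Rightarrow> (real \<Rightarrow> real^'m) \<Rightarrow> (real^'n) \<times> real"
where
  "lift_sol A B t = (\<lambda>(x, r) u.
     (mat_exp (t *\<^sub>R A) *v x +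
        r *\<^sub>R (LINT \<sigma>=ereal 0..ereal t|lebesgue. (mat_exp ((t - \<sigma>) *\<^sub>R A) *v (B *v u \<sigma>))),
      r))"


section \<open>The induced systems on the Poincare sphere and on projective space\<close>

text \<open>The radial projection \<open>y / \<parallel>y\<parallel>\<close> onto the unit sphere is the library's \<open>sgn\<close>.\<close>

abbreviation poincare_sphere :: "((real^'n) \<times> real) set" where
  "poincare_sphere \<equiv> sphere 0 1"

definition sphere_sol ::
  "real^'n^'n \<Rightarrow> real^'m^'n \<Rightarrow> real \<Rightarrow> (real^'n) \<times> real \<Rightarrow> (real \<Rightarrow> real^'m) \<Rightarrow> (real^'n) \<times> real"
where
  "sphere_sol A B t s u = sgn (lift_sol A B t s u)"

definition h1 :: "real^'n \<Rightarrow> (real^'n) \<times> real" where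
  "h1 x = sgn (x, 1)"

text \<open>
  The points of projective space are the lines through the origin.  The distance of two lines is
  the smallest distance between their unit vectors; see \<open>proj_dist_proj\<close>.
\<close>

definition proj :: "(real^'n) \<times> real \<Rightarrow> ((real^'n) \<times> real) set" where
  "proj y = span {y}"

definition proj_space :: "((real^'n) \<times> real) set set" where
  "proj_space = {proj y |y. y \<noteq> 0}"

definition proj_dist :: "((real^'n) \<times> real) set \<Rightarrow> ((real^'n) \<times> real) set \<Rightarrow> real" where
  "proj_dist p q = setdist (p \<inter> sphere 0 1) (q \<inter> sphere 0 1)"

definition proj_space1 :: "((real^'n) \<times> real) set set" where
  "proj_space1 = {proj (x, r) |x r. r \<noteq> 0}"

text \<open>
  The lifted solution map is linear in the initial value, hence maps lines to lines;
  see \<open>proj_sol_proj\<close>.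
\<close>

definition proj_sol ::
  "real^'n^'n \<Rightarrow> real^'m^'n \<Rightarrow> real \<Rightarrow> ((real^'n) \<times> real) set \<Rightarrow> (real \<Rightarrow> real^'m) \<Rightarrow> ((real^'n) \<times> real) set"
where
  "proj_sol A B t p u = (\<lambda>y. lift_sol A B t y u) ` p"

lemma linear_lift_sol: "linear (\<lambda>y. lift_sol A B t y u)"
  by (rule linearI)
     (auto simp: lift_sol_def case_prod_unfold matrix_vector_right_distrib
        matrix_vector_mult_scaleR scaleR_add_left scaleR_add_right)

lemma proj_sol_proj: "proj_sol A B t (proj y) u = proj (lift_sol A B t y u)"
  using linear_span_image[OF linear_lift_sol, of A B t u "{y}"]
  by (simp add: proj_sol_def proj_def)

lemma proj_Int_sphere:
  assumes "y \<noteq> 0"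
  shows "proj y \<inter> sphere 0 1 = {sgn y, - sgn y}"
proof (intro equalityI subsetI)
  fix z assume "z \<in> proj y \<inter> sphere 0 1"
  then have "z \<in> span {y}" and "norm z = 1"
    by (auto simp: proj_def)
  then obtain c where z: "z = c *\<^sub>R y"
    by (auto simp: span_singleton)
  then have "\<bar>c\<bar> = inverse (norm y)"
    using assms \<open>norm z = 1\<close> by (simp add: field_simps)
  then have "c = inverse (norm y) \<or> c = - inverse (norm y)"
    by linarith
  then show "z \<in> {sgn y, - sgn y}"
    unfolding z sgn_div_norm by auto
next
  fix z assume z: "z \<in> {sgn y, - sgn y}"
  have "sgn y \<in> span {y}"
    unfolding sgn_div_norm by (simp add: span_base span_scale)
  with z have "z \<in> span {y}"
    by (auto intro: span_neg)
  with z show "z \<in> proj y \<inter> sphere 0 1"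
    using assms by (auto simp: proj_def norm_sgn)
qed

lemma proj_dist_proj:
  assumes "y \<noteq> 0" "z \<noteq> 0"
  shows "proj_dist (proj y) (proj z) = min (norm (sgn y - sgn z)) (norm (sgn y + sgn z))"
proof -
  let ?s = "sgn y" and ?t = "sgn z"
  have "dist ?s ?t = norm (?s - ?t)" "dist ?s (- ?t) = norm (?s + ?t)"
    by (simp_all add: dist_norm)
  moreover have "dist (- ?s) ?t = norm (?s + ?t)"
    using norm_minus_cancel[of "?s + ?t"] by (simp only: dist_norm minus_add_distrib diff_conv_add_uminus)
  moreover have "dist (- ?s) (- ?t) = norm (?s - ?t)"
    by (simp add: dist_norm norm_minus_commute)
  moreover have "{dist a b |a b. a \<in> {?s, - ?s} \<and> b \<in> {?t, - ?t}}
      = {dist ?s ?t, dist ?s (- ?t), dist (- ?s) ?t, dist (- ?s) (- ?t)}"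
    by blast
  ultimately have "{dist a b |a b. a \<in> {?s, - ?s} \<and> b \<in> {?t, - ?t}} = {norm (?s - ?t), norm (?s + ?t)}"
    by (simp only: insert_commute insert_absorb2)
  then show ?thesis
    unfolding proj_dist_def setdist_def proj_Int_sphere[OF assms(1)] proj_Int_sphere[OF assms(2)]
    by (simp only: cInf_eq_Min finite.intros insert_not_empty simp_thms if_False) simp
qed

text \<open>The chain control set of the projective system that meets \<open>proj_space1\<close> is unique.\<close>

definition central_proj ::
  "real^'n^'n \<Rightarrow> real^'m^'n \<Rightarrow> (real^'m) set \<Rightarrow> ((real^'n) \<times> real) set set"
where
  "central_proj A B U =
     (THE E. chain_control_set proj_space proj_dist (admissible_controls U) (proj_sol A B) E \<and>
             E \<inter> proj_space1 \<noteq> {})"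

definition is_central_chain_control_set ::
  "real^'n^'n \<Rightarrow> real^'m^'n \<Rightarrow> (real^'m) set \<Rightarrow> ((real^'n) \<times> real) set \<Rightarrow> bool"
where
  "is_central_chain_control_set A B U E \<longleftrightarrow>
     chain_control_set poincare_sphere dist (admissible_controls U) (sphere_sol A B) E \<and>
     proj ` E = central_proj A B U"

definition omega_limit_set ::
  "real^'n^'n \<Rightarrow> real^'m^'n \<Rightarrow> (real^'n) \<times> real \<Rightarrow> (real \<Rightarrow> real^'m) \<Rightarrow> ((real^'n) \<times> real) set"
where
  "omega_limit_set A B s0 u =
     {s \<in> poincare_sphere. \<exists>t :: nat \<Rightarrow> real. filterlim t at_top sequentially \<and>
        (\<lambda>k. sphere_sol A B (t k) s0 u) \<longlonglongrightarrow> s}"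

definition alpha_limit_set ::
  "real^'n^'n \<Rightarrow> real^'m^'n \<Rightarrow> (real^'n) \<times> real \<Rightarrow> (real \<Rightarrow> real^'m) \<Rightarrow> ((real^'n) \<times> real) set"
where
  "alpha_limit_set A B s0 u =
     {s \<in> poincare_sphere. \<exists>t :: nat \<Rightarrow> real. filterlim t at_bot sequentially \<and>
        (\<lambda>k. sphere_sol A B (t k) s0 u) \<longlonglongrightarrow> s}"


section \<open>Lyapunov spaces and the flow on the equator\<close>

definition eigenvalues :: "real^'n^'n \<Rightarrow> complex set" where
  "eigenvalues A = {\<mu>. \<exists>v. v \<noteq> 0 \<and> map_matrix complex_of_real A *v v = \<mu> *s v}"

definition gen_eigenspace :: "real^'n^'n \<Rightarrow> complex \<Rightarrow> (complex^'n) set" where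
  "gen_eigenspace A \<mu> =
     {v. \<exists>k. ((\<lambda>w. map_matrix complex_of_real A *v w - \<mu> *s w) ^^ k) v = 0}"

text \<open>
  Imaginary parts need not be added: a generalized eigenspace is a complex subspace, and the
  imaginary part of \<open>v\<close> is the real part of \<open>- \<i> v\<close>.
\<close>

definition real_gen_eigenspace :: "real^'n^'n \<Rightarrow> complex \<Rightarrow> (real^'n) set" where
  "real_gen_eigenspace A \<mu> = (\<lambda>v. \<chi> i. Re (v $ i)) ` gen_eigenspace A \<mu>"

definition lyapunov_exponents :: "real^'n^'n \<Rightarrow> real set" where
  "lyapunov_exponents A = Re ` eigenvalues A"

definition lyapunov_space :: "real^'n^'n \<Rightarrow> real \<Rightarrow> (real^'n) set" where
  "lyapunov_space A lam =
     span (\<Union>\<mu>\<in>{\<mu> \<in> eigenvalues A. Re \<mu> = lam}. real_gen_eigenspace A \<mu>)"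

definition lyapunov_space_inf :: "real^'n^'n \<Rightarrow> real \<Rightarrow> ((real^'n) \<times> real) set" where
  "lyapunov_space_inf A lam = lyapunov_space A lam \<times> {0}"

definition equator :: "((real^'n) \<times> real) set" where
  "equator = {s \<in> poincare_sphere. snd s = 0}"

definition equator_flow :: "real^'n^'n \<Rightarrow> real \<Rightarrow> (real^'n) \<times> real \<Rightarrow> (real^'n) \<times> real" where
  "equator_flow A t s = sgn (mat_exp (t *\<^sub>R A) *v fst s, 0)"

definition is_lyapunov_component ::
  "real^'n^'n \<Rightarrow> real \<Rightarrow> ((real^'n) \<times> real) set \<Rightarrow> bool"
where
  "is_lyapunov_component A lam E \<longleftrightarrow>
     maximal_chain_transitive equator dist (equator_flow A) E \<and>
     E \<subseteq> lyapunov_space_inf A lam \<inter> poincare_sphere"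

end

theory Submission
  imports Defs
    "HOL-Computational_Algebra.Fundamental_Theorem_Algebra"
    "HOL-Real_Asymp.Real_Asymp"
begin

text \<open>
  A limit set is chain controllable, because chains between its points follow the trajectory.
  If it contains a point off the equator, that point is chain recurrent, and we show that every
  chain recurrent point \<open>(z, 1)\<close> is chain equivalent to the north pole \<open>(0, 1)\<close>, whose class is a
  central chain control set.  For chain recurrence forces the unstable component of \<open>z\<close> into the
  closure of the set that can be steered to 0: outside, its distance to that set grows faster than
  all other components, in ratio, and small jumps cannot undo this.  Similarly the stable component
  lies in the closure of the set reachable from 0.  After steering, the state grows
  subexponentially under the zero control, so jumps that multiply the height by \<open>1 + \<delta>\<close> lead to the
  pole, and symmetrically back from it.

  If the limit set lies in the equator, the trajectory is asymptotic to the equator flow, so the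
  limit set is chain transitive for that flow.  The same comparison of growth rates at every
  spectral gap puts its chain class into a single Lyapunov space.  Points of \<open>L(0)\<close> are limits of
  points \<open>(k v, 1)\<close> that are chain equivalent to the pole, so the exponent 0 leads back to the
  central chain control set.
\<close>

section \<open>The matrix exponential\<close>

text \<open>The obstacle is that jumps are small on the sphere only: near the equator a small jump
  moves the point of R^n arbitrarily far, so no estimate in R^n survives it. Every separation
  argument therefore uses two nonnegative functions \<open>a\<close> and \<open>b\<close> on the
  lifted space, homogeneous of degree one, and their quotient a / (a + b). It is uniformly
  continuous on the compact sphere, and a spectral gap forces it upwards along every long trajectory
  piece. For the controlled system one of the two functions is \<open>hdist\<close>, a distance to a
  bounded set of components that is scaled with the height; the other contains the height itself,
  because the control enters the lifted equation multiplied by it. \<open>central_proj\<close> is a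
  definite description, so existence and uniqueness of the central projective chain control set are
  part of the work. A projective chain lifts to the sphere only up to the sign of its end point;
  hence recurrence off the equator is assumed in the weak form
  \<open>s \<leadsto> s \<or> s \<leadsto> - s\<close>.\<close>

abbreviation mat_pow :: "real^'n^'n \<Rightarrow> nat \<Rightarrow> real^'n^'n" where
  "mat_pow A k \<equiv> ((**) A ^^ k) (mat 1)"

lemma matrix_mult_scaleR_left: "(k *\<^sub>R A) ** B = k *\<^sub>R (A ** B)" for A :: "real^'m^'n"
  by (simp add: matrix_matrix_mult_def vec_eq_iff sum_distrib_left mult.assoc)

lemma matrix_mult_scaleR_right: "A ** (k *\<^sub>R B) = k *\<^sub>R (A ** B)" for A :: "real^'m^'n"
  by (simp add: matrix_matrix_mult_def vec_eq_iff sum_distrib_left mult.left_commute)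

lemma matrix_mult_add_left: "(A + B) ** C = A ** C + B ** C" for A :: "real^'m^'n"
  by (simp add: matrix_matrix_mult_def vec_eq_iff sum.distrib distrib_right)

lemma matrix_vector_mult_scaleR_left: "(k *\<^sub>R A) *v x = k *\<^sub>R (A *v x)" for A :: "real^'m^'n"
  by (simp add: matrix_vector_mult_def vec_eq_iff sum_distrib_left mult.assoc)

lemma matrix_vector_mult_uminus_left: "(- A) *v x = - (A *v x)" for A :: "real^'m^'n"
  by (simp add: matrix_vector_mult_def vec_eq_iff sum_negf)

lemma mat_pow_scaleR: "mat_pow (t *\<^sub>R A) k = t ^ k *\<^sub>R mat_pow A k"
  by (induction k) (simp_all add: matrix_mult_scaleR_left matrix_mult_scaleR_right)

lemma mat_pow_commute: "mat_pow A k ** A = A ** mat_pow A k"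
  by (induction k) (simp_all add: matrix_mul_assoc[symmetric])

text \<open>Each product costs a factor n in an entrywise bound, so \<open>N\<close> is n times a
  bound on the entries of \<open>A\<close>. The exponential series is dominated entry by entry in
  this way.\<close>

lemma mat_pow_entry_bound:
  fixes A :: "real^'n^'n"
  shows "\<exists>N\<ge>0. \<forall>k i j. \<bar>mat_pow A k $ i $ j\<bar> \<le> N ^ k"
proof -
  define M where "M = (\<Sum>i\<in>UNIV. \<Sum>j\<in>UNIV. \<bar>A $ i $ j\<bar>)"
  have M: "\<bar>A $ i $ j\<bar> \<le> M" for i j
  proof -
    have "\<bar>A $ i $ j\<bar> \<le> (\<Sum>j\<in>UNIV. \<bar>A $ i $ j\<bar>)"
      by (rule member_le_sum) auto
    also have "\<dots> \<le> M"
      unfolding M_def by (rule member_le_sum[where f = "\<lambda>i. \<Sum>j\<in>UNIV. \<bar>A $ i $ j\<bar>"]) (auto intro: sum_nonneg)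
    finally show ?thesis .
  qed
  have M0: "M \<ge> 0" unfolding M_def by (intro sum_nonneg) auto
  define N where "N = real CARD('n) * M"
  have "\<bar>mat_pow A k $ i $ j\<bar> \<le> N ^ k" for k i j
  proof (induction k arbitrary: i j)
    case 0
    then show ?case by (simp add: mat_def)
  next
    case (Suc k)
    have "\<bar>mat_pow A (Suc k) $ i $ j\<bar> = \<bar>\<Sum>l\<in>UNIV. A $ i $ l * mat_pow A k $ l $ j\<bar>"
      by (simp add: matrix_matrix_mult_def)
    also have "\<dots> \<le> (\<Sum>l\<in>UNIV. \<bar>A $ i $ l * mat_pow A k $ l $ j\<bar>)"
      by (rule sum_abs)
    also have "\<dots> \<le> (\<Sum>l\<in>(UNIV::'n set). M * N ^ k)"
      using M Suc M0 by (intro sum_mono) (auto simp: abs_mult intro!: mult_mono)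
    also have "\<dots> = N ^ Suc k" by (simp add: N_def)
    finally show ?case .
  qed
  moreover have "N \<ge> 0" using M0 by (simp add: N_def)
  ultimately show ?thesis by blast
qed

lemma sums_vec_entries:
  fixes M :: "nat \<Rightarrow> real^'n^'m"
  assumes "\<And>i j. (\<lambda>k. M k $ i $ j) sums (L $ i $ j)"
  shows "M sums L"
  unfolding sums_def
proof (intro vec_tendstoI)
  fix i j
  show "(\<lambda>n. sum M {..<n} $ i $ j) \<longlonglongrightarrow> L $ i $ j"
    using assms[of i j] by (simp add: sums_def)
qed

lemma mat_pow_entry_summable:
  fixes A :: "real^'n^'n"
  shows "summable (\<lambda>k. mat_pow A k $ i $ j / fact k * t ^ k)"
proof -
  obtain N where N: "N \<ge> 0" "\<And>k. \<bar>mat_pow A k $ i $ j\<bar> \<le> N ^ k"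
    using mat_pow_entry_bound[of A] by blast
  have "summable (\<lambda>k. (N * \<bar>t\<bar>) ^ k /\<^sub>R fact k)"
    by (rule summable_exp_generic)
  then show ?thesis
  proof (rule summable_comparison_test')
    fix k :: nat assume "k \<ge> 0"
    have "norm (mat_pow A k $ i $ j / fact k * t ^ k) = \<bar>mat_pow A k $ i $ j\<bar> * \<bar>t\<bar> ^ k / fact k"
      by (simp add: abs_mult power_abs)
    also have "\<dots> \<le> N ^ k * \<bar>t\<bar> ^ k / fact k"
      using N by (intro divide_right_mono mult_right_mono) auto
    finally show "norm (mat_pow A k $ i $ j / fact k * t ^ k) \<le> (N * \<bar>t\<bar>) ^ k /\<^sub>R fact k"
      by (simp add: power_mult_distrib divide_inverse mult.commute)
  qed
qed

lemma mat_exp_sums: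
  "(\<lambda>k. mat_pow (t *\<^sub>R A) k /\<^sub>R fact k) sums (\<chi> i j. \<Sum>k. mat_pow A k $ i $ j / fact k * t ^ k)"
proof (rule sums_vec_entries)
  fix i j
  have "(\<lambda>k. mat_pow A k $ i $ j / fact k * t ^ k) sums (\<Sum>k. mat_pow A k $ i $ j / fact k * t ^ k)"
    using mat_pow_entry_summable by (rule summable_sums)
  then show "(\<lambda>k. (mat_pow (t *\<^sub>R A) k /\<^sub>R fact k) $ i $ j) sums
      ((\<chi> i j. \<Sum>k. mat_pow A k $ i $ j / fact k * t ^ k) $ i $ j)"
    by (simp add: mat_pow_scaleR field_simps)
qed

lemma mat_exp_entry: "mat_exp (t *\<^sub>R A) $ i $ j = (\<Sum>k. mat_pow A k $ i $ j / fact k * t ^ k)"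
proof -
  have "mat_exp (t *\<^sub>R A) = (\<chi> i j. \<Sum>k. mat_pow A k $ i $ j / fact k * t ^ k)"
    unfolding mat_exp_def by (rule sums_unique[OF mat_exp_sums, symmetric])
  then show ?thesis by simp
qed

lemma mat_exp_sums': "(\<lambda>k. mat_pow (t *\<^sub>R A) k /\<^sub>R fact k) sums mat_exp (t *\<^sub>R A)"
  unfolding mat_exp_def by (rule summable_sums[OF sums_summable[OF mat_exp_sums]])

text \<open>Each entry is an everywhere convergent power series in t, hence differentiable termwise.
  The factor \<open>Suc k\<close> from \<open>diffs\<close> cancels against the factorial and leaves
  the series with one more factor \<open>A\<close>.\<close>

lemma mat_exp_entry_deriv:
  "((\<lambda>t. mat_exp (t *\<^sub>R A) $ i $ j) has_field_derivative (A ** mat_exp (t *\<^sub>R A)) $ i $ j) (at t)"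
proof -
  let ?c = "\<lambda>k. mat_pow A k $ i $ j / fact k"
  have "((\<lambda>t. \<Sum>k. ?c k * t ^ k) has_field_derivative (\<Sum>k. diffs ?c k * t ^ k)) (at t)"
    by (rule termdiffs_strong_converges_everywhere) (rule mat_pow_entry_summable)
  moreover have "(\<Sum>k. diffs ?c k * t ^ k) = (A ** mat_exp (t *\<^sub>R A)) $ i $ j"
  proof -
    have "diffs ?c k * t ^ k = (\<Sum>l\<in>UNIV. A $ i $ l * (mat_pow A k $ l $ j / fact k * t ^ k))" for k
    proof -
      have "diffs ?c k * t ^ k = (\<Sum>l\<in>UNIV. A $ i $ l * mat_pow A k $ l $ j) / fact k * t ^ k"
        by (simp add: diffs_def matrix_matrix_mult_def del: of_nat_Suc)
      then show ?thesis by (simp add: sum_divide_distrib sum_distrib_right mult.assoc)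
    qed
    then have "(\<Sum>k. diffs ?c k * t ^ k) = (\<Sum>k. \<Sum>l\<in>UNIV. A $ i $ l * (mat_pow A k $ l $ j / fact k * t ^ k))"
      by presburger
    also have "\<dots> = (\<Sum>l\<in>UNIV. \<Sum>k. A $ i $ l * (mat_pow A k $ l $ j / fact k * t ^ k))"
      by (rule suminf_sum) (intro summable_mult mat_pow_entry_summable)
    also have "\<dots> = (\<Sum>l\<in>UNIV. A $ i $ l * mat_exp (t *\<^sub>R A) $ l $ j)"
      unfolding mat_exp_entry by (intro sum.cong refl suminf_mult mat_pow_entry_summable)
    finally show ?thesis by (simp add: matrix_matrix_mult_def)
  qed
  ultimately show ?thesis by (simp add: mat_exp_entry)
qed

lemma mat_exp_0: "mat_exp (0 *\<^sub>R A) = mat 1"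
proof -
  have "(\<Sum>k. mat_pow A k $ i $ j / fact k * 0 ^ k) = mat 1 $ i $ j" for i j
    using powser_zero[of "\<lambda>k. mat_pow A k $ i $ j / fact k"] by simp
  then show ?thesis using mat_exp_entry[of 0 A] by (simp add: vec_eq_iff)
qed

lemma mat_exp_commute: "mat_exp (t *\<^sub>R A) ** A = A ** mat_exp (t *\<^sub>R A)"
proof -
  let ?S = "\<lambda>k. mat_pow (t *\<^sub>R A) k /\<^sub>R fact k"
  have S: "?S sums mat_exp (t *\<^sub>R A)"
    by (rule mat_exp_sums')
  have lin: "bounded_linear (\<lambda>X::real^'a^'a. X ** A)" "bounded_linear (\<lambda>X::real^'a^'a. A ** X)"
    by (intro linear_conv_bounded_linear[THEN iffD1] linearI;
        simp add: matrix_mult_add_left matrix_add_ldistrib matrix_mult_scaleR_left matrix_mult_scaleR_right)+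
  have eq: "?S k ** A = A ** ?S k" for k
    by (simp only: mat_pow_scaleR matrix_mult_scaleR_left matrix_mult_scaleR_right mat_pow_commute)
  have "(\<lambda>k. ?S k ** A) sums (mat_exp (t *\<^sub>R A) ** A)"
    by (rule bounded_linear.sums[OF lin(1) S])
  moreover have "(\<lambda>k. ?S k ** A) sums (A ** mat_exp (t *\<^sub>R A))"
    unfolding eq by (rule bounded_linear.sums[OF lin(2) S])
  ultimately show ?thesis by (rule sums_unique2)
qed

definition lflow :: "real^'n^'n \<Rightarrow> real \<Rightarrow> real^'n \<Rightarrow> real^'n" where
  "lflow A t x = mat_exp (t *\<^sub>R A) *v x"

lemma linear_lflow: "linear (lflow A t)"
  unfolding lflow_def by (rule matrix_vector_mul_linear)

lemma bounded_linear_lflow: "bounded_linear (lflow A t)"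
  using linear_lflow linear_conv_bounded_linear by blast

lemmas lflow_simps = linear_add[OF linear_lflow] linear_diff[OF linear_lflow] linear_0[OF linear_lflow]
  linear_cmul[OF linear_lflow] linear_neg[OF linear_lflow]

lemma lflow_0 [simp]: "lflow A 0 x = x"
  using mat_exp_0[of A] by (simp add: lflow_def)

lemma lflow_commute: "lflow A t (A *v x) = A *v lflow A t x"
  by (simp add: lflow_def matrix_vector_mul_assoc mat_exp_commute)

text \<open>The product rule for a moving matrix applied to a moving vector. The hypothesis on
  \<open>X\<close> is entrywise because the derivative of the exponential is available in that
  form.\<close>

lemma matrix_curve_deriv:
  fixes X X' :: "real \<Rightarrow> real^'n^'m"
  assumes X: "\<And>i j. ((\<lambda>t. X t $ i $ j) has_field_derivative D $ i $ j) (at t)"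
    and y: "(y has_vector_derivative y') (at t)"
  shows "((\<lambda>t. X t *v y t) has_vector_derivative (D *v y t + X t *v y')) (at t)"
proof -
  have comp: "((\<lambda>t. y t $ j) has_vector_derivative y' $ j) (at t)" for j
    using has_derivative_compose[OF y[unfolded has_vector_derivative_def] bounded_linear.has_derivative[OF bounded_linear_vec_nth has_derivative_ident]]
    by (simp add: has_vector_derivative_def)
  have "((\<lambda>t. (X t *v y t) \<bullet> b) has_vector_derivative ((D *v y t + X t *v y') \<bullet> b)) (at t)" if "b \<in> Basis" for b
  proof -
    from that obtain i where b: "b = axis i 1" by (auto simp: Basis_vec_def)
    have "((\<lambda>t. \<Sum>j\<in>UNIV. X t $ i $ j * y t $ j) has_vector_derivative
       (\<Sum>j\<in>UNIV. X t $ i $ j * y' $ j + D $ i $ j * y t $ j)) (at t)"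
      using X comp unfolding has_real_derivative_iff_has_vector_derivative
      by (intro derivative_intros has_vector_derivative_mult) auto
    then show ?thesis
      by (simp add: b inner_axis matrix_vector_mult_def sum.distrib add.commute)
  qed
  then show ?thesis
    unfolding has_vector_derivative_def by (subst has_derivative_componentwise_within) auto
qed

lemma lflow_curve_deriv:
  assumes "(y has_vector_derivative y') (at t)"
  shows "((\<lambda>t. lflow A t (y t)) has_vector_derivative (A *v lflow A t (y t) + lflow A t y')) (at t)"
  using matrix_curve_deriv[OF mat_exp_entry_deriv assms]
  by (simp add: lflow_def matrix_vector_mul_assoc)

lemma lflow_deriv: "((\<lambda>t. lflow A t x) has_vector_derivative (A *v lflow A t x)) (at t)"
  using lflow_curve_deriv[of "\<lambda>_. x" 0 t A] by (simp add: lflow_simps has_vector_derivative_const)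

lemma lflow_curve_deriv_neg:
  assumes "(y has_vector_derivative y') (at t)"
  shows "((\<lambda>t. lflow A (- t) (y t)) has_vector_derivative (lflow A (- t) (y' - A *v y t))) (at t)"
proof -
  have "((\<lambda>t. mat_exp ((- t) *\<^sub>R A) $ i $ j) has_field_derivative
      (- (A ** mat_exp ((- t) *\<^sub>R A))) $ i $ j) (at t)" for i j
    using DERIV_chain2[OF mat_exp_entry_deriv[of A i j "- t"] DERIV_minus[OF DERIV_ident]] by simp
  from matrix_curve_deriv[OF this assms]
  have "((\<lambda>t. lflow A (- t) (y t)) has_vector_derivative (- (A *v lflow A (- t) (y t)) + lflow A (- t) y')) (at t)"
    by (simp add: lflow_def matrix_vector_mul_assoc matrix_vector_mult_uminus_left)
  then show ?thesis by (simp add: lflow_simps lflow_commute)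
qed

text \<open>The classical uniqueness argument: e^{-tA} y(t) has derivative zero. It yields the
  inverse of the flow and, through \<open>lflow_ode_unique\<close>, the group law, without
  multiplying exponential series.\<close>

lemma lflow_ode_backward:
  assumes "\<And>t. (y has_vector_derivative A *v y t) (at t)"
  shows "lflow A (- t) (y t) = y 0"
proof -
  have "((\<lambda>t. lflow A (- t) (y t)) has_vector_derivative 0) (at t)" for t
    using lflow_curve_deriv_neg[OF assms, of A t] by (simp add: lflow_simps)
  then have "(\<lambda>t. lflow A (- t) (y t)) t = (\<lambda>t. lflow A (- t) (y t)) 0"
    by (intro has_derivative_zero_unique[of UNIV]) (auto simp: has_vector_derivative_def)
  then show ?thesis by simp
qed

lemma lflow_minus_cancel [simp]: "lflow A (- t) (lflow A t x) = x" "lflow A t (lflow A (- t) x) = x"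
proof -
  have *: "lflow A (- t) (lflow A t x) = x" for t
    using lflow_ode_backward[OF lflow_deriv, of A t x] by (simp only: lflow_0)
  show "lflow A (- t) (lflow A t x) = x" "lflow A t (lflow A (- t) x) = x"
    using *[of t] *[of "- t"] by (simp_all only: minus_minus)
qed

lemma lflow_ode_unique:
  assumes "\<And>t. (y has_vector_derivative A *v y t) (at t)"
  shows "y t = lflow A t (y 0)"
  by (metis assms lflow_minus_cancel(2) lflow_ode_backward)

lemma lflow_add: "lflow A (s + t) x = lflow A s (lflow A t x)"
proof -
  have "((\<lambda>s. lflow A (s + t) x) has_vector_derivative (A *v lflow A (s + t) x)) (at s)" for s
  proof -
    have "((\<lambda>s. s + t) has_vector_derivative 1) (at s)"
      by (auto intro!: derivative_eq_intros)
    from vector_diff_chain_at[OF this lflow_deriv] show ?thesis by (simp add: o_def)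
  qed
  then show ?thesis using lflow_ode_unique[of "\<lambda>s. lflow A (s + t) x" A s] by simp
qed

lemma lflow_eq_0_iff [simp]: "lflow A t x = 0 \<longleftrightarrow> x = 0"
  by (metis lflow_minus_cancel(1) linear_0 linear_lflow)

lemma continuous_mat_exp: "continuous_on UNIV (\<lambda>t. mat_exp (t *\<^sub>R A))"
proof -
  have "continuous_on UNIV (\<lambda>t. mat_exp (t *\<^sub>R A) $ i $ j)" for i j
    by (intro continuous_at_imp_continuous_on ballI DERIV_isCont[OF mat_exp_entry_deriv])
  then have "continuous_on UNIV (\<lambda>t. \<chi> i j. mat_exp (t *\<^sub>R A) $ i $ j)"
    by (intro continuous_on_vec_lambda)
  then show ?thesis by simp
qed

lemma norm_matrix_vector_mult_le: "norm (X *v x) \<le> norm X * norm x" for X :: "real^'n^'m"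
proof -
  have "norm (X *v x) \<le> norm (\<chi> i. norm (X $ i) * norm x)"
  proof (rule norm_le_componentwise_cart)
    fix i
    have "norm ((X *v x) $ i) = \<bar>X $ i \<bullet> x\<bar>"
      by (simp add: matrix_vector_mult_def inner_vec_def)
    then show "norm ((X *v x) $ i) \<le> norm ((\<chi> i. norm (X $ i) * norm x) $ i)"
      by (simp add: abs_mult Cauchy_Schwarz_ineq2)
  qed
  also have "(\<chi> i. norm (X $ i) * norm x) = norm x *\<^sub>R (\<chi> i. norm (X $ i))"
    by (simp add: vec_eq_iff)
  also have "norm \<dots> = norm x * norm X"
    by (simp add: norm_vec_def[of X] norm_vec_def[of "\<chi> i. norm (X $ i)"])
  finally show ?thesis by (simp add: mult.commute)
qed

lemma lflow_norm_bound:
  assumes "T \<ge> 0"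
  shows "\<exists>C\<ge>1. \<forall>t x. \<bar>t\<bar> \<le> T \<longrightarrow> norm (lflow A t x) \<le> C * norm x"
proof -
  have "compact ((\<lambda>t. mat_exp (t *\<^sub>R A)) ` {-T..T})"
    by (intro compact_continuous_image continuous_on_subset[OF continuous_mat_exp]) auto
  then obtain K where K: "\<forall>X\<in>(\<lambda>t. mat_exp (t *\<^sub>R A)) ` {-T..T}. norm X \<le> K"
    using compact_imp_bounded bounded_iff by blast
  have K': "norm (mat_exp (t *\<^sub>R A)) \<le> K" if "\<bar>t\<bar> \<le> T" for t
    using that by (intro K[rule_format] imageI) auto
  have "norm (lflow A t x) \<le> max 1 K * norm x" if "\<bar>t\<bar> \<le> T" for t x
  proof -
    have "norm (lflow A t x) \<le> norm (mat_exp (t *\<^sub>R A)) * norm x"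
      unfolding lflow_def by (rule norm_matrix_vector_mult_le)
    also have "\<dots> \<le> max 1 K * norm x"
      using K'[OF that] by (intro mult_right_mono) auto
    finally show ?thesis .
  qed
  then show ?thesis by (intro exI[of _ "max 1 K"]) auto
qed

lemma continuous_on_lflow [continuous_intros]:
  fixes f :: "'a::topological_space \<Rightarrow> real"
  assumes f: "continuous_on S f" and g: "continuous_on S g"
  shows "continuous_on S (\<lambda>s. lflow A (f s) (g s))"
proof -
  have X: "continuous_on S (\<lambda>s. mat_exp (f s *\<^sub>R A))"
    using continuous_on_compose2[OF continuous_mat_exp f] by auto
  have "continuous_on S (\<lambda>s. \<Sum>j\<in>UNIV. mat_exp (f s *\<^sub>R A) $ i $ j * g s $ j)" for i
    by (intro continuous_on_sum continuous_on_mult continuous_on_component[OF continuous_on_component[OF X]]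
        continuous_on_component[OF g])
  then show ?thesis
    unfolding lflow_def matrix_vector_mult_def by (intro continuous_on_vec_lambda)
qed

text \<open>The partial sums of the exponential series applied to \<open>x\<close> stay in
  \<open>S\<close>, and a subspace of a finite-dimensional space is closed.\<close>

lemma subspace_lflow_invariant:
  assumes S: "subspace S" and inv: "\<And>x. x \<in> S \<Longrightarrow> A *v x \<in> S" and x: "x \<in> S"
  shows "lflow A t x \<in> S"
proof -
  have "(\<lambda>k. mat_pow (t *\<^sub>R A) k /\<^sub>R fact k) sums mat_exp (t *\<^sub>R A)"
    by (rule mat_exp_sums')
  moreover have "bounded_linear (\<lambda>X::real^'a^'a. X *v x)"
    by (intro linear_conv_bounded_linear[THEN iffD1] linearI)
       (simp_all add: matrix_vector_mult_add_rdistrib matrix_vector_mult_scaleR_left)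
  ultimately have "(\<lambda>k. (mat_pow (t *\<^sub>R A) k /\<^sub>R fact k) *v x) sums lflow A t x"
    unfolding lflow_def by (rule bounded_linear.sums[rotated])
  moreover have "mat_pow A k *v x \<in> S" for k
    using x inv by (induction k) (simp_all add: matrix_vector_mul_assoc[symmetric])
  then have "(mat_pow (t *\<^sub>R A) k /\<^sub>R fact k) *v x \<in> S" for k
    using S by (simp add: mat_pow_scaleR matrix_vector_mult_scaleR_left subspace_scale)
  then have "(\<Sum>k<n. (mat_pow (t *\<^sub>R A) k /\<^sub>R fact k) *v x) \<in> S" for n
    using S by (intro subspace_sum) auto
  ultimately show ?thesis
    unfolding sums_def using closed_subspace[OF S] by (metis (no_types, lifting) closed_sequentially)
qed

section \<open>Spectral decomposition\<close>

definition cmul :: "real^'n^'n \<Rightarrow> complex^'n \<Rightarrow> complex^'n" where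
  "cmul A w = map_matrix complex_of_real A *v w"

definition cshift :: "real^'n^'n \<Rightarrow> complex \<Rightarrow> complex^'n \<Rightarrow> complex^'n" where
  "cshift A \<mu> w = cmul A w - \<mu> *s w"

definition vec_Re :: "complex^'n \<Rightarrow> real^'n" where "vec_Re w = (\<chi> i. Re (w $ i))"
definition vec_Im :: "complex^'n \<Rightarrow> real^'n" where "vec_Im w = (\<chi> i. Im (w $ i))"

lemma gen_eigenspace_iff: "v \<in> gen_eigenspace A \<mu> \<longleftrightarrow> (\<exists>k. (cshift A \<mu> ^^ k) v = 0)"
  by (simp add: gen_eigenspace_def cshift_def[abs_def] cmul_def)

lemma linear_cmul_op: "linear (cmul A)"
  unfolding cmul_def by (rule matrix_vector_mul_linear)

lemma linear_vector_smult: "linear ((*s) c)" for c :: complex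
  by (rule linearI) (simp_all add: vec_eq_iff distrib_left)

lemma linear_cshift: "linear (cshift A \<mu>)"
  unfolding cshift_def[abs_def] by (intro linear_compose_sub linear_cmul_op linear_vector_smult)

lemma linear_vec_Re: "linear vec_Re" and linear_vec_Im: "linear vec_Im"
  by (rule linearI; simp add: vec_Re_def vec_Im_def vec_eq_iff)+

lemma cmul_smult: "cmul A (c *s w) = c *s cmul A w"
  by (simp add: cmul_def vector_scalar_commute)

lemma cshift_smult: "cshift A \<mu> (c *s w) = c *s cshift A \<mu> w"
  by (simp add: cshift_def cmul_smult vec_eq_iff algebra_simps)

lemma linear_funpow: "linear (f :: 'a::real_vector \<Rightarrow> 'a) \<Longrightarrow> linear (f ^^ k)"
proof (induction k)
  case (Suc k)
  then show ?case using linear_compose[of "f ^^ k" f] by (simp add: o_def)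
qed (simp add: linear_id[unfolded id_def] id_def)

lemma linear_cshift_pow: "linear (cshift A \<mu> ^^ k)"
  by (rule linear_funpow[OF linear_cshift])

lemma cshift_pow_smult: "(cshift A \<mu> ^^ k) (c *s w) = c *s (cshift A \<mu> ^^ k) w"
  by (induction k) (simp_all add: cshift_smult)

lemma cshift_pow_mono:
  assumes "(cshift A \<mu> ^^ k) v = 0" "k \<le> m"
  shows "(cshift A \<mu> ^^ m) v = 0"
proof -
  have "(cshift A \<mu> ^^ m) v = (cshift A \<mu> ^^ (m - k)) ((cshift A \<mu> ^^ k) v)"
    using assms(2) by (simp flip: funpow_add o_apply[of "cshift A \<mu> ^^ (m - k)"])
  then show ?thesis by (simp add: assms(1) linear_0[OF linear_cshift_pow])
qed

lemma subspace_gen_eigenspace: "subspace (gen_eigenspace A \<mu>)"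
proof (rule subspaceI)
  show "0 \<in> gen_eigenspace A \<mu>"
    unfolding gen_eigenspace_iff by (rule exI[of _ 0]) simp
  show "c *\<^sub>R x \<in> gen_eigenspace A \<mu>" if x: "x \<in> gen_eigenspace A \<mu>" for c x
    using x unfolding gen_eigenspace_iff by (metis linear_cshift_pow linear_cmul_op scaleR_zero_right linear_scale)
  show "x + y \<in> gen_eigenspace A \<mu>" if "x \<in> gen_eigenspace A \<mu>" "y \<in> gen_eigenspace A \<mu>" for x y
  proof -
    from that obtain k m where "(cshift A \<mu> ^^ k) x = 0" "(cshift A \<mu> ^^ m) y = 0"
      unfolding gen_eigenspace_iff by blast
    then have "(cshift A \<mu> ^^ max k m) x = 0" "(cshift A \<mu> ^^ max k m) y = 0"
      using cshift_pow_mono by (meson max.cobounded1 max.cobounded2)+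
    then show ?thesis
      unfolding gen_eigenspace_iff by (intro exI[of _ "max k m"]) (simp add: linear_add[OF linear_cshift_pow])
  qed
qed

lemma gen_eigenspace_smult: "w \<in> gen_eigenspace A \<mu> \<Longrightarrow> c *s w \<in> gen_eigenspace A \<mu>"
  unfolding gen_eigenspace_iff by (auto simp: cshift_pow_smult)

lemma gen_eigenspace_cshift: "cshift A \<mu> w \<in> gen_eigenspace A \<mu> \<longleftrightarrow> w \<in> gen_eigenspace A \<mu>"
proof
  assume "cshift A \<mu> w \<in> gen_eigenspace A \<mu>"
  then obtain k where "(cshift A \<mu> ^^ Suc k) w = 0"
    unfolding gen_eigenspace_iff by (auto simp: funpow_Suc_right simp del: funpow.simps)
  then show "w \<in> gen_eigenspace A \<mu>" unfolding gen_eigenspace_iff by blast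
next
  assume "w \<in> gen_eigenspace A \<mu>"
  then obtain k where "(cshift A \<mu> ^^ k) w = 0" unfolding gen_eigenspace_iff by blast
  then have "(cshift A \<mu> ^^ Suc k) w = 0" by (simp add: linear_0[OF linear_cshift])
  then show "cshift A \<mu> w \<in> gen_eigenspace A \<mu>"
    unfolding gen_eigenspace_iff by (auto simp: funpow_Suc_right simp del: funpow.simps)
qed

lemma gen_eigenspace_cmul:
  assumes "w \<in> gen_eigenspace A \<mu>"
  shows "cmul A w \<in> gen_eigenspace A \<mu>"
proof -
  have "cmul A w = cshift A \<mu> w + \<mu> *s w" by (simp add: cshift_def)
  then show ?thesis
    using assms by (simp add: subspace_add[OF subspace_gen_eigenspace] gen_eigenspace_smult gen_eigenspace_cshift)
qed

text \<open>Induction on the order of nilpotency. If (A - \<mu>)v = (A - \<nu>)w, then (A - \<mu>)(w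
  - v) = (\<nu> - \<mu>)w, so w - v only has to be divided by \<nu> - \<mu>.\<close>

lemma gen_eigenspace_resolvent:
  assumes "w \<in> gen_eigenspace A \<nu>" "\<nu> \<noteq> \<mu>"
  shows "\<exists>v\<in>gen_eigenspace A \<nu>. cshift A \<mu> v = w"
proof -
  obtain k where "(cshift A \<nu> ^^ k) w = 0"
    using assms(1) unfolding gen_eigenspace_iff by blast
  then show ?thesis
  proof (induction k arbitrary: w)
    case 0
    then show ?case
      by (intro bexI[of _ 0]) (simp_all add: subspace_0[OF subspace_gen_eigenspace] linear_0[OF linear_cshift])
  next
    case (Suc k)
    let ?c = "1 / (\<nu> - \<mu>)"
    have "(cshift A \<nu> ^^ k) (cshift A \<nu> w) = 0"
      using Suc.prems by (simp add: funpow_swap1)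
    then obtain v where v: "v \<in> gen_eigenspace A \<nu>" "cshift A \<mu> v = cshift A \<nu> w"
      using Suc.IH by blast
    have w: "w \<in> gen_eigenspace A \<nu>" using Suc.prems unfolding gen_eigenspace_iff by blast
    have "cshift A \<mu> (?c *s (w - v)) = ?c *s (cshift A \<mu> w - cshift A \<nu> w)"
      by (simp add: cshift_smult linear_diff[OF linear_cshift] v(2))
    also have "cshift A \<mu> w - cshift A \<nu> w = (\<nu> - \<mu>) *s w"
      by (simp add: cshift_def vec_eq_iff algebra_simps)
    also have "?c *s ((\<nu> - \<mu>) *s w) = (?c * (\<nu> - \<mu>)) *s w" by (simp only: vector_smult_assoc)
    also have "\<dots> = w" using assms(2) by simp
    finally show ?case
      using v(1) w by (intro bexI[of _ "?c *s (w - v)"])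
        (auto intro: gen_eigenspace_smult subspace_diff[OF subspace_gen_eigenspace])
  qed
qed

section \<open>The generalized eigenspaces span the complex space\<close>

abbreviation gen_span :: "real^'n^'n \<Rightarrow> (complex^'n) set" where
  "gen_span A \<equiv> span (\<Union>\<mu>. gen_eigenspace A \<mu>)"

lemma linear_span_invariant:
  assumes "linear f" "\<And>x. x \<in> G \<Longrightarrow> f x \<in> span G" "x \<in> span G"
  shows "f x \<in> span G"
  using assms(3)
proof (rule span_induct)
  show "subspace {x. f x \<in> span G}"
    using linear_subspace_vimage[OF assms(1) subspace_span] by (simp add: vimage_def)
qed (use assms in auto)

text \<open>\<open>span\<close> is the real span; it is closed under complex scalars because every
  generalized eigenspace is.\<close>

lemma gen_span_smult: "w \<in> gen_span A \<Longrightarrow> c *s w \<in> gen_span A"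
  by (rule linear_span_invariant[OF linear_vector_smult]) (auto intro: span_base gen_eigenspace_smult)

text \<open>It suffices to check generators: a vector of the generalized eigenspace of \<mu> is its
  own first summand, and any other generator is an image under A - \<mu> by
  \<open>gen_eigenspace_resolvent\<close>.\<close>

lemma gen_span_cshift_decomp:
  assumes "w \<in> gen_span A"
  shows "\<exists>w0 v. w0 \<in> gen_eigenspace A \<mu> \<and> v \<in> gen_span A \<and> w = w0 + cshift A \<mu> v"
  using assms
proof (rule span_induct)
  let ?P = "{w. \<exists>w0 v. w0 \<in> gen_eigenspace A \<mu> \<and> v \<in> gen_span A \<and> w = w0 + cshift A \<mu> v}"
  have "?P = {x + y |x y. x \<in> gen_eigenspace A \<mu> \<and> y \<in> cshift A \<mu> ` gen_span A}" by blast
  moreover have "subspace \<dots>"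
    by (intro subspace_sums subspace_gen_eigenspace linear_subspace_image[OF linear_cshift] subspace_span)
  ultimately show "subspace ?P" by simp
next
  fix w assume "w \<in> (\<Union>\<nu>. gen_eigenspace A \<nu>)"
  then obtain \<nu> where \<nu>: "w \<in> gen_eigenspace A \<nu>" by blast
  show "\<exists>w0 v. w0 \<in> gen_eigenspace A \<mu> \<and> v \<in> gen_span A \<and> w = w0 + cshift A \<mu> v"
  proof (cases "\<nu> = \<mu>")
    case True
    then show ?thesis
      using \<nu> by (intro exI[of _ w] exI[of _ 0]) (simp add: linear_0[OF linear_cshift] span_0)
  next
    case False
    then obtain v where "v \<in> gen_eigenspace A \<nu>" "cshift A \<mu> v = w"
      using gen_eigenspace_resolvent[OF \<nu>] by blast
    then show ?thesis
      by (intro exI[of _ 0] exI[of _ v]) (auto intro: span_base simp: subspace_0[OF subspace_gen_eigenspace])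
  qed
qed

text \<open>After subtracting \<open>v'\<close>, the operator A - \<mu> maps the rest into the
  generalized eigenspace of \<mu>, so the rest lies there itself. This cancels one linear factor of
  a polynomial in \<open>A\<close>.\<close>

lemma gen_span_cshiftD:
  assumes "cshift A \<mu> v \<in> gen_span A"
  shows "v \<in> gen_span A"
proof -
  obtain w0 v' where *: "w0 \<in> gen_eigenspace A \<mu>" "v' \<in> gen_span A" "cshift A \<mu> v = w0 + cshift A \<mu> v'"
    using gen_span_cshift_decomp[OF assms, of \<mu>] by blast
  then have "cshift A \<mu> (v - v') \<in> gen_eigenspace A \<mu>"
    by (simp add: linear_diff[OF linear_cshift])
  then have "v - v' \<in> gen_span A"
    unfolding gen_eigenspace_cshift by (auto intro: span_base)
  with *(2) show ?thesis using span_add by fastforce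
qed

text \<open>The vector p(A) v on the complexified space.\<close>

definition poly_act :: "real^'n^'n \<Rightarrow> complex poly \<Rightarrow> complex^'n \<Rightarrow> complex^'n" where
  "poly_act A p v = (\<Sum>i\<le>degree p. coeff p i *s (cmul A ^^ i) v)"

lemma poly_act_altdef:
  assumes "degree p \<le> N"
  shows "poly_act A p v = (\<Sum>i\<le>N. coeff p i *s (cmul A ^^ i) v)"
  unfolding poly_act_def
  by (rule sum.mono_neutral_left) (use assms in \<open>auto simp: coeff_eq_0 not_le\<close>)

lemma poly_act_linear_factor: "poly_act A ([:-\<mu>, 1:] * q) v = cshift A \<mu> (poly_act A q v)"
proof -
  let ?d = "degree q" and ?f = "\<lambda>i. (cmul A ^^ i) v"
  have eq: "[:-\<mu>, 1:] * q = pCons 0 q - smult \<mu> q" by simp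
  have deg: "degree (pCons 0 q - smult \<mu> q) \<le> Suc ?d"
    by (intro degree_diff_le) (auto simp: degree_pCons_le intro: le_trans[OF degree_smult_le])
  have "poly_act A ([:-\<mu>, 1:] * q) v = (\<Sum>i\<le>Suc ?d. coeff (pCons 0 q - smult \<mu> q) i *s ?f i)"
    unfolding eq by (rule poly_act_altdef[OF deg])
  also have "\<dots> = (\<Sum>i\<le>Suc ?d. coeff (pCons 0 q) i *s ?f i) - (\<Sum>i\<le>Suc ?d. (\<mu> * coeff q i) *s ?f i)"
    unfolding sum_subtractf[symmetric] by (rule sum.cong) (simp_all add: vec_eq_iff algebra_simps)
  also have "(\<Sum>i\<le>Suc ?d. coeff (pCons 0 q) i *s ?f i) = (\<Sum>i\<le>?d. coeff q i *s ?f (Suc i))"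
    by (simp add: sum.atMost_Suc_shift del: sum.atMost_Suc)
  also have "\<dots> = cmul A (poly_act A q v)"
    by (simp add: poly_act_def linear_sum[OF linear_cmul_op] cmul_smult)
  also have "(\<Sum>i\<le>Suc ?d. (\<mu> * coeff q i) *s ?f i) = \<mu> *s poly_act A q v"
    unfolding poly_act_altdef[of q "Suc ?d", OF le_SucI[OF order_refl]]
    by (subst linear_sum[OF linear_vector_smult]) (simp add: vec_eq_iff)
  finally show ?thesis by (simp add: cshift_def)
qed

text \<open>The fundamental theorem of algebra supplies a root \<mu> of \<open>p\<close>, and
  \<open>gen_span_cshiftD\<close> removes the factor A - \<mu>. For an annihilating polynomial the
  hypothesis holds for every \<open>v\<close>.\<close>

lemma gen_span_poly_actD:
  assumes "p \<noteq> 0" "poly_act A p v \<in> gen_span A"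
  shows "v \<in> gen_span A"
  using assms
proof (induction "degree p" arbitrary: p rule: less_induct)
  case less
  show ?case
  proof (cases "degree p = 0")
    case True
    then obtain c where c: "p = [:c:]" by (rule degree_eq_zeroE)
    with less.prems have "c \<noteq> 0" "c *s v \<in> gen_span A"
      by (auto simp: poly_act_def)
    moreover have "v = inverse c *s (c *s v)" using \<open>c \<noteq> 0\<close> by (simp add: vec_eq_iff)
    ultimately show ?thesis using gen_span_smult by metis
  next
    case False
    then obtain \<mu> where "poly p \<mu> = 0" using alg_closed_imp_poly_has_root by blast
    then obtain q where q: "p = [:-\<mu>, 1:] * q" by (auto simp: poly_eq_0_iff_dvd)
    with less.prems have "q \<noteq> 0" by auto
    then have "degree p = Suc (degree q)" unfolding q by (subst degree_mult_eq) auto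
    moreover have "poly_act A q v \<in> gen_span A"
      using less.prems(2) unfolding q poly_act_linear_factor by (rule gen_span_cshiftD)
    ultimately show ?thesis using less.hyps[of q] \<open>q \<noteq> 0\<close> by simp
  qed
qed

text \<open>Dependence of the set of values does not see repetitions, so a repeated value is treated
  separately, with the relation f i - f j = 0.\<close>

lemma sequence_dependent:
  fixes f :: "nat \<Rightarrow> 'a::euclidean_space"
  shows "\<exists>c N. (\<exists>i\<le>N. c i \<noteq> (0::real)) \<and> (\<Sum>i\<le>N. c i *\<^sub>R f i) = 0"
proof (cases "inj_on f {..DIM('a)}")
  case True
  let ?S = "f ` {..DIM('a)}"
  have "card ?S > DIM('a)" using True by (simp add: card_image)
  then have "dependent ?S" using independent_bound[of ?S] by fastforce
  then obtain u where u: "\<exists>v\<in>?S. u v \<noteq> 0" "(\<Sum>v\<in>?S. u v *\<^sub>R v) = 0"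
    by (auto simp: dependent_finite)
  then have "(\<Sum>i\<le>DIM('a). u (f i) *\<^sub>R f i) = 0"
    using True by (simp add: sum.reindex)
  with u(1) show ?thesis by (intro exI[of _ "u \<circ> f"] exI[of _ "DIM('a)"]) auto
next
  case False
  then obtain i j where ij: "i \<noteq> j" "f i = f j" "i \<le> DIM('a)" "j \<le> DIM('a)"
    unfolding inj_on_def by auto
  let ?c = "\<lambda>k. (if k = i then 1 else 0) - (if k = j then 1 else (0::real))"
  have "(\<Sum>k\<le>DIM('a). ?c k *\<^sub>R f k) =
      (\<Sum>k\<le>DIM('a). if k = i then f k else 0) - (\<Sum>k\<le>DIM('a). if k = j then f k else 0)"
    unfolding sum_subtractf[symmetric] by (rule sum.cong) auto
  then have "(\<Sum>k\<le>DIM('a). ?c k *\<^sub>R f k) = 0"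
    using ij by simp
  then show ?thesis using ij by (intro exI[of _ ?c] exI[of _ "DIM('a)"]) auto
qed

lemma cmul_pow: "(cmul A ^^ i) v = map_matrix complex_of_real (mat_pow A i) *v v"
proof (induction i)
  case 0
  have "map_matrix complex_of_real (mat 1) = (mat 1 :: complex^'a^'a)"
    by (simp add: vec_eq_iff mat_def map_matrix_def)
  then show ?case by simp
next
  case (Suc i)
  have "map_matrix complex_of_real (A ** B) = map_matrix complex_of_real A ** map_matrix complex_of_real B" for B :: "real^'a^'a"
    by (simp add: vec_eq_iff matrix_matrix_mult_def map_matrix_def)
  with Suc show ?case by (simp add: cmul_def matrix_vector_mul_assoc)
qed

text \<open>The powers of \<open>A\<close> form a sequence in the finite-dimensional space of
  matrices; a nontrivial linear relation among them gives the coefficients of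
  \<open>p\<close>.\<close>

lemma annihilating_poly:
  fixes A :: "real^'n^'n"
  shows "\<exists>p. p \<noteq> 0 \<and> (\<forall>v. poly_act A p v = 0)"
proof -
  obtain c N where c: "\<exists>i\<le>N. c i \<noteq> (0::real)" "(\<Sum>i\<le>N. c i *\<^sub>R mat_pow A i) = 0"
    using sequence_dependent[of "mat_pow A"] by blast
  define p where "p = (\<Sum>i\<le>N. monom (complex_of_real (c i)) i)"
  have coeff: "coeff p i = (if i \<le> N then complex_of_real (c i) else 0)" for i
    unfolding p_def by (simp add: coeff_sum)
  have "p \<noteq> 0"
  proof
    assume "p = 0"
    with coeff c(1) show False by (metis coeff_0 of_real_eq_0_iff)
  qed
  moreover have "poly_act A p v = 0" for v
  proof -
    have "degree p \<le> N" by (rule degree_le) (simp add: coeff)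
    then have "poly_act A p v = (\<Sum>i\<le>N. complex_of_real (c i) *s (map_matrix complex_of_real (mat_pow A i) *v v))"
      by (simp add: poly_act_altdef coeff cmul_pow)
    moreover have "(\<Sum>i\<le>N. complex_of_real (c i) *s (map_matrix complex_of_real (mat_pow A i) *v v)) $ j = 0" for j
    proof -
      have z: "(\<Sum>i\<le>N. c i * mat_pow A i $ j $ l) = 0" for l
        using arg_cong[OF c(2), of "\<lambda>M. M $ j $ l"] by simp
      have "(\<Sum>i\<le>N. complex_of_real (c i) *s (map_matrix complex_of_real (mat_pow A i) *v v)) $ j
          = (\<Sum>i\<le>N. \<Sum>l\<in>UNIV. complex_of_real (c i * mat_pow A i $ j $ l) * v $ l)"
        by (simp add: matrix_vector_mult_def map_matrix_def sum_distrib_left mult.assoc)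
      also have "\<dots> = (\<Sum>l\<in>UNIV. \<Sum>i\<le>N. complex_of_real (c i * mat_pow A i $ j $ l) * v $ l)"
        by (rule sum.swap)
      also have "\<dots> = (\<Sum>l\<in>UNIV. complex_of_real (\<Sum>i\<le>N. c i * mat_pow A i $ j $ l) * v $ l)"
        by (simp add: sum_distrib_right)
      finally show ?thesis by (simp only: z) simp
    qed
    ultimately show ?thesis by (simp add: vec_eq_iff)
  qed
  ultimately show ?thesis by blast
qed

lemma gen_span_UNIV: "gen_span A = UNIV"
proof -
  obtain p where "p \<noteq> 0" "\<And>v. poly_act A p v = 0" using annihilating_poly[of A] by blast
  then show ?thesis using gen_span_poly_actD[of p A] span_0 by (metis UNIV_eq_I)
qed

text \<open>On an eigenvector p(A) acts as multiplication by p(\<mu>), so every eigenvalue is a root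
  of an annihilating polynomial.\<close>

lemma finite_eigenvalues: "finite (eigenvalues A)"
proof -
  obtain p where p: "p \<noteq> 0" "\<And>v. poly_act A p v = 0" using annihilating_poly[of A] by blast
  have "eigenvalues A \<subseteq> {\<mu>. poly p \<mu> = 0}"
  proof
    fix \<mu> assume "\<mu> \<in> eigenvalues A"
    then obtain v where v: "v \<noteq> 0" "cmul A v = \<mu> *s v"
      by (auto simp: eigenvalues_def cmul_def)
    have "(cmul A ^^ i) v = \<mu> ^ i *s v" for i
      by (induction i) (simp_all add: cmul_smult v(2) vector_smult_assoc)
    then have "poly_act A p v = poly p \<mu> *s v"
      by (simp add: poly_act_def poly_altdef vec_eq_iff sum_distrib_right mult.assoc)
    with p(2) v(1) show "\<mu> \<in> {\<mu>. poly p \<mu> = 0}" by (auto simp: vec_eq_iff)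
  qed
  then show ?thesis using poly_roots_finite[OF p(1)] finite_subset by blast
qed

lemma finite_lyapunov_exponents: "finite (lyapunov_exponents A)"
  by (simp add: lyapunov_exponents_def finite_eigenvalues)

section \<open>Sums of Lyapunov spaces over sets of exponents\<close>

lemma gen_eigenspace_trivial:
  assumes "\<mu> \<notin> eigenvalues A" "w \<in> gen_eigenspace A \<mu>"
  shows "w = 0"
proof -
  obtain k where "(cshift A \<mu> ^^ k) w = 0" using assms(2) gen_eigenspace_iff by blast
  then show ?thesis
  proof (induction k)
    case (Suc k)
    have "cshift A \<mu> ((cshift A \<mu> ^^ k) w) = 0" using Suc.prems by simp
    then have "(cshift A \<mu> ^^ k) w = 0"
      using assms(1) by (auto simp: eigenvalues_def cshift_def cmul_def)
    then show ?case by (rule Suc.IH)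
  qed simp
qed

text \<open>Arbitrary real sets \<open>S\<close> are allowed so that the half-lines
  \<open>{..c}\<close> and \<open>{c<..}\<close> describe the two sides of a spectral gap.\<close>

definition lyapunov_sum :: "real^'n^'n \<Rightarrow> real set \<Rightarrow> (real^'n) set" where
  "lyapunov_sum A S = span (\<Union>\<mu>\<in>{\<mu> \<in> eigenvalues A. Re \<mu> \<in> S}. real_gen_eigenspace A \<mu>)"

lemma lyapunov_sum_singleton: "lyapunov_sum A {lam} = lyapunov_space A lam"
  by (simp add: lyapunov_sum_def lyapunov_space_def)

lemma real_gen_eigenspace_eq: "real_gen_eigenspace A \<mu> = vec_Re ` gen_eigenspace A \<mu>"
  by (simp add: real_gen_eigenspace_def vec_Re_def)

text \<open>A real vector is the real part of itself viewed in the complex space, which the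
  generalized eigenspaces span; those belonging to no eigenvalue are zero.\<close>

lemma lyapunov_sum_UNIV: "lyapunov_sum A UNIV = UNIV"
proof -
  have "x \<in> lyapunov_sum A UNIV" for x
  proof -
    let ?w = "(\<chi> i. complex_of_real (x $ i))"
    have "vec_Re ?w \<in> vec_Re ` gen_span A" by (simp add: gen_span_UNIV)
    also have "\<dots> = span (vec_Re ` (\<Union>\<mu>. gen_eigenspace A \<mu>))"
      by (rule linear_span_image[OF linear_vec_Re, symmetric])
    also have "\<dots> \<subseteq> lyapunov_sum A UNIV"
      unfolding lyapunov_sum_def
    proof (rule span_minimal[OF _ subspace_span], safe)
      fix \<mu> w assume w: "w \<in> gen_eigenspace A \<mu>"
      show "vec_Re w \<in> span (\<Union>\<mu>\<in>{\<mu> \<in> eigenvalues A. Re \<mu> \<in> UNIV}. real_gen_eigenspace A \<mu>)"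
      proof (cases "\<mu> \<in> eigenvalues A")
        case True
        with w show ?thesis by (intro span_base) (auto simp: real_gen_eigenspace_eq)
      next
        case False
        with w show ?thesis
          using gen_eigenspace_trivial linear_0[OF linear_vec_Re] span_0 by metis
      qed
    qed
    finally show ?thesis by (simp add: vec_Re_def)
  qed
  then show ?thesis by blast
qed

lemma subspace_lyapunov_sum: "subspace (lyapunov_sum A S)"
  by (simp add: lyapunov_sum_def)

lemma lyapunov_sum_mono:
  "S \<inter> lyapunov_exponents A \<subseteq> T \<Longrightarrow> lyapunov_sum A S \<subseteq> lyapunov_sum A T"
  unfolding lyapunov_sum_def by (rule span_mono) (auto simp: lyapunov_exponents_def)

lemma lyapunov_sum_Un: "lyapunov_sum A (S \<union> T) = {x + y |x y. x \<in> lyapunov_sum A S \<and> y \<in> lyapunov_sum A T}"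
proof -
  have "(\<Union>\<mu>\<in>{\<mu> \<in> eigenvalues A. Re \<mu> \<in> S \<union> T}. real_gen_eigenspace A \<mu>) =
      (\<Union>\<mu>\<in>{\<mu> \<in> eigenvalues A. Re \<mu> \<in> S}. real_gen_eigenspace A \<mu>) \<union>
      (\<Union>\<mu>\<in>{\<mu> \<in> eigenvalues A. Re \<mu> \<in> T}. real_gen_eigenspace A \<mu>)" by blast
  then show ?thesis unfolding lyapunov_sum_def by (simp only: span_Un)
qed

lemma vec_Re_cmul: "vec_Re (cmul A w) = A *v vec_Re w"
  and vec_Im_cmul: "vec_Im (cmul A w) = A *v vec_Im w"
  by (simp_all add: vec_eq_iff vec_Re_def vec_Im_def cmul_def matrix_vector_mult_def map_matrix_def)

lemma lyapunov_sum_lflow: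
  assumes "x \<in> lyapunov_sum A S"
  shows "lflow A t x \<in> lyapunov_sum A S"
proof (rule subspace_lflow_invariant[OF subspace_lyapunov_sum _ assms])
  fix x assume "x \<in> lyapunov_sum A S"
  then show "A *v x \<in> lyapunov_sum A S"
    unfolding lyapunov_sum_def
  proof (rule linear_span_invariant[OF matrix_vector_mul_linear, rotated])
    fix y assume "y \<in> (\<Union>\<mu>\<in>{\<mu> \<in> eigenvalues A. Re \<mu> \<in> S}. real_gen_eigenspace A \<mu>)"
    then obtain \<mu> w where *: "\<mu> \<in> eigenvalues A" "Re \<mu> \<in> S" "w \<in> gen_eigenspace A \<mu>" "y = vec_Re w"
      by (auto simp: real_gen_eigenspace_eq)
    then have "A *v y = vec_Re (cmul A w)" "cmul A w \<in> gen_eigenspace A \<mu>"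
      by (auto simp: vec_Re_cmul gen_eigenspace_cmul)
    with * show "A *v y \<in> span (\<Union>\<mu>\<in>{\<mu> \<in> eigenvalues A. Re \<mu> \<in> S}. real_gen_eigenspace A \<mu>)"
      by (intro span_base) (auto simp: real_gen_eigenspace_eq)
  qed
qed

section \<open>Growth rates on Lyapunov spaces\<close>

text \<open>The complexification of \<open>lflow\<close>. Its complex linearity
  (\<open>cflow_smult\<close>) is what permits multiplying by e^{-\<mu>t}.\<close>

definition cflow :: "real^'n^'n \<Rightarrow> real \<Rightarrow> complex^'n \<Rightarrow> complex^'n" where
  "cflow A t w = (\<chi> i. Complex (lflow A t (vec_Re w) $ i) (lflow A t (vec_Im w) $ i))"

lemma cflow_0: "cflow A 0 w = w"
  by (simp add: cflow_def vec_eq_iff vec_Re_def vec_Im_def)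

lemma lflow_component_deriv:
  "((\<lambda>t. lflow A t x $ i) has_field_derivative (lflow A t (A *v x) $ i)) (at t)"
proof -
  have "((\<lambda>t. lflow A t x $ i) has_vector_derivative ((A *v lflow A t x) $ i)) (at t)"
    using bounded_linear.has_vector_derivative[OF bounded_linear_vec_nth lflow_deriv] .
  then show ?thesis by (simp add: has_real_derivative_iff_has_vector_derivative lflow_commute)
qed

lemma cflow_smult: "cflow A t (c *s w) = c *s cflow A t w"
proof -
  have "vec_Re (c *s w) = Re c *\<^sub>R vec_Re w - Im c *\<^sub>R vec_Im w"
    "vec_Im (c *s w) = Re c *\<^sub>R vec_Im w + Im c *\<^sub>R vec_Re w"
    by (simp_all add: vec_Re_def vec_Im_def vec_eq_iff)
  then have "lflow A t (vec_Re (c *s w)) = Re c *\<^sub>R lflow A t (vec_Re w) - Im c *\<^sub>R lflow A t (vec_Im w)"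
    "lflow A t (vec_Im (c *s w)) = Re c *\<^sub>R lflow A t (vec_Im w) + Im c *\<^sub>R lflow A t (vec_Re w)"
    by (simp_all only: lflow_simps)
  then show ?thesis
    by (simp add: cflow_def vec_eq_iff complex_eq_iff)
qed

lemma cflow_diff: "cflow A t (v - w) = cflow A t v - cflow A t w"
  by (simp add: cflow_def vec_eq_iff lflow_simps complex_eq_iff linear_diff[OF linear_vec_Re]
      linear_diff[OF linear_vec_Im])

lemma cflow_component_deriv:
  "((\<lambda>t. cflow A t w $ i) has_vector_derivative cflow A t (cmul A w) $ i) (at t)"
  unfolding has_vector_derivative_complex_iff
  by (simp add: cflow_def lflow_component_deriv vec_Re_cmul vec_Im_cmul)

text \<open>Twisting by e^{-\<mu>t} replaces A by A - \<mu> in the derivative, so on a generalized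
  eigenspace each differentiation lowers the order of nilpotency.\<close>

lemma twisted_cflow_deriv:
  "((\<lambda>t. exp (- \<mu> * of_real t) * cflow A t w $ i) has_vector_derivative
     exp (- \<mu> * of_real t) * cflow A t (cshift A \<mu> w) $ i) (at t)"
proof -
  have "((\<lambda>t. exp (- \<mu> * of_real t)) has_vector_derivative (- \<mu> * exp (- \<mu> * of_real t))) (at t)"
    by (rule has_vector_derivative_real_field) (auto intro!: derivative_eq_intros)
  from has_vector_derivative_mult[OF this cflow_component_deriv[of A w i t]]
  show ?thesis
    by (rule has_vector_derivative_eq_rhs) (simp add: cshift_def cflow_diff cflow_smult algebra_simps)
qed

text \<open>The twisted orbit is a polynomial in t; only the growth matters. The bound for the
  derivative comes from the induction hypothesis at \<open>cshift A \<mu> w\<close>, and the mean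
  value inequality raises the power by one.\<close>

lemma twisted_cflow_bound:
  assumes "(cshift A \<mu> ^^ k) w = 0"
  shows "\<exists>C\<ge>0. \<forall>t i. norm (exp (- \<mu> * of_real t) * cflow A t w $ i) \<le> C * (1 + \<bar>t\<bar>) ^ k"
  using assms
proof (induction k arbitrary: w)
  case 0
  then have "cflow A t w = 0" for t
    using cflow_diff[of A t w w] by simp
  then show ?case by (intro exI[of _ 0]) simp
next
  case (Suc k)
  have "(cshift A \<mu> ^^ k) (cshift A \<mu> w) = 0"
    using Suc.prems by (simp add: funpow_swap1)
  then obtain C where C: "C \<ge> 0"
    "\<And>t i. norm (exp (- \<mu> * of_real t) * cflow A t (cshift A \<mu> w) $ i) \<le> C * (1 + \<bar>t\<bar>) ^ k"
    using Suc.IH by blast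
  let ?g = "\<lambda>t i. exp (- \<mu> * of_real t) * cflow A t w $ i"
  have "norm (?g t i) \<le> (norm w + C) * (1 + \<bar>t\<bar>) ^ Suc k" for t i
  proof -
    have "norm (?g t i - ?g 0 i) \<le> (C * (1 + \<bar>t\<bar>) ^ k) * norm (t - 0)"
    proof (rule differentiable_bound[of "{-\<bar>t\<bar>..\<bar>t\<bar>}"])
      fix s assume s: "s \<in> {-\<bar>t\<bar>..\<bar>t\<bar>}"
      let ?d = "exp (- \<mu> * of_real s) * cflow A s (cshift A \<mu> w) $ i"
      show "((\<lambda>t. ?g t i) has_derivative (\<lambda>h. h *\<^sub>R ?d)) (at s within {-\<bar>t\<bar>..\<bar>t\<bar>})"
        using twisted_cflow_deriv[of \<mu> A w i s]
        unfolding has_vector_derivative_def by (rule has_derivative_at_withinI)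
      have "norm ?d \<le> C * (1 + \<bar>t\<bar>) ^ k"
        using s C(1) by (intro order_trans[OF C(2)] mult_left_mono power_mono) auto
      then show "onorm (\<lambda>h. h *\<^sub>R ?d) \<le> C * (1 + \<bar>t\<bar>) ^ k"
        by (simp add: onorm_scaleR_left onorm_id bounded_linear_ident)
    qed auto
    moreover have "norm (?g 0 i) \<le> norm w" by (simp add: cflow_0 Finite_Cartesian_Product.norm_nth_le)
    ultimately have "norm (?g t i) \<le> norm w * 1 + C * ((1 + \<bar>t\<bar>) ^ k * \<bar>t\<bar>)"
      using norm_triangle_sub[of "?g t i" "?g 0 i"] by simp
    also have "\<dots> \<le> norm w * (1 + \<bar>t\<bar>) ^ Suc k + C * (1 + \<bar>t\<bar>) ^ Suc k"
      using C(1) by (intro add_mono mult_left_mono one_le_power) (auto simp: mult.commute intro!: mult_left_mono)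
    finally show ?thesis by (simp add: distrib_right)
  qed
  then show ?case using C(1) by (intro exI[of _ "norm w + C"]) auto
qed

lemma polynomial_le_exp:
  fixes \<delta> :: real
  assumes "\<delta> > 0"
  shows "\<exists>C\<ge>0. \<forall>s\<ge>0. (1 + s) ^ k \<le> C * exp (\<delta> * s)"
proof -
  \<comment> \<open>\<eta> \<le> 1 gives \<eta>(1 + s) \<le> 1 + \<eta>s \<le> e^{\<eta>s}; the k-th
    power then costs the exponent k\<eta>, which must not exceed \<delta>.\<close>
  define \<eta> where "\<eta> = min 1 (\<delta> / (real k + 1))"
  have \<eta>: "\<eta> > 0" "\<eta> \<le> 1" "real k * \<eta> \<le> \<delta>"
  proof -
    show "\<eta> > 0" "\<eta> \<le> 1" using assms by (auto simp: \<eta>_def)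
    have "real k * \<eta> \<le> real k * (\<delta> / (real k + 1))" by (intro mult_left_mono) (auto simp: \<eta>_def)
    also have "\<dots> \<le> \<delta>" using assms by (simp add: field_simps)
    finally show "real k * \<eta> \<le> \<delta>" .
  qed
  have "(1 + s) ^ k \<le> (1 / \<eta>) ^ k * exp (\<delta> * s)" if "s \<ge> 0" for s
  proof -
    have "\<eta> * (1 + s) \<le> 1 + \<eta> * s" using \<eta> by (simp add: algebra_simps)
    also have "\<dots> \<le> exp (\<eta> * s)" by (rule exp_ge_add_one_self)
    finally have "1 + s \<le> (1 / \<eta>) * exp (\<eta> * s)" using \<eta> by (simp add: field_simps)
    then have "(1 + s) ^ k \<le> ((1 / \<eta>) * exp (\<eta> * s)) ^ k" using that by (intro power_mono) auto
    also have "\<dots> = (1 / \<eta>) ^ k * exp (real k * (\<eta> * s))"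
      by (simp only: power_mult_distrib exp_of_nat_mult)
    also have "\<dots> \<le> (1 / \<eta>) ^ k * exp (\<delta> * s)"
      using \<eta> that mult_right_mono[OF \<eta>(3) that] by (intro mult_left_mono) (auto simp: mult.assoc)
    finally show ?thesis .
  qed
  then show ?thesis using \<eta> by (intro exI[of _ "(1 / \<eta>) ^ k"]) auto
qed

text \<open>The polynomial factor is absorbed by an arbitrarily small exponent \<delta>; the term
  \<delta>|t| makes one bound serve both directions of time.\<close>

lemma real_gen_eigenspace_growth:
  assumes "v \<in> real_gen_eigenspace A \<mu>" "\<delta> > 0"
  shows "\<exists>C\<ge>0. \<forall>t. norm (lflow A t v) \<le> C * exp (Re \<mu> * t + \<delta> * \<bar>t\<bar>)"
proof -
  obtain w k where w: "v = vec_Re w" "(cshift A \<mu> ^^ k) w = 0"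
    using assms(1) by (auto simp: real_gen_eigenspace_eq gen_eigenspace_iff)
  obtain C where C: "C \<ge> 0" "\<And>t i. norm (exp (- \<mu> * of_real t) * cflow A t w $ i) \<le> C * (1 + \<bar>t\<bar>) ^ k"
    using twisted_cflow_bound[OF w(2)] by blast
  obtain D where D: "D \<ge> 0" "\<And>s. s \<ge> 0 \<Longrightarrow> (1 + s) ^ k \<le> D * exp (\<delta> * s)"
    using polynomial_le_exp[OF assms(2)] by blast
  have comp: "\<bar>lflow A t v $ i\<bar> \<le> C * D * exp (Re \<mu> * t + \<delta> * \<bar>t\<bar>)" for t i
  proof -
    have "\<bar>lflow A t v $ i\<bar> \<le> norm (cflow A t w $ i)"
      using abs_Re_le_cmod[of "cflow A t w $ i"] by (simp add: cflow_def w(1))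
    also have "\<dots> = exp (Re \<mu> * t) * norm (exp (- \<mu> * of_real t) * cflow A t w $ i)"
      by (simp add: norm_mult exp_minus norm_inverse)
    also have "\<dots> \<le> exp (Re \<mu> * t) * (C * (D * exp (\<delta> * \<bar>t\<bar>)))"
      using C(1) by (intro mult_left_mono order_trans[OF C(2)] D(2)) auto
    finally show ?thesis by (simp add: exp_add mult_ac)
  qed
  have "norm (lflow A t v) \<le> (real CARD('a) * C * D) * exp (Re \<mu> * t + \<delta> * \<bar>t\<bar>)" for t
  proof -
    have "norm (lflow A t v) \<le> (\<Sum>i\<in>UNIV. \<bar>lflow A t v $ i\<bar>)" by (rule norm_le_l1_cart)
    also have "\<dots> \<le> (\<Sum>i\<in>(UNIV::'a set). C * D * exp (Re \<mu> * t + \<delta> * \<bar>t\<bar>))"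
      by (intro sum_mono comp)
    finally show ?thesis by simp
  qed
  then show ?thesis using C(1) D(1) by (intro exI[of _ "real CARD('a) * C * D"]) auto
qed

text \<open>The sign \<sigma> selects the direction of time. Being a subspace is what carries growth
  bounds from the generators to a whole \<open>lyapunov_sum\<close>.\<close>

lemma subspace_orbit_bound:
  "subspace {v. \<exists>C\<ge>0. \<forall>t\<ge>0. norm (lflow A (\<sigma> * t) v) \<le> C * exp (\<rho> * t)}"
proof (rule subspaceI, goal_cases)
  case 1
  then show ?case by (simp add: lflow_simps) (rule exI[of _ 0], simp)
next
  case (2 x y)
  then obtain C D where *: "C \<ge> 0" "D \<ge> 0"
    "\<And>t. t \<ge> 0 \<Longrightarrow> norm (lflow A (\<sigma> * t) x) \<le> C * exp (\<rho> * t)"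
    "\<And>t. t \<ge> 0 \<Longrightarrow> norm (lflow A (\<sigma> * t) y) \<le> D * exp (\<rho> * t)" by blast
  have "norm (lflow A (\<sigma> * t) (x + y)) \<le> (C + D) * exp (\<rho> * t)" if "t \<ge> 0" for t
    using norm_triangle_mono[OF *(3,4)[OF that]] by (simp add: lflow_simps distrib_right)
  then show ?case using *(1,2) by (intro CollectI exI[of _ "C + D"]) auto
next
  case (3 c x)
  then obtain C where *: "C \<ge> 0" "\<And>t. t \<ge> 0 \<Longrightarrow> norm (lflow A (\<sigma> * t) x) \<le> C * exp (\<rho> * t)" by blast
  have "norm (lflow A (\<sigma> * t) (c *\<^sub>R x)) \<le> (\<bar>c\<bar> * C) * exp (\<rho> * t)" if "t \<ge> 0" for t
    using mult_left_mono[OF *(2)[OF that], of "\<bar>c\<bar>"] by (simp add: lflow_simps mult.assoc)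
  then show ?case using *(1) by (intro CollectI exI[of _ "\<bar>c\<bar> * C"]) auto
qed

lemma lyapunov_sum_growth_forward:
  assumes "v \<in> lyapunov_sum A S" "\<And>l. l \<in> S \<Longrightarrow> l \<in> lyapunov_exponents A \<Longrightarrow> l < \<rho>"
  shows "\<exists>C\<ge>0. \<forall>t\<ge>0. norm (lflow A t v) \<le> C * exp (\<rho> * t)"
proof -
  have "v \<in> {v. \<exists>C\<ge>0. \<forall>t\<ge>0. norm (lflow A (1 * t) v) \<le> C * exp (\<rho> * t)}"
  proof (rule subsetD[OF span_minimal[OF _ subspace_orbit_bound] assms(1)[unfolded lyapunov_sum_def]], safe)
    fix \<mu> v assume *: "\<mu> \<in> eigenvalues A" "Re \<mu> \<in> S" "v \<in> real_gen_eigenspace A \<mu>"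
    then have "Re \<mu> < \<rho>" using assms(2) by (simp add: lyapunov_exponents_def)
    then obtain C where C: "C \<ge> 0" "\<And>t. norm (lflow A t v) \<le> C * exp (Re \<mu> * t + (\<rho> - Re \<mu>) * \<bar>t\<bar>)"
      using real_gen_eigenspace_growth[OF *(3), of "\<rho> - Re \<mu>"] by auto
    have "norm (lflow A (1 * t) v) \<le> C * exp (\<rho> * t)" if "t \<ge> 0" for t
      using C(2)[of t] that by (simp add: algebra_simps)
    with C(1) show "\<exists>C\<ge>0. \<forall>t\<ge>0. norm (lflow A (1 * t) v) \<le> C * exp (\<rho> * t)" by blast
  qed
  then show ?thesis by simp
qed

lemma lyapunov_sum_growth_backward:
  assumes "v \<in> lyapunov_sum A S" "\<And>l. l \<in> S \<Longrightarrow> l \<in> lyapunov_exponents A \<Longrightarrow> l > \<rho>"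
  shows "\<exists>C\<ge>0. \<forall>t\<ge>0. norm (lflow A (- t) v) \<le> C * exp (- \<rho> * t)"
proof -
  have "v \<in> {v. \<exists>C\<ge>0. \<forall>t\<ge>0. norm (lflow A (- 1 * t) v) \<le> C * exp (- \<rho> * t)}"
  proof (rule subsetD[OF span_minimal[OF _ subspace_orbit_bound] assms(1)[unfolded lyapunov_sum_def]], safe)
    fix \<mu> v assume *: "\<mu> \<in> eigenvalues A" "Re \<mu> \<in> S" "v \<in> real_gen_eigenspace A \<mu>"
    then have "Re \<mu> > \<rho>" using assms(2) by (simp add: lyapunov_exponents_def)
    then obtain C where C: "C \<ge> 0" "\<And>t. norm (lflow A t v) \<le> C * exp (Re \<mu> * t + (Re \<mu> - \<rho>) * \<bar>t\<bar>)"
      using real_gen_eigenspace_growth[OF *(3), of "Re \<mu> - \<rho>"] by auto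
    have "norm (lflow A (- 1 * t) v) \<le> C * exp (- \<rho> * t)" if "t \<ge> 0" for t
      using C(2)[of "- t"] that by (simp add: algebra_simps)
    with C(1) show "\<exists>C\<ge>0. \<forall>t\<ge>0. norm (lflow A (- 1 * t) v) \<le> C * exp (- \<rho> * t)" by blast
  qed
  then show ?thesis by simp
qed

text \<open>By linearity the constants for the finitely many basis vectors suffice. The added 1 only
  makes the constant positive.\<close>

lemma orbit_bound_uniform:
  fixes Q :: "real^'n \<Rightarrow> real^'n"
  assumes Q: "linear Q"
    and bnd: "\<And>x. \<exists>C\<ge>0. \<forall>t\<ge>0. norm (lflow A (\<sigma> * t) (Q x)) \<le> C * exp (\<rho> * t)"
  shows "\<exists>C>0. \<forall>t\<ge>0. \<forall>x. norm (lflow A (\<sigma> * t) (Q x)) \<le> C * exp (\<rho> * t) * norm x"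
proof -
  obtain C where C: "\<And>x. C x \<ge> 0" "\<And>x t. t \<ge> 0 \<Longrightarrow> norm (lflow A (\<sigma> * t) (Q x)) \<le> C x * exp (\<rho> * t)"
    using bnd by metis
  let ?C = "(\<Sum>b\<in>Basis. C b) + 1"
  have "norm (lflow A (\<sigma> * t) (Q x)) \<le> ?C * exp (\<rho> * t) * norm x" if "t \<ge> 0" for t x
  proof -
    have lin: "linear (\<lambda>x. lflow A (\<sigma> * t) (Q x))"
      using linear_compose[OF Q linear_lflow] by (simp add: o_def)
    have "lflow A (\<sigma> * t) (Q x) = lflow A (\<sigma> * t) (Q (\<Sum>b\<in>Basis. (x \<bullet> b) *\<^sub>R b))"
      by (simp add: euclidean_representation)
    also have "\<dots> = (\<Sum>b\<in>Basis. (x \<bullet> b) *\<^sub>R lflow A (\<sigma> * t) (Q b))"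
      by (simp add: linear_sum[OF lin] linear_cmul[OF lin])
    also have "norm \<dots> \<le> (\<Sum>b\<in>Basis. norm x * (C b * exp (\<rho> * t)))"
      using that C by (intro order_trans[OF norm_sum] sum_mono) (auto intro!: mult_mono Basis_le_norm)
    also have "\<dots> = (\<Sum>b\<in>Basis. C b) * exp (\<rho> * t) * norm x"
      by (simp add: sum_distrib_left sum_distrib_right mult_ac)
    also have "\<dots> \<le> ?C * exp (\<rho> * t) * norm x"
      by (intro mult_right_mono) auto
    finally show ?thesis .
  qed
  moreover have "?C > 0" using C(1) by (intro add_nonneg_pos sum_nonneg) auto
  ultimately show ?thesis by blast
qed

section \<open>Spectral gaps and spectral projections\<close>

lemma lyapunov_gap:
  obtains r1 r2 where "c < r1" "r1 < r2" "\<forall>l\<in>lyapunov_exponents A. l \<le> c \<or> l > r2"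
proof -
  let ?X = "{l \<in> lyapunov_exponents A. l > c}"
  \<comment> \<open>\<open>m\<close> is the first exponent above \<open>c\<close>, with
    \<open>c + 1\<close> as default if there is none. The two rates will trisect the interval from
    \<open>c\<close> to \<open>m\<close>.\<close>
  define m where "m = Min (insert (c + 1) ?X)"
  have fin: "finite (insert (c + 1) ?X)" using finite_subset[OF _ finite_lyapunov_exponents[of A], of ?X] by auto
  have "m \<in> insert (c + 1) ?X" unfolding m_def by (rule Min_in[OF fin]) auto
  then have "m > c" by auto
  moreover have "l \<le> c \<or> l \<ge> m" if "l \<in> lyapunov_exponents A" for l
  proof (cases "l \<le> c")
    case False
    with that have "l \<in> insert (c + 1) ?X" by simp
    then show ?thesis unfolding m_def using Min_le[OF fin] by blast
  qed simp
  ultimately have "c < (2 * c + m) / 3" "(2 * c + m) / 3 < (c + 2 * m) / 3"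
    "\<forall>l\<in>lyapunov_exponents A. l \<le> c \<or> l > (c + 2 * m) / 3" by (force simp: field_simps)+
  then show ?thesis by (rule that)
qed

text \<open>Such a vector grows forward at most like e^{r1 t}, while the backward flow shrinks the
  upper part like e^{-r2 t}. Going forward and back returns \<open>v\<close>, so its norm is at most
  a multiple of e^{-(r2 - r1)t}.\<close>

lemma lyapunov_sum_disjoint:
  assumes "v \<in> lyapunov_sum A {..c}" "v \<in> lyapunov_sum A {c<..}"
  shows "v = 0"
proof -
  obtain r1 r2 where r: "c < r1" "r1 < r2" "\<forall>l\<in>lyapunov_exponents A. l \<le> c \<or> l > r2"
    by (rule lyapunov_gap[of c A])
  obtain C where C: "C \<ge> 0" "\<And>t. t \<ge> 0 \<Longrightarrow> norm (lflow A t v) \<le> C * exp (r1 * t)"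
    using lyapunov_sum_growth_forward[OF assms(1), of r1] r(1) by auto
  \<comment> \<open>A linear retraction onto the upper space turns the vectorwise backward bounds
    into a uniform one, which is needed for the moving vector \<open>lflow A t v\<close>.\<close>
  obtain Q where Q: "linear Q" "\<And>x. Q x \<in> lyapunov_sum A {c<..}" "\<And>x. x \<in> lyapunov_sum A {c<..} \<Longrightarrow> Q x = x"
    using linear_exists_left_inverse_on[OF linear_id subspace_lyapunov_sum inj_on_id, of A "{c<..}"] by auto
  have "\<exists>C\<ge>0. \<forall>t\<ge>0. norm (lflow A (- 1 * t) (Q x)) \<le> C * exp (- r2 * t)" for x
    using lyapunov_sum_growth_backward[OF Q(2)[of x], of r2] r(3) by force
  from orbit_bound_uniform[OF Q(1) this]
  obtain D where D: "D > 0"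
    "\<And>t x. t \<ge> 0 \<Longrightarrow> norm (lflow A (- 1 * t) (Q x)) \<le> D * exp (- r2 * t) * norm x" by blast
  have "norm v \<le> D * C * exp (- (r2 - r1) * t)" if t: "t \<ge> 0" for t
  proof -
    have "norm v = norm (lflow A (- 1 * t) (Q (lflow A t v)))"
      using Q(3)[OF lyapunov_sum_lflow[OF assms(2)]] by simp
    also have "\<dots> \<le> D * exp (- r2 * t) * (C * exp (r1 * t))"
      using D(1) by (intro order_trans[OF D(2)[OF t]] mult_left_mono C(2)[OF t]) auto
    also have "\<dots> = D * C * exp (- (r2 - r1) * t)" by (simp add: exp_add[symmetric] algebra_simps flip: exp_add)
    finally show ?thesis .
  qed
  moreover have "((\<lambda>t. D * C * exp (- (r2 - r1) * t)) \<longlongrightarrow> 0) at_top"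
    using r(2) by real_asymp
  ultimately have "norm v \<le> 0"
    by (intro tendsto_lowerbound[of _ 0 at_top]) (auto intro: eventually_mono[OF eventually_ge_at_top[of 0]])
  then show ?thesis by simp
qed

text \<open>\<open>P\<close> selects the upper summand. Uniqueness of the decomposition gives
  everything else: linearity, idempotence, and commutation with the flow, under which both summands
  are invariant.\<close>

lemma spectral_projection:
  obtains P :: "real^'n \<Rightarrow> real^'n" where "linear P" "\<forall>x. P (P x) = P x"
    "\<forall>t x. P (lflow A t x) = lflow A t (P x)"
    "\<forall>x. P x \<in> lyapunov_sum A {c<..}" "\<forall>x. x - P x \<in> lyapunov_sum A {..c}"
proof -
  let ?V = "lyapunov_sum A {c<..}" and ?W = "lyapunov_sum A {..c}"
  have ex: "\<exists>y. y \<in> ?V \<and> x - y \<in> ?W" for x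
  proof -
    have "{c<..} \<union> {..c} = UNIV" by auto
    then have "x \<in> lyapunov_sum A ({c<..} \<union> {..c})" by (simp only: lyapunov_sum_UNIV UNIV_I)
    then obtain y z where "x = y + z" "y \<in> ?V" "z \<in> ?W" unfolding lyapunov_sum_Un by blast
    then show ?thesis by (intro exI[of _ y]) simp
  qed
  define P where "P x = (SOME y. y \<in> ?V \<and> x - y \<in> ?W)" for x
  have P: "P x \<in> ?V" "x - P x \<in> ?W" for x
    using someI_ex[OF ex[of x]] by (simp_all add: P_def)
  note sub = subspace_lyapunov_sum[of A "{c<..}"] subspace_lyapunov_sum[of A "{..c}"]
  have uniq: "P x = y" if "y \<in> ?V" "x - y \<in> ?W" for x y
  proof -
    have "P x - y \<in> ?V" using subspace_diff[OF sub(1) P(1) that(1)] .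
    moreover have "P x - y = (x - y) - (x - P x)" by simp
    then have "P x - y \<in> ?W" using subspace_diff[OF sub(2) that(2) P(2)] by metis
    ultimately show ?thesis using lyapunov_sum_disjoint by fastforce
  qed
  have "linear P"
  proof (rule linearI)
    show "P (x + y) = P x + P y" for x y
      using subspace_add[OF sub(1) P(1) P(1)] subspace_add[OF sub(2) P(2)[of x] P(2)[of y]]
      by (intro uniq) (auto simp: algebra_simps)
    show "P (r *\<^sub>R x) = r *\<^sub>R P x" for r x
      using subspace_scale[OF sub(1) P(1)] subspace_scale[OF sub(2) P(2)[of x]]
      by (intro uniq) (auto simp: algebra_simps)
  qed
  moreover have "P (P x) = P x" for x
    using P(1) by (intro uniq) (auto simp: subspace_0[OF sub(2)])
  moreover have "P (lflow A t x) = lflow A t (P x)" for t x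
    using lyapunov_sum_lflow[OF P(1)] lyapunov_sum_lflow[OF P(2)[of x], of t]
    by (intro uniq) (auto simp: lflow_simps)
  ultimately show ?thesis using P by (intro that[of P] allI)
qed

section \<open>Oriented integrals of control terms\<close>

text \<open>The oriented gauge integral from 0 to t; \<open>interval_lebesgue_integral_oint\<close>
  identifies it with the integrals in the definitions of \<open>is_solution\<close> and
  \<open>lift_sol\<close>.\<close>

definition oint :: "(real \<Rightarrow> 'a::banach) \<Rightarrow> real \<Rightarrow> 'a" where
  "oint f t = (if 0 \<le> t then integral {0..t} f else - integral {t..0} f)"

lemma oint_0 [simp]: "oint f 0 = 0"
  by (simp add: oint_def)

lemma oint_diff:
  assumes f: "\<And>a b. f integrable_on {a..b}" and "a \<le> b"
  shows "oint f b - oint f a = integral {a..b} f"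
proof -
  define c where "c = min a 0"
  have *: "oint f t = integral {c..t} f - integral {c..0} f" if "c \<le> t" for t
  proof (cases "0 \<le> t")
    case True
    then show ?thesis
      using Henstock_Kurzweil_Integration.integral_combine[of c 0 t f] f by (simp add: oint_def c_def algebra_simps)
  next
    case False
    then show ?thesis
      using Henstock_Kurzweil_Integration.integral_combine[of c t 0 f] f that
      by (simp add: oint_def c_def algebra_simps)
  qed
  have "integral {c..a} f + integral {a..b} f = integral {c..b} f"
    by (rule Henstock_Kurzweil_Integration.integral_combine) (use assms c_def in auto)
  moreover have "c \<le> a" "c \<le> b" using assms(2) by (auto simp: c_def)
  ultimately show ?thesis by (simp add: * algebra_simps)
qed

lemma continuous_oint:
  assumes f: "\<And>a b. f integrable_on {a..b}"
  shows "continuous_on UNIV (oint f)"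
proof (rule continuous_at_imp_continuous_on, rule ballI)
  fix t :: real
  define T where "T = \<bar>t\<bar> + 1"
  have "continuous_on {-T..T} (\<lambda>s. integral {-T..s} f + oint f (-T))"
    by (intro continuous_on_add continuous_on_const indefinite_integral_continuous_1 f)
  then have "continuous_on {-T..T} (oint f)"
  proof (rule continuous_on_eq)
    fix s assume "s \<in> {-T..T}"
    then show "integral {-T..s} f + oint f (-T) = oint f s"
      using oint_diff[OF f, of "-T" s] by (simp add: algebra_simps)
  qed
  then show "isCont (oint f) t"
    by (rule continuous_on_interior) (auto simp: T_def)
qed

lemma oint_linear:
  assumes "\<And>a b. f integrable_on {a..b}" "bounded_linear L"
  shows "oint (\<lambda>s. L (f s)) t = L (oint f t)"
  using integral_linear[OF assms(1,2)] linear_neg[OF bounded_linear.linear[OF assms(2)]]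
  by (simp add: oint_def o_def)

lemma interval_lebesgue_integral_oint:
  fixes f :: "real \<Rightarrow> 'a::euclidean_space"
  assumes f: "\<And>a b. set_integrable lebesgue {a..b} f"
  shows "(LINT s=ereal 0..ereal t|lebesgue. f s) = oint f t"
proof -
  have "(LINT s:{a<..<b}|lebesgue. f s) = integral {a..b} f" for a b
  proof -
    have "set_integrable lebesgue {a<..<b} f"
      by (rule set_integrable_subset[OF f[of a b]]) auto
    then show ?thesis
      by (simp add: set_lebesgue_integral_eq_integral(2) integral_open_interval_real)
  qed
  then show ?thesis by (simp add: interval_lebesgue_integral_def oint_def)
qed

text \<open>With merely measurable controls the product rule is not available; instead the difference of the
  two sides of the integral equation has quadratic increments.\<close>

lemma quadratic_increments_constant:
  fixes F :: "real \<Rightarrow> 'a::real_normed_vector"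
  assumes "\<And>T. \<exists>C. \<forall>a b. - T \<le> a \<longrightarrow> a \<le> b \<longrightarrow> b \<le> T \<longrightarrow> norm (F b - F a) \<le> C * (b - a) ^ 2"
  shows "F t = F 0"
proof -
  have "(F has_derivative (\<lambda>h. 0)) (at x)" for x
    unfolding has_derivative_at_alt
  proof (intro conjI allI impI)
    fix e :: real assume e: "e > 0"
    define T where "T = \<bar>x\<bar> + 1"
    obtain C where C: "\<And>a b. - T \<le> a \<Longrightarrow> a \<le> b \<Longrightarrow> b \<le> T \<Longrightarrow> norm (F b - F a) \<le> C * (b - a) ^ 2"
      using assms by blast
    have bnd: "norm (F y - F x) \<le> (\<bar>C\<bar> + 1) * \<bar>y - x\<bar> ^ 2" if "\<bar>y - x\<bar> \<le> 1" for y
    proof -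
      have "norm (F y - F x) \<le> C * \<bar>y - x\<bar> ^ 2"
      proof (cases "x \<le> y")
        case True
        then show ?thesis using C[of x y] that by (simp add: T_def)
      next
        case False
        then show ?thesis using C[of y x] that by (simp add: T_def norm_minus_commute power2_commute)
      qed
      also have "\<dots> \<le> (\<bar>C\<bar> + 1) * \<bar>y - x\<bar> ^ 2" by (intro mult_right_mono) auto
      finally show ?thesis .
    qed
    define d where "d = min 1 (e / (\<bar>C\<bar> + 1))"
    have d: "d > 0" using e by (simp add: d_def add_nonneg_pos)
    have "norm (F y - F x - 0) \<le> e * norm (y - x)" if y: "norm (y - x) < d" for y
    proof -
      have "norm (F y - F x) \<le> ((\<bar>C\<bar> + 1) * \<bar>y - x\<bar>) * \<bar>y - x\<bar>"
        using bnd[of y] y by (simp add: d_def power2_eq_square mult.assoc)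
      also have "\<dots> \<le> e * \<bar>y - x\<bar>"
        using y by (intro mult_right_mono) (auto simp: d_def field_simps)
      finally show ?thesis by simp
    qed
    with d show "\<exists>d>0. \<forall>y. norm (y - x) < d \<longrightarrow> norm (F y - F x - 0) \<le> e * norm (y - x)" by blast
  qed simp
  then show ?thesis by (intro has_derivative_zero_unique[of UNIV]) auto
qed

section \<open>Integrability and almost everywhere bounds for control terms\<close>

lemma admissible_negligible:
  assumes "u \<in> admissible_controls U"
  obtains N where "negligible N" "\<And>s. s \<notin> N \<Longrightarrow> u s \<in> U"
proof -
  have "AE s in lebesgue. u s \<in> U" using assms by (simp add: admissible_controls_def)
  then obtain N where "N \<in> null_sets lebesgue" "{s \<in> space lebesgue. u s \<notin> U} \<subseteq> N"
    unfolding eventually_ae_filter by blast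
  then show ?thesis by (intro that[of N]) (auto simp: negligible_iff_null_sets)
qed

lemma ident_lebesgue_measurable: "(\<lambda>s::real. s) \<in> borel_measurable lebesgue"
  by (rule measurable_completion) simp

lemma compact_matrix_bound:
  fixes B :: "real^'m^'n"
  assumes "compact U"
  obtains M where "M > 0" "\<forall>y\<in>U. norm (B *v y) \<le> M"
proof -
  have "compact ((*v) B ` U)"
    by (intro compact_continuous_image assms linear_continuous_on matrix_vector_mul_bounded_linear)
  then obtain M where M: "M > 0" "\<forall>x\<in>(*v) B ` U. norm x \<le> M"
    using compact_imp_bounded bounded_pos by blast
  then show ?thesis by (intro that) auto
qed

lemma control_set_integrable:
  fixes A :: "real^'n^'n" and B :: "real^'m^'n"
  assumes "compact U" "u \<in> admissible_controls U"
  shows "set_integrable lebesgue {a..b} (\<lambda>s. lflow A (c - s) (B *v u s))"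
proof -
  obtain M where M0: "M > 0" "\<forall>y\<in>U. norm (B *v y) \<le> M"
    by (rule compact_matrix_bound[OF assms(1), of B])
  then have M: "norm (B *v y) \<le> M" if "y \<in> U" for y using that by blast
  obtain C where C: "C \<ge> 1" "\<And>t x. \<bar>t\<bar> \<le> \<bar>a\<bar> + \<bar>b\<bar> + \<bar>c\<bar> \<Longrightarrow> norm (lflow A t x) \<le> C * norm x"
    using lflow_norm_bound[of "\<bar>a\<bar> + \<bar>b\<bar> + \<bar>c\<bar>" A] by auto
  have "(\<lambda>s. lflow A (c - s) (B *v u s)) \<in> borel_measurable lebesgue"
  proof (rule borel_measurable_continuous_Pair[OF ident_lebesgue_measurable, where H = "\<lambda>s y. lflow A (c - s) (B *v y)"])
    show "u \<in> borel_measurable lebesgue" using assms(2) by (simp add: admissible_controls_def)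
    show "continuous_on UNIV (\<lambda>x. lflow A (c - fst x) (B *v snd x))"
      by (intro continuous_intros bounded_linear.continuous_on[OF matrix_vector_mul_bounded_linear])
  qed
  moreover have "AE s in lebesgue. s \<in> {a..b} \<longrightarrow> norm (lflow A (c - s) (B *v u s)) \<le> C * M"
  proof -
    have "AE s in lebesgue. u s \<in> U" using assms(2) by (simp add: admissible_controls_def)
    then show ?thesis
    proof (rule eventually_mono, intro impI)
      fix s assume s: "u s \<in> U" "s \<in> {a..b}"
      have "norm (lflow A (c - s) (B *v u s)) \<le> C * norm (B *v u s)"
        using s(2) by (intro C(2)) auto
      also have "\<dots> \<le> C * M" using C(1) M[OF s(1)] by (intro mult_left_mono) auto
      finally show "norm (lflow A (c - s) (B *v u s)) \<le> C * M" .
    qed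
  qed
  ultimately show ?thesis
    unfolding set_integrable_def by (intro integrableI_bounded_set_indicator) (auto simp: emeasure_lborel_Icc_eq)
qed

lemma control_integrable:
  fixes A :: "real^'n^'n" and B :: "real^'m^'n"
  assumes "compact U" "u \<in> admissible_controls U"
  shows "(\<lambda>s. lflow A (c - s) (B *v u s)) integrable_on {a..b}"
  by (rule set_lebesgue_integral_eq_integral(1)[OF control_set_integrable[OF assms]])

text \<open>Control values lie in \<open>U\<close> only almost everywhere, so both integrands are
  set to 0 on a null set before the pointwise estimate is applied.\<close>

lemma control_integral_bound:
  fixes h :: "real \<Rightarrow> 'b::euclidean_space"
  assumes "u \<in> admissible_controls U" "h integrable_on {a..b}" "g integrable_on {a..b}"
    and "\<And>s. s \<in> {a..b} \<Longrightarrow> u s \<in> U \<Longrightarrow> norm (h s) \<le> g s"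
  shows "norm (integral {a..b} h) \<le> integral {a..b} g"
proof -
  obtain N where N: "negligible N" "\<And>s. s \<notin> N \<Longrightarrow> u s \<in> U"
    using admissible_negligible[OF assms(1)] by blast
  let ?h = "\<lambda>s. if s \<in> N then 0 else h s" and ?g = "\<lambda>s. if s \<in> N then 0 else g s"
  have "norm (integral {a..b} ?h) \<le> integral {a..b} ?g"
  proof (rule integral_norm_bound_integral)
    show "?h integrable_on {a..b}" by (rule integrable_spike[OF assms(2) N(1)]) auto
    show "?g integrable_on {a..b}" by (rule integrable_spike[OF assms(3) N(1)]) auto
  qed (use assms(4) N(2) in auto)
  also have "integral {a..b} ?g = integral {a..b} g" by (rule integral_spike[OF N(1)]) auto
  also have "integral {a..b} ?h = integral {a..b} h" by (rule integral_spike[OF N(1)]) auto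
  finally show ?thesis .
qed

lemma AE_shift:
  assumes "AE s in lebesgue. P (s::real)"
  shows "AE s in lebesgue. P (T + s)"
proof -
  obtain N where N: "N \<in> null_sets lebesgue" "{s \<in> space lebesgue. \<not> P s} \<subseteq> N"
    using assms unfolding eventually_ae_filter by blast
  then have "negligible ((+) (- T) ` N)" by (intro negligible_translation) (simp add: negligible_iff_null_sets)
  moreover have "{s \<in> space lebesgue. \<not> P (T + s)} \<subseteq> (+) (- T) ` N"
  proof
    fix s assume "s \<in> {s \<in> space lebesgue. \<not> P (T + s)}"
    then have "T + s \<in> N" using N(2) by auto
    then show "s \<in> (+) (- T) ` N" by (intro image_eqI[of _ _ "T + s"]) auto
  qed
  ultimately show ?thesis
    unfolding eventually_ae_filter by (auto simp: negligible_iff_null_sets)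
qed

lemma measurable_shift:
  assumes "u \<in> borel_measurable lebesgue"
  shows "(\<lambda>s::real. u (T + s)) \<in> borel_measurable lebesgue"
proof -
  have "(\<lambda>s::real. T + 1 *\<^sub>R s) \<in> lebesgue \<rightarrow>\<^sub>M lebesgue"
    using lebesgue_affine_measurable[of "\<lambda>_. 1" T] by simp
  from measurable_compose[OF this assms] show ?thesis by simp
qed

lemma lflow_diff_bound:
  assumes C: "\<And>t x. \<bar>t\<bar> \<le> T \<Longrightarrow> norm (lflow A t x) \<le> C * norm x" and "0 \<le> h" "h \<le> T"
  shows "norm (lflow A h y - y) \<le> C * norm (A *v y) * h"
proof -
  have "norm (lflow A h y - lflow A 0 y) \<le> (C * norm (A *v y)) * norm (h - 0)"
  proof (rule differentiable_bound[of "{0..h}"])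
    fix s assume s: "s \<in> {0..h}"
    show "((\<lambda>s. lflow A s y) has_derivative (\<lambda>r. r *\<^sub>R lflow A s (A *v y))) (at s within {0..h})"
      using lflow_deriv[of A y s] by (simp add: has_vector_derivative_def has_derivative_at_withinI lflow_commute)
    have "norm (lflow A s (A *v y)) \<le> C * norm (A *v y)" using s assms(3) by (intro C) auto
    then show "onorm (\<lambda>r. r *\<^sub>R lflow A s (A *v y)) \<le> C * norm (A *v y)"
      by (simp add: onorm_scaleR_left onorm_id bounded_linear_ident)
  qed (use assms(2) in auto)
  then show ?thesis using assms(2) by simp
qed

section \<open>Variation of constants\<close>

text \<open>The integral of the variation of constants formula pulled back to time 0. The solution
  becomes e^{tA}(x + r drive), and steering one control after another adds the drives up to a
  transport by the flow.\<close>

definition drive :: "real^'n^'n \<Rightarrow> real^'m^'n \<Rightarrow> (real \<Rightarrow> real^'m) \<Rightarrow> real \<Rightarrow> real^'n" where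
  "drive A B u = oint (\<lambda>s. lflow A (- s) (B *v u s))"

lemma drive_0 [simp]: "drive A B u 0 = 0"
  by (simp add: drive_def)

locale control_range =
  fixes U :: "(real^'m) set"
  assumes compact_U: "compact U" and zero_U: "0 \<in> U"
begin

abbreviation "controls \<equiv> admissible_controls U"

lemma drive_integrable:
  "u \<in> controls \<Longrightarrow> (\<lambda>s. lflow A (- s) (B *v u s)) integrable_on {a..b}"
  using control_integrable[OF compact_U, of u A 0 B] by simp

lemma drive_diff:
  "u \<in> controls \<Longrightarrow> a \<le> b \<Longrightarrow> drive A B u b - drive A B u a = integral {a..b} (\<lambda>s. lflow A (- s) (B *v u s))"
  unfolding drive_def by (rule oint_diff[OF drive_integrable])

lemma lift_sol_eq:
  assumes "u \<in> controls"
  shows "lift_sol A B t y u = (lflow A t (fst y + snd y *\<^sub>R drive A B u t), snd y)"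
proof -
  have "(LINT \<sigma>=ereal 0..ereal t|lebesgue. (mat_exp ((t - \<sigma>) *\<^sub>R A) *v (B *v u \<sigma>)))
      = oint (\<lambda>s. lflow A (t - s) (B *v u s)) t"
    unfolding lflow_def[symmetric]
    by (rule interval_lebesgue_integral_oint[OF control_set_integrable[OF compact_U assms]])
  also have "\<dots> = oint (\<lambda>s. lflow A t (lflow A (- s) (B *v u s))) t"
    by (simp add: lflow_add[symmetric])
  also have "\<dots> = lflow A t (drive A B u t)"
    unfolding drive_def by (rule oint_linear[OF drive_integrable[OF assms] bounded_linear_lflow])
  finally show ?thesis
    by (simp add: lift_sol_def case_prod_unfold lflow_simps) (simp add: lflow_def)
qed

lemma zero_control: "(\<lambda>_. 0) \<in> controls"
  using zero_U by (auto simp: admissible_controls_def intro: exI[of _ 0])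

lemma lift_sol_zero_control: "lift_sol A B t y (\<lambda>_. 0 :: real^'m) = (lflow A t (fst y), snd y)"
proof -
  have "drive A B (\<lambda>_. 0 :: real^'m) t = 0" by (simp add: drive_def oint_def lflow_simps)
  then show ?thesis by (simp add: lift_sol_eq[OF zero_control])
qed

lemma shift_control:
  assumes "u \<in> controls"
  shows "(\<lambda>s. u (T + s)) \<in> controls"
proof -
  obtain C where "u \<in> borel_measurable lebesgue" "AE s in lebesgue. norm (u s) \<le> C" "AE s in lebesgue. u s \<in> U"
    using assms by (auto simp: admissible_controls_def)
  from measurable_shift[OF this(1)] AE_shift[OF this(2)] AE_shift[OF this(3)]
  show ?thesis unfolding admissible_controls_def by blast
qed

definition concat_control :: "real \<Rightarrow> (real \<Rightarrow> real^'m) \<Rightarrow> (real \<Rightarrow> real^'m) \<Rightarrow> real \<Rightarrow> real^'m" where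
  "concat_control T u v s = (if s < T then u s else v (s - T))"

lemma concat_control:
  assumes u: "u \<in> controls" and v: "v \<in> controls"
  shows "concat_control T u v \<in> controls"
proof -
  let ?v = "\<lambda>s. v (- T + s)"
  have v': "?v \<in> controls" by (rule shift_control[OF v])
  have eq: "concat_control T u v = (\<lambda>s. if s < T then u s else ?v s)"
    by (simp add: concat_control_def fun_eq_iff)
  have "(\<lambda>s. if s < T then u s else ?v s) \<in> borel_measurable lebesgue"
  proof (rule measurable_If)
    show "{s \<in> space lebesgue. s < T} \<in> sets lebesgue"
      using lborelD[OF borel_open[OF open_lessThan[of T]]] by (simp add: lessThan_def)
  qed (use u v' in \<open>auto simp: admissible_controls_def\<close>)
  moreover obtain C D where "AE s in lebesgue. norm (u s) \<le> C" "AE s in lebesgue. norm (?v s) \<le> D"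
    using u v' by (auto simp: admissible_controls_def)
  then have "AE s in lebesgue. norm (concat_control T u v s) \<le> max C D"
    unfolding eq by eventually_elim auto
  moreover have "AE s in lebesgue. u s \<in> U" "AE s in lebesgue. ?v s \<in> U"
    using u v' by (auto simp: admissible_controls_def)
  then have "AE s in lebesgue. concat_control T u v s \<in> U"
    unfolding eq by eventually_elim auto
  ultimately show ?thesis unfolding eq admissible_controls_def by blast
qed

lemma drive_shift:
  assumes u: "u \<in> controls" and "t \<ge> 0"
  shows "drive A B u (s + t) = drive A B u s + lflow A (- s) (drive A B (\<lambda>\<sigma>. u (s + \<sigma>)) t)"
proof -
  let ?f = "\<lambda>\<sigma>. lflow A (- \<sigma>) (B *v u \<sigma>)"
  have "drive A B u (s + t) - drive A B u s = integral {s..s + t} ?f"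
    using assms by (intro drive_diff) auto
  also have "\<dots> = integral {0..t} (?f \<circ> (+) s)"
    using integral_shift_Icc_real[of 0 t ?f s] by (simp add: add.commute)
  also have "?f \<circ> (+) s = lflow A (- s) \<circ> (\<lambda>\<sigma>. lflow A (- \<sigma>) (B *v u (s + \<sigma>)))"
    by (simp add: fun_eq_iff lflow_add[symmetric])
  also have "integral {0..t} \<dots> = lflow A (- s) (integral {0..t} (\<lambda>\<sigma>. lflow A (- \<sigma>) (B *v u (s + \<sigma>))))"
    by (rule integral_linear[OF drive_integrable[OF shift_control[OF u]] bounded_linear_lflow])
  finally show ?thesis using assms(2) by (simp add: drive_def oint_def algebra_simps)
qed

text \<open>Only the second duration has to be nonnegative. A negative \<open>s\<close> is what the
  alpha-limit set requires: trajectory pieces that start at an arbitrary time.\<close>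

lemma lift_sol_cocycle:
  assumes u: "u \<in> controls" and "t \<ge> 0"
  shows "lift_sol A B (s + t) y u = lift_sol A B t (lift_sol A B s y u) (\<lambda>\<sigma>. u (s + \<sigma>))"
proof -
  have "lflow A (s + t) x = lflow A t (lflow A s x)" for x
    using lflow_add[of A t s x] by (simp only: add.commute)
  then show ?thesis
    unfolding lift_sol_eq[OF u] lift_sol_eq[OF shift_control[OF u]] drive_shift[OF assms]
    by (simp add: lflow_simps scaleR_add_right add.assoc)
qed

lemma drive_cong:
  assumes "t \<ge> 0" "\<And>s. 0 \<le> s \<Longrightarrow> s < t \<Longrightarrow> u s = v s"
  shows "drive A B u t = drive A B v t"
proof -
  have "integral {0..t} (\<lambda>s. lflow A (- s) (B *v u s)) = integral {0..t} (\<lambda>s. lflow A (- s) (B *v v s))"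
    by (rule integral_spike[of "{t}"]) (use assms(2) in auto)
  then show ?thesis using assms(1) by (simp add: drive_def oint_def)
qed

lemma lift_sol_cong:
  assumes "u \<in> controls" "v \<in> controls" "t \<ge> 0" "\<And>s. 0 \<le> s \<Longrightarrow> s < t \<Longrightarrow> u s = v s"
  shows "lift_sol A B t y u = lift_sol A B t y v"
  unfolding lift_sol_eq[OF assms(1)] lift_sol_eq[OF assms(2)]
  using drive_cong[of t u v A B] assms(3,4) by simp

lemma lift_sol_concat:
  assumes "u \<in> controls" "v \<in> controls" "T \<ge> 0" "t \<ge> 0"
  shows "lift_sol A B (T + t) y (concat_control T u v) = lift_sol A B t (lift_sol A B T y u) v"
proof -
  have "lift_sol A B T y (concat_control T u v) = lift_sol A B T y u"
    using assms by (intro lift_sol_cong concat_control) (auto simp: concat_control_def)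
  moreover have "(\<lambda>s. concat_control T u v (T + s)) \<in> controls"
    by (intro shift_control concat_control assms)
  then have "lift_sol A B t z (\<lambda>s. concat_control T u v (T + s)) = lift_sol A B t z v" for z
    using assms by (intro lift_sol_cong) (auto simp: concat_control_def)
  ultimately show ?thesis
    by (simp add: lift_sol_cocycle[OF concat_control[OF assms(1,2)] assms(4)])
qed

definition affine_sol :: "real^'n^'n \<Rightarrow> real^'m^'n \<Rightarrow> real \<Rightarrow> real^'n \<Rightarrow> (real \<Rightarrow> real^'m) \<Rightarrow> real^'n" where
  "affine_sol A B t x u = lflow A t (x + drive A B u t)"

lemma lift_sol_affine: "u \<in> controls \<Longrightarrow> lift_sol A B t (x, 1) u = (affine_sol A B t x u, 1)"
  by (simp add: lift_sol_eq affine_sol_def)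

lemma continuous_affine_sol:
  assumes "u \<in> controls"
  shows "continuous_on S (\<lambda>t. affine_sol A B t x u)"
  unfolding affine_sol_def
  by (intro continuous_intros continuous_on_subset[OF continuous_oint[OF drive_integrable[OF assms], folded drive_def]]) auto

lemma affine_sol_diff:
  assumes u: "u \<in> controls" and "a \<le> b"
  shows "affine_sol A B b x u = lflow A (b - a) (affine_sol A B a x u)
    + integral {a..b} (\<lambda>s. lflow A (b - s) (B *v u s))"
proof -
  have "drive A B u b = drive A B u a + integral {a..b} (\<lambda>s. lflow A (- s) (B *v u s))"
    using drive_diff[OF assms, of A B] by (simp add: algebra_simps)
  moreover have "lflow A b (integral {a..b} (\<lambda>s. lflow A (- s) (B *v u s)))
      = integral {a..b} (lflow A b \<circ> (\<lambda>s. lflow A (- s) (B *v u s)))"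
    by (rule integral_linear[OF drive_integrable[OF u] bounded_linear_lflow, symmetric])
  moreover have "lflow A b \<circ> (\<lambda>s. lflow A (- s) (B *v u s)) = (\<lambda>s. lflow A (b - s) (B *v u s))"
    by (simp add: fun_eq_iff lflow_add[symmetric])
  moreover have "lflow A (b - a) (lflow A a z) = lflow A b z" for z
    by (simp add: lflow_add[symmetric])
  ultimately show ?thesis by (simp add: affine_sol_def lflow_simps add.assoc)
qed

lemma control_term_set_integrable:
  fixes B :: "real^'m^'n"
  assumes "u \<in> controls"
  shows "set_integrable lebesgue {a..b} (\<lambda>s. B *v u s)"
proof -
  have "set_integrable lebesgue {a..b} (\<lambda>s. lflow 0 (0 - s) (B *v u s))"
    by (rule control_set_integrable[OF compact_U assms])
  moreover have "lflow 0 t y = y" for t and y :: "real^'n"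
    using lflow_ode_unique[of "\<lambda>_. y" 0 t] by simp
  ultimately show ?thesis by simp
qed

text \<open>On a short interval the solution differs from the free flow of its initial value by O(b
  - a), and so does e^{(b-s)A} from the identity. Integrating these two errors over the interval
  makes them quadratic.\<close>

lemma affine_sol_increment_bound:
  assumes u: "u \<in> controls" and M: "\<And>y. y \<in> U \<Longrightarrow> norm (B *v y) \<le> M"
    and C: "C \<ge> 1" "\<And>t x. \<bar>t\<bar> \<le> 2 * T \<Longrightarrow> norm (lflow A t x) \<le> C * norm x"
    and K: "\<And>x. norm (A *v x) \<le> K * norm x" "K \<ge> 0"
    and Z: "\<And>t. \<bar>t\<bar> \<le> T \<Longrightarrow> norm (affine_sol A B t x u) \<le> Z"
    and ab: "- T \<le> a" "a \<le> b" "b \<le> T"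
  shows "norm (affine_sol A B b x u - affine_sol A B a x u
    - integral {a..b} (\<lambda>s. A *v affine_sol A B s x u + B *v u s)) \<le> (2 * K * C * M) * (b - a)^2"
proof -
  let ?z = "\<lambda>s. affine_sol A B s x u"
  have zc: "continuous_on S ?z" for S by (rule continuous_affine_sol[OF u])
  have M0: "M \<ge> 0" using M[OF zero_U] by simp
  have uint: "(\<lambda>s. B *v u s) integrable_on {a..b}"
    by (rule set_lebesgue_integral_eq_integral(1)[OF control_term_set_integrable[OF u]])
  have zint: "(\<lambda>s. A *v ?z s) integrable_on {a..b}"
    by (intro integrable_continuous_real bounded_linear.continuous_on[OF matrix_vector_mul_bounded_linear] zc)
  have hint: "(\<lambda>s. A *v lflow A (s - a) (?z a)) integrable_on {a..b}"
    by (intro integrable_continuous_real bounded_linear.continuous_on[OF matrix_vector_mul_bounded_linear] continuous_intros)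
  have ftc: "integral {a..b} (\<lambda>s. A *v lflow A (s - a) (?z a)) = lflow A (b - a) (?z a) - ?z a"
  proof -
    have "((\<lambda>s. lflow A (s - a) (?z a)) has_vector_derivative A *v lflow A (s - a) (?z a)) (at s within {a..b})" for s
    proof -
      have "((\<lambda>s. s - a) has_vector_derivative 1) (at s)" by (auto intro!: derivative_eq_intros)
      from vector_diff_chain_at[OF this lflow_deriv[of A "?z a"]]
      have "((\<lambda>s. lflow A (s - a) (?z a)) has_vector_derivative A *v lflow A (s - a) (?z a)) (at s)"
        by (simp add: o_def)
      then show ?thesis by (rule has_vector_derivative_at_within)
    qed
    from fundamental_theorem_of_calculus[OF ab(2) this] show ?thesis by (simp add: integral_unique)
  qed
  \<comment> \<open>The free flow satisfies the homogeneous equation exactly (\<open>ftc\<close>),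
    so the defect is the sum of two errors: \<open>?I1\<close> from replacing the solution by the
    free flow, \<open>?I2\<close> from replacing the propagator by the identity.\<close>
  let ?I1 = "\<lambda>s. A *v lflow A (s - a) (?z a) - A *v ?z s"
  let ?I2 = "\<lambda>s. lflow A (b - s) (B *v u s) - B *v u s"
  have cint: "(\<lambda>s. lflow A (b - s) (B *v u s)) integrable_on {a..b}"
    by (rule control_integrable[OF compact_U u])
  have i1: "?I1 integrable_on {a..b}" and i2: "?I2 integrable_on {a..b}"
    by (intro integrable_diff hint zint cint uint)+
  have "?z b - ?z a - integral {a..b} (\<lambda>s. A *v ?z s + B *v u s) = integral {a..b} ?I1 + integral {a..b} ?I2"
    unfolding Henstock_Kurzweil_Integration.integral_diff[OF hint zint]
      Henstock_Kurzweil_Integration.integral_diff[OF cint uint]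
      Henstock_Kurzweil_Integration.integral_add[OF zint uint] ftc affine_sol_diff[OF u ab(2)]
    by (simp add: algebra_simps)
  moreover have "norm (integral {a..b} ?I1) \<le> integral {a..b} (\<lambda>_. K * C * M * (b - a))"
  proof (rule integral_norm_bound_integral[OF i1])
    fix s assume s: "s \<in> {a..b}"
    have "norm (?z s - lflow A (s - a) (?z a)) = norm (integral {a..s} (\<lambda>\<sigma>. lflow A (s - \<sigma>) (B *v u \<sigma>)))"
      using affine_sol_diff[OF u, of a s A B x] s by simp
    also have "\<dots> \<le> integral {a..s} (\<lambda>_. C * M)"
    proof (rule control_integral_bound[OF u control_integrable[OF compact_U u]])
      fix \<sigma> assume \<sigma>: "\<sigma> \<in> {a..s}" "u \<sigma> \<in> U"
      have "norm (lflow A (s - \<sigma>) (B *v u \<sigma>)) \<le> C * norm (B *v u \<sigma>)"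
        using \<sigma> s ab by (intro C(2)) auto
      also have "\<dots> \<le> C * M" using M[OF \<sigma>(2)] C(1) by (intro mult_left_mono) auto
      finally show "norm (lflow A (s - \<sigma>) (B *v u \<sigma>)) \<le> C * M" .
    qed auto
    also have "\<dots> = C * M * (s - a)" using s by simp
    also have "\<dots> \<le> C * M * (b - a)" using s C(1) M0 by (intro mult_left_mono) auto
    finally have *: "norm (lflow A (s - a) (?z a) - ?z s) \<le> C * M * (b - a)" by (simp add: norm_minus_commute)
    have "norm (?I1 s) = norm (A *v (lflow A (s - a) (?z a) - ?z s))" by (simp add: matrix_vector_mult_diff_distrib)
    also have "\<dots> \<le> K * (C * M * (b - a))" using * K(2) by (intro order_trans[OF K(1)] mult_left_mono)
    finally show "norm (?I1 s) \<le> K * C * M * (b - a)" by (simp add: mult.assoc)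
  qed auto
  moreover have "norm (integral {a..b} ?I2) \<le> integral {a..b} (\<lambda>_. K * C * M * (b - a))"
  proof (rule control_integral_bound[OF u i2])
    fix s assume s: "s \<in> {a..b}" "u s \<in> U"
    have "norm (?I2 s) \<le> C * norm (A *v (B *v u s)) * (b - s)"
      using s ab by (intro lflow_diff_bound[of "2 * T"] C(2)) auto
    also have "\<dots> \<le> C * (K * M) * (b - a)"
      using s C(1) K(2) M0 M[OF s(2)] by (intro mult_mono order_trans[OF K(1)] mult_left_mono) auto
    finally show "norm (?I2 s) \<le> K * C * M * (b - a)" by (simp add: mult_ac)
  qed auto
  moreover have "integral {a..b} (\<lambda>_. K * C * M * (b - a)) = K * C * M * (b - a)^2"
    using ab(2) by (simp add: power2_eq_square mult_ac)
  ultimately show ?thesis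
    using norm_triangle_ineq[of "integral {a..b} ?I1" "integral {a..b} ?I2"] by (simp only: mult.assoc)
qed

lemma rhs_set_integrable:
  assumes "u \<in> controls" "continuous_on UNIV z"
  shows "set_integrable lebesgue {a..b} (\<lambda>s. A *v z s + B *v u s)"
proof (rule set_integral_add)
  have "continuous_on {a..b} (\<lambda>s. A *v z s)"
    by (rule bounded_linear.continuous_on[OF matrix_vector_mul_bounded_linear continuous_on_subset[OF assms(2)]]) auto
  then show "set_integrable lebesgue {a..b} (\<lambda>s. A *v z s)"
    by (intro absolutely_integrable_continuous_real)
qed (rule control_term_set_integrable[OF assms(1)])

text \<open>The difference of the two sides of the integral equation has quadratic increments, hence
  is constant, and its value at 0 is the initial value.\<close>

lemma affine_sol_is_solution:
  assumes u: "u \<in> controls"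
  shows "is_solution A B x u (\<lambda>t. affine_sol A B t x u)"
proof -
  let ?z = "\<lambda>s. affine_sol A B s x u"
  let ?f = "\<lambda>s. A *v ?z s + B *v u s"
  have zc: "continuous_on S ?z" for S by (rule continuous_affine_sol[OF u])
  have si: "set_integrable lebesgue {a..b} ?f" for a b by (rule rhs_set_integrable[OF u zc])
  have fi: "?f integrable_on {a..b}" for a b by (rule set_lebesgue_integral_eq_integral(1)[OF si])
  obtain M where "M > 0" "\<forall>y\<in>U. norm (B *v y) \<le> M"
    by (rule compact_matrix_bound[OF compact_U, of B])
  then have M: "norm (B *v y) \<le> M" if "y \<in> U" for y using that by blast
  define K where "K = norm A"
  have K: "K \<ge> 0" by (simp add: K_def)
  have K2: "norm (A *v x) \<le> K * norm x" for x unfolding K_def by (rule norm_matrix_vector_mult_le)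
  have const: "?z t - oint ?f t = ?z 0 - oint ?f 0" for t
  proof (rule quadratic_increments_constant[where F = "\<lambda>t. ?z t - oint ?f t"])
    fix T :: real
    show "\<exists>C. \<forall>a b. - T \<le> a \<longrightarrow> a \<le> b \<longrightarrow> b \<le> T \<longrightarrow>
        norm (?z b - oint ?f b - (?z a - oint ?f a)) \<le> C * (b - a)\<^sup>2"
    proof (cases "T \<ge> 0")
      case True
      obtain C where C: "C \<ge> 1" "\<And>t x. \<bar>t\<bar> \<le> 2 * T \<Longrightarrow> norm (lflow A t x) \<le> C * norm x"
        using lflow_norm_bound[of "2 * T" A] True by auto
      obtain Z where Z: "\<forall>y\<in>?z ` {-T..T}. norm y \<le> Z"
        using compact_imp_bounded[OF compact_continuous_image[OF zc compact_Icc]] bounded_iff by blast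
      have Z': "norm (?z t) \<le> Z" if "\<bar>t\<bar> \<le> T" for t
        using that by (intro Z[rule_format] imageI) auto
      show ?thesis
      proof (intro exI allI impI)
        fix a b assume ab: "- T \<le> a" "a \<le> b" "b \<le> T"
        have "?z b - oint ?f b - (?z a - oint ?f a) = ?z b - ?z a - integral {a..b} ?f"
          using oint_diff[OF fi ab(2)] by (simp add: algebra_simps)
        moreover have "norm (?z b - ?z a - integral {a..b} ?f) \<le> (2 * K * C * M) * (b - a)\<^sup>2"
          by (rule affine_sol_increment_bound[OF u M C K2 K Z' ab])
        ultimately show "norm (?z b - oint ?f b - (?z a - oint ?f a)) \<le> (2 * K * C * M) * (b - a)\<^sup>2"
          by (simp only:)
      qed
    next
      case False
      then have "\<not> (- T \<le> a \<and> a \<le> b \<and> b \<le> T)" for a b by linarith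
      then show ?thesis by blast
    qed
  qed
  have "?z 0 = x" by (simp add: affine_sol_def)
  then have "?z t = x + oint ?f t" for t
    using const[of t] by (simp only: oint_0 diff_zero diff_eq_eq)
  then show ?thesis
    unfolding is_solution_def interval_lebesgue_integral_oint[OF si] using zc by blast
qed

text \<open>The merely measurable control term cancels in the difference of two solutions. What
  remains is an integral of a continuous function, so the difference solves x' = Ax classically and
  starts at 0.\<close>

lemma is_solution_unique:
  assumes u: "u \<in> controls" and y: "is_solution A B x u y" and z: "is_solution A B x u z"
  shows "y = z"
proof
  fix t
  have c: "continuous_on UNIV y" "continuous_on UNIV z" using y z unfolding is_solution_def by blast+
  let ?f = "\<lambda>w s. A *v w s + B *v u s"
  have si: "set_integrable lebesgue {a..b} (?f y)" "set_integrable lebesgue {a..b} (?f z)" for a b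
    using rhs_set_integrable[OF u] c by auto
  note fi = set_lebesgue_integral_eq_integral(1)[OF si(1)] set_lebesgue_integral_eq_integral(1)[OF si(2)]
  have eq: "y t = x + oint (?f y) t" "z t = x + oint (?f z) t" for t
    using spec[OF conjunct2[OF y[unfolded is_solution_def]], of t] spec[OF conjunct2[OF z[unfolded is_solution_def]], of t]
    unfolding interval_lebesgue_integral_oint[OF si(1)] interval_lebesgue_integral_oint[OF si(2)] .
  define d where "d t = y t - z t" for t
  have dc: "continuous_on S (\<lambda>s. A *v d s)" for S
    unfolding d_def
    by (intro bounded_linear.continuous_on[OF matrix_vector_mul_bounded_linear] continuous_on_diff
        continuous_on_subset[OF c(1)] continuous_on_subset[OF c(2)]) auto
  have diff: "d b - d a = integral {a..b} (\<lambda>s. A *v d s)" if "a \<le> b" for a b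
  proof -
    have "d b - d a = integral {a..b} (?f y) - integral {a..b} (?f z)"
      using eq(1)[of a] eq(1)[of b] eq(2)[of a] eq(2)[of b]
      unfolding d_def oint_diff[OF fi(1) that, symmetric] oint_diff[OF fi(2) that, symmetric]
      by (simp add: algebra_simps)
    also have "\<dots> = integral {a..b} (\<lambda>s. ?f y s - ?f z s)"
      by (rule Henstock_Kurzweil_Integration.integral_diff[OF fi, symmetric])
    finally show ?thesis by (simp add: d_def matrix_vector_mult_diff_distrib)
  qed
  have "(d has_vector_derivative A *v d t) (at t)" for t
  proof -
    let ?S = "{t - 1..t + 1}"
    have "((\<lambda>s. integral {t - 1..s} (\<lambda>s. A *v d s)) has_vector_derivative A *v d t) (at t within ?S)"
      by (rule integral_has_vector_derivative[OF dc]) auto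
    then have "((\<lambda>s. integral {t - 1..s} (\<lambda>s. A *v d s)) has_vector_derivative A *v d t) (at t)"
      using at_within_Icc_at[of "t - 1" t "t + 1"] by simp
    then have "((\<lambda>s. integral {t - 1..s} (\<lambda>s. A *v d s) + d (t - 1)) has_vector_derivative A *v d t) (at t)"
      by (simp only: has_vector_derivative_add_const)
    then show ?thesis
    proof (rule has_vector_derivative_transform_within_open[where S = "{t - 1<..}"])
      fix s assume "s \<in> {t - 1<..}"
      then show "integral {t - 1..s} (\<lambda>s. A *v d s) + d (t - 1) = d s"
        using diff[of "t - 1" s] by (simp add: algebra_simps)
    qed auto
  qed
  then have "d t = lflow A t (d 0)" by (rule lflow_ode_unique)
  also have "d 0 = 0" using eq(1)[of 0] eq(2)[of 0] by (simp add: d_def)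
  finally show "y t = z t" by (simp add: d_def lflow_simps)
qed

lemma lin_sol_eq:
  assumes "u \<in> controls"
  shows "lin_sol A B t x u = affine_sol A B t x u"
proof -
  have "(THE y. is_solution A B x u y) = (\<lambda>t. affine_sol A B t x u)"
    by (rule the_equality) (auto intro: affine_sol_is_solution[OF assms] is_solution_unique[OF assms])
  then show ?thesis by (simp add: lin_sol_def)
qed

end

section \<open>Controlled chains\<close>

text \<open>A single segment with its jump. Chains with at least one segment are then the transitive
  closure, and they can be cut and joined by the rules for closures.\<close>

definition chain_step ::
  "'x set \<Rightarrow> ('x \<Rightarrow> 'x \<Rightarrow> real) \<Rightarrow> 'u set \<Rightarrow> (real \<Rightarrow> 'x \<Rightarrow> 'u \<Rightarrow> 'x) \<Rightarrow> real \<Rightarrow> real \<Rightarrow> 'x \<Rightarrow> 'x \<Rightarrow> bool"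
where
  "chain_step M d V \<Phi> \<epsilon> \<tau> x y \<longleftrightarrow> x \<in> M \<and> y \<in> M \<and> (\<exists>v\<in>V. \<exists>T\<ge>\<tau>. d (\<Phi> T x v) y < \<epsilon>)"

lemma controlled_chain_eq: "controlled_chain M d V \<Phi> \<epsilon> \<tau> x y \<longleftrightarrow> (chain_step M d V \<Phi> \<epsilon> \<tau>)\<^sup>+\<^sup>+ x y"
proof
  assume "controlled_chain M d V \<Phi> \<epsilon> \<tau> x y"
  then obtain k p v T where *: "k \<ge> 1" "p 0 = x" "p k = y" "\<forall>j\<le>k. p j \<in> M"
    "\<forall>j<k. v j \<in> V \<and> T j \<ge> \<tau> \<and> d (\<Phi> (T j) (p j) (v j)) (p (Suc j)) < \<epsilon>"
    unfolding controlled_chain_def by blast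
  have "\<forall>j<k. chain_step M d V \<Phi> \<epsilon> \<tau> (p j) (p (Suc j))"
  proof (intro allI impI)
    fix j assume "j < k"
    then show "chain_step M d V \<Phi> \<epsilon> \<tau> (p j) (p (Suc j))"
      using * unfolding chain_step_def by (metis Suc_leI less_imp_le_nat)
  qed
  with * show "(chain_step M d V \<Phi> \<epsilon> \<tau>)\<^sup>+\<^sup>+ x y"
    unfolding tranclp_power relpowp_fun_conv by (intro exI[of _ k]) auto
next
  assume "(chain_step M d V \<Phi> \<epsilon> \<tau>)\<^sup>+\<^sup>+ x y"
  then obtain k p where k: "k > 0" "p 0 = x" "p k = y" "\<forall>j<k. chain_step M d V \<Phi> \<epsilon> \<tau> (p j) (p (Suc j))"
    unfolding tranclp_power relpowp_fun_conv by blast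
  then have "\<forall>j. \<exists>v T. j < k \<longrightarrow> v \<in> V \<and> T \<ge> \<tau> \<and> d (\<Phi> T (p j) v) (p (Suc j)) < \<epsilon>"
    unfolding chain_step_def by blast
  then obtain v T where "\<forall>j<k. v j \<in> V \<and> T j \<ge> \<tau> \<and> d (\<Phi> (T j) (p j) (v j)) (p (Suc j)) < \<epsilon>"
    by metis
  moreover have "p j \<in> M" if "j \<le> k" for j
  proof (cases "j < k")
    case False
    with that k(1) have "j = Suc (k - 1)" "k - 1 < k" by auto
    then show ?thesis using k(4) unfolding chain_step_def by metis
  qed (use k(4) in \<open>auto simp: chain_step_def\<close>)
  ultimately show "controlled_chain M d V \<Phi> \<epsilon> \<tau> x y"
    unfolding controlled_chain_def using k by (intro exI[of _ k] exI[of _ p] exI[of _ v] exI[of _ T]) auto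
qed

lemma chain_step_mono:
  "chain_step M d V \<Phi> \<epsilon> \<tau> x y \<Longrightarrow> \<epsilon> \<le> \<epsilon>' \<Longrightarrow> \<tau>' \<le> \<tau> \<Longrightarrow> chain_step M d V \<Phi> \<epsilon>' \<tau>' x y"
  unfolding chain_step_def by (meson less_le_trans order_trans)

lemma chain_step_le:
  assumes "\<epsilon> \<le> \<epsilon>'" "\<tau>' \<le> \<tau>"
  shows "chain_step M d V \<Phi> \<epsilon> \<tau> \<le> chain_step M d V \<Phi> \<epsilon>' \<tau>'"
  by (intro predicate2I) (rule chain_step_mono[OF _ assms])

lemma chain_rtrancl_mono:
  assumes "(chain_step M d V \<Phi> \<epsilon> \<tau>)\<^sup>*\<^sup>* x y" "\<epsilon> \<le> \<epsilon>'" "\<tau>' \<le> \<tau>"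
  shows "(chain_step M d V \<Phi> \<epsilon>' \<tau>')\<^sup>*\<^sup>* x y"
  by (rule predicate2D[OF rtranclp_mono[OF chain_step_le[OF assms(2,3)]] assms(1)])

lemma chain_trancl_mono:
  assumes "(chain_step M d V \<Phi> \<epsilon> \<tau>)\<^sup>+\<^sup>+ x y" "\<epsilon> \<le> \<epsilon>'" "\<tau>' \<le> \<tau>"
  shows "(chain_step M d V \<Phi> \<epsilon>' \<tau>')\<^sup>+\<^sup>+ x y"
  using assms(1)
  by (induction rule: tranclp_induct)
    (meson chain_step_mono[OF _ assms(2,3)] tranclp.r_into_trancl tranclp.trancl_into_trancl)+

lemma tranclpE_rtrancl:
  assumes "r\<^sup>+\<^sup>+ x y"
  obtains z where "r\<^sup>*\<^sup>* x z" "r z y"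
  using assms by (cases rule: tranclp.cases) (auto intro: tranclp_into_rtranclp)

definition chain_reach ::
  "'x set \<Rightarrow> ('x \<Rightarrow> 'x \<Rightarrow> real) \<Rightarrow> 'u set \<Rightarrow> (real \<Rightarrow> 'x \<Rightarrow> 'u \<Rightarrow> 'x) \<Rightarrow> 'x \<Rightarrow> 'x \<Rightarrow> bool"
where
  "chain_reach M d V \<Phi> x y \<longleftrightarrow> (\<forall>\<epsilon>>0. \<forall>\<tau>>0. (chain_step M d V \<Phi> \<epsilon> \<tau>)\<^sup>+\<^sup>+ x y)"

text \<open>For a chain recurrent \<open>x\<close> this is its class under mutual reachability;
  \<open>chain_control_set_class\<close> and \<open>chain_control_set_eq_class\<close> show that the
  chain control sets are exactly these classes.\<close>

definition chain_class ::
  "'x set \<Rightarrow> ('x \<Rightarrow> 'x \<Rightarrow> real) \<Rightarrow> 'u set \<Rightarrow> (real \<Rightarrow> 'x \<Rightarrow> 'u \<Rightarrow> 'x) \<Rightarrow> 'x \<Rightarrow> 'x set"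
where
  "chain_class M d V \<Phi> x = {y \<in> M. chain_reach M d V \<Phi> x y \<and> chain_reach M d V \<Phi> y x}"

lemma chain_reach_trans: "chain_reach M d V \<Phi> x y \<Longrightarrow> chain_reach M d V \<Phi> y z \<Longrightarrow> chain_reach M d V \<Phi> x z"
  unfolding chain_reach_def by (meson tranclp_trans)

lemma chain_reach_carrier:
  assumes "chain_reach M d V \<Phi> x y"
  shows "x \<in> M" "y \<in> M"
proof -
  have *: "(chain_step M d V \<Phi> 1 1)\<^sup>+\<^sup>+ x y" using assms by (simp add: chain_reach_def)
  show "x \<in> M" using tranclpD[OF *] by (auto simp: chain_step_def)
  show "y \<in> M" using * by cases (auto simp: chain_step_def)
qed

lemma chain_controllable_on_iff:
  "chain_controllable_on M d V \<Phi> E \<longleftrightarrow>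
     E \<subseteq> M \<and> E \<noteq> {} \<and> (\<forall>x\<in>E. \<forall>y\<in>E. chain_reach M d V \<Phi> x y)"
  by (simp add: chain_controllable_on_def chain_reach_def controlled_chain_eq)

lemma chain_control_set_class:
  assumes "chain_reach M d V \<Phi> x x"
  shows "chain_control_set M d V \<Phi> (chain_class M d V \<Phi> x)"
proof -
  have x: "x \<in> chain_class M d V \<Phi> x"
    using assms chain_reach_carrier[OF assms] by (simp add: chain_class_def)
  have "chain_controllable_on M d V \<Phi> (chain_class M d V \<Phi> x)"
    unfolding chain_controllable_on_iff using x chain_reach_trans by (fastforce simp: chain_class_def)
  moreover have "F = chain_class M d V \<Phi> x"
    if "chain_controllable_on M d V \<Phi> F" "chain_class M d V \<Phi> x \<subseteq> F" for F
    using that x unfolding chain_controllable_on_iff by (auto simp: chain_class_def)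
  ultimately show ?thesis unfolding chain_control_set_def by blast
qed

lemma chain_control_set_eq_class:
  assumes "chain_control_set M d V \<Phi> E" "x \<in> E"
  shows "chain_reach M d V \<Phi> x x" "E = chain_class M d V \<Phi> x"
proof -
  have E: "chain_controllable_on M d V \<Phi> E" using assms(1) by (simp add: chain_control_set_def)
  then show x: "chain_reach M d V \<Phi> x x" using assms(2) by (simp add: chain_controllable_on_iff)
  have "E \<subseteq> chain_class M d V \<Phi> x"
    using E assms(2) unfolding chain_controllable_on_iff by (auto simp: chain_class_def)
  moreover have "chain_controllable_on M d V \<Phi> (chain_class M d V \<Phi> x)"
    using chain_control_set_class[OF x] by (simp add: chain_control_set_def)
  ultimately show "E = chain_class M d V \<Phi> x" using assms(1) unfolding chain_control_set_def by blast
qed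

text \<open>A function that every long trajectory piece raises from \<open>\<theta>\<close> to \<open>\<theta>'\<close> cannot be brought back by
  sufficiently small jumps.\<close>

lemma chain_separation:
  assumes h: "\<And>\<eta>. \<eta> > 0 \<Longrightarrow> \<exists>\<delta>>0. \<forall>a\<in>M. \<forall>b\<in>M. d a b < \<delta> \<longrightarrow> \<bar>h a - h b\<bar> < \<eta>"
    and inv: "\<And>T x v. x \<in> M \<Longrightarrow> v \<in> V \<Longrightarrow> \<Phi> T x v \<in> M"
    and \<theta>: "\<theta> < \<theta>'"
    and raise: "\<And>T x v. T \<ge> \<tau> \<Longrightarrow> x \<in> M \<Longrightarrow> v \<in> V \<Longrightarrow> h x \<ge> \<theta> \<Longrightarrow> h (\<Phi> T x v) \<ge> \<theta>'"
    and xy: "chain_reach M d V \<Phi> x y" and x: "h x \<ge> \<theta>"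
  shows "h y > (\<theta>::real)"
proof -
  obtain \<delta> where \<delta>: "\<delta> > 0" "\<And>a b. a \<in> M \<Longrightarrow> b \<in> M \<Longrightarrow> d a b < \<delta> \<Longrightarrow> \<bar>h a - h b\<bar> < \<theta>' - \<theta>"
    using h[of "\<theta>' - \<theta>"] \<theta> by auto
  have step: "h z > \<theta>" if "chain_step M d V \<Phi> \<delta> (max \<tau> 1) y z" "h y \<ge> \<theta>" for y z
  proof -
    from that obtain v T where *: "y \<in> M" "z \<in> M" "v \<in> V" "T \<ge> \<tau>" "d (\<Phi> T y v) z < \<delta>"
      unfolding chain_step_def by auto
    from \<delta>(2)[OF inv[OF *(1,3)] *(2,5)] raise[OF *(4,1,3) that(2)] show ?thesis by linarith
  qed
  have "(chain_step M d V \<Phi> \<delta> (max \<tau> 1))\<^sup>+\<^sup>+ x y"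
    using xy \<delta>(1) by (simp add: chain_reach_def)
  then show ?thesis
  proof (induction rule: tranclp_induct)
    case (base y)
    then show ?case using step x by blast
  next
    case (step y z)
    then show ?case using \<open>\<And>z y. chain_step M d V \<Phi> \<delta> (max \<tau> 1) y z \<Longrightarrow> \<theta> \<le> h y \<Longrightarrow> \<theta> < h z\<close> by fastforce
  qed
qed

text \<open>What the manipulation of chains uses: trajectories can be restarted and joined.
  Continuity is uniform in the control because \<delta> has to be fixed before the chain, and with
  it the control, is known.\<close>

locale control_system =
  fixes M :: "'a::metric_space set" and V :: "'u set" and \<Phi> :: "real \<Rightarrow> 'a \<Rightarrow> 'u \<Rightarrow> 'a"
  assumes invariant: "x \<in> M \<Longrightarrow> v \<in> V \<Longrightarrow> \<Phi> T x v \<in> M"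
    and shift: "v \<in> V \<Longrightarrow> s \<ge> 0 \<Longrightarrow> \<exists>w\<in>V. \<forall>t\<ge>0. \<forall>x\<in>M. \<Phi> (s + t) x v = \<Phi> t (\<Phi> s x v) w"
    and concat: "u \<in> V \<Longrightarrow> v \<in> V \<Longrightarrow> s \<ge> 0 \<Longrightarrow> \<exists>w\<in>V. \<forall>t\<ge>0. \<forall>x\<in>M. \<Phi> (s + t) x w = \<Phi> t (\<Phi> s x u) v"
    and continuity: "T \<ge> 0 \<Longrightarrow> \<epsilon> > 0 \<Longrightarrow>
      \<exists>\<delta>>0. \<forall>x\<in>M. \<forall>y\<in>M. \<forall>v\<in>V. dist x y < \<delta> \<longrightarrow> dist (\<Phi> T x v) (\<Phi> T y v) < \<epsilon>"
begin

abbreviation step where "step \<equiv> chain_step M dist V \<Phi>"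
abbreviation reach (infix \<open>\<leadsto>\<close> 50) where "x \<leadsto> y \<equiv> chain_reach M dist V \<Phi> x y"

text \<open>Starting with a chain for times at least 2\<tau>, its first segment can be cut at time
  \<tau>. The first half is started at \<open>x\<close> instead of \<open>x'\<close>, and continuity
  over the fixed time \<tau> turns the error into an admissible jump.\<close>

lemma reach_limit_source:
  assumes x: "x \<in> M" and lim: "\<And>\<delta>. \<delta> > 0 \<Longrightarrow> \<exists>x'\<in>M. dist x x' < \<delta> \<and> x' \<leadsto> y"
  shows "x \<leadsto> y"
  unfolding chain_reach_def
proof (intro allI impI)
  fix \<epsilon> \<tau> :: real assume e: "\<epsilon> > 0" "\<tau> > 0"
  obtain \<delta> where \<delta>: "\<delta> > 0" "\<And>x y v. x \<in> M \<Longrightarrow> y \<in> M \<Longrightarrow> v \<in> V \<Longrightarrow> dist x y < \<delta> \<Longrightarrow> dist (\<Phi> \<tau> x v) (\<Phi> \<tau> y v) < \<epsilon>"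
    using continuity[of \<tau> \<epsilon>] e by (meson less_imp_le)
  obtain x' where x': "x' \<in> M" "dist x x' < \<delta>" "x' \<leadsto> y" using lim[OF \<delta>(1)] by blast
  then have "(step \<epsilon> (2 * \<tau>))\<^sup>+\<^sup>+ x' y" using e by (simp add: chain_reach_def)
  then obtain z where z: "step \<epsilon> (2 * \<tau>) x' z" "(step \<epsilon> (2 * \<tau>))\<^sup>*\<^sup>* z y"
    using tranclpD[of "step _ _"] by metis
  then obtain v T where v: "v \<in> V" "T \<ge> 2 * \<tau>" "dist (\<Phi> T x' v) z < \<epsilon>" "z \<in> M"
    unfolding chain_step_def by blast
  obtain w where w: "w \<in> V" "\<And>t x. t \<ge> 0 \<Longrightarrow> x \<in> M \<Longrightarrow> \<Phi> (\<tau> + t) x v = \<Phi> t (\<Phi> \<tau> x v) w"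
    using shift[OF v(1), of \<tau>] e by (meson less_imp_le)
  have "step \<epsilon> \<tau> x (\<Phi> \<tau> x' v)"
    unfolding chain_step_def using \<delta>(2)[OF x x'(1) v(1) x'(2)] v(1) x invariant[OF x'(1) v(1)] by blast
  moreover have "step \<epsilon> \<tau> (\<Phi> \<tau> x' v) z"
    unfolding chain_step_def
  proof (intro conjI bexI exI)
    show "dist (\<Phi> (T - \<tau>) (\<Phi> \<tau> x' v) w) z < \<epsilon>" using w(2)[of "T - \<tau>" x'] v e x' by simp
  qed (use v w e invariant[OF x'(1) v(1)] in auto)
  moreover have "(step \<epsilon> \<tau>)\<^sup>*\<^sup>* z y"
    using e by (intro chain_rtrancl_mono[OF z(2)]) auto
  ultimately show "(step \<epsilon> \<tau>)\<^sup>+\<^sup>+ x y"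
    by (meson rtranclp_into_tranclp2 converse_rtranclp_into_rtranclp)
qed

text \<open>Only the last jump changes, so half of \<epsilon> is kept for replacing
  \<open>y'\<close> by \<open>y\<close>.\<close>

lemma reach_limit_target:
  assumes y: "y \<in> M" and lim: "\<And>\<delta>. \<delta> > 0 \<Longrightarrow> \<exists>y'\<in>M. dist y y' < \<delta> \<and> x \<leadsto> y'"
  shows "x \<leadsto> y"
  unfolding chain_reach_def
proof (intro allI impI)
  fix \<epsilon> \<tau> :: real assume e: "\<epsilon> > 0" "\<tau> > 0"
  obtain y' where y': "y' \<in> M" "dist y y' < \<epsilon> / 2" "x \<leadsto> y'" using lim[of "\<epsilon> / 2"] e by auto
  then have "(step (\<epsilon> / 2) \<tau>)\<^sup>+\<^sup>+ x y'" using e by (simp add: chain_reach_def)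
  then obtain z where z: "(step (\<epsilon> / 2) \<tau>)\<^sup>*\<^sup>* x z" "step (\<epsilon> / 2) \<tau> z y'"
    by (rule tranclpE_rtrancl)
  then obtain v T where v: "v \<in> V" "T \<ge> \<tau>" "dist (\<Phi> T z v) y' < \<epsilon> / 2" "z \<in> M"
    unfolding chain_step_def by blast
  have "dist (\<Phi> T z v) y < \<epsilon>"
    using v(3) y'(2) dist_triangle_half_r[of y' "\<Phi> T z v" \<epsilon> y] by (simp add: dist_commute)
  then have "step \<epsilon> \<tau> z y" unfolding chain_step_def using v y by blast
  moreover have "(step \<epsilon> \<tau>)\<^sup>*\<^sup>* x z"
    using e by (intro chain_rtrancl_mono[OF z(1)]) auto
  ultimately show "(step \<epsilon> \<tau>)\<^sup>+\<^sup>+ x y" by (rule rtranclp_into_tranclp1[rotated])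
qed

text \<open>The trajectory piece is put in front of the first segment of the chain, which only
  lengthens it.\<close>

lemma reach_flow_source:
  assumes x: "x \<in> M" "u \<in> V" "T \<ge> 0" and "\<Phi> T x u \<leadsto> y"
  shows "x \<leadsto> y"
  unfolding chain_reach_def
proof (intro allI impI)
  fix \<epsilon> \<tau> :: real assume e: "\<epsilon> > 0" "\<tau> > 0"
  then have "(step \<epsilon> \<tau>)\<^sup>+\<^sup>+ (\<Phi> T x u) y" using assms(4) by (simp add: chain_reach_def)
  then obtain z where z: "step \<epsilon> \<tau> (\<Phi> T x u) z" "(step \<epsilon> \<tau>)\<^sup>*\<^sup>* z y"
    using tranclpD[of "step _ _"] by metis
  then obtain v S where v: "v \<in> V" "S \<ge> \<tau>" "dist (\<Phi> S (\<Phi> T x u) v) z < \<epsilon>" "z \<in> M"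
    unfolding chain_step_def by blast
  obtain w where w: "w \<in> V" "\<And>t x. t \<ge> 0 \<Longrightarrow> x \<in> M \<Longrightarrow> \<Phi> (T + t) x w = \<Phi> t (\<Phi> T x u) v"
    using concat[OF x(2) v(1) x(3)] by blast
  have "step \<epsilon> \<tau> x z"
    unfolding chain_step_def
  proof (intro conjI bexI exI)
    show "dist (\<Phi> (T + S) x w) z < \<epsilon>" using w(2)[of S x] v e x by simp
  qed (use v w e x in auto)
  with z(2) show "(step \<epsilon> \<tau>)\<^sup>+\<^sup>+ x y" by (rule rtranclp_into_tranclp2[rotated])
qed

text \<open>The last segment is prolonged by the piece from \<open>y\<close>; its former jump,
  carried along for time \<open>T\<close>, has to stay below \<epsilon>, whence the smaller
  tolerance \<delta>.\<close>

lemma reach_flow_target: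
  assumes u: "u \<in> V" "T \<ge> 0" and "x \<leadsto> y"
  shows "x \<leadsto> \<Phi> T y u"
  unfolding chain_reach_def
proof (intro allI impI)
  fix \<epsilon> \<tau> :: real assume e: "\<epsilon> > 0" "\<tau> > 0"
  have y: "y \<in> M" using chain_reach_carrier[OF assms(3)] by simp
  obtain \<delta> where \<delta>: "\<delta> > 0" "\<And>x y v. x \<in> M \<Longrightarrow> y \<in> M \<Longrightarrow> v \<in> V \<Longrightarrow> dist x y < \<delta> \<Longrightarrow> dist (\<Phi> T x v) (\<Phi> T y v) < \<epsilon>"
    using continuity[OF u(2) e(1)] by blast
  have "(step (min \<epsilon> \<delta>) \<tau>)\<^sup>+\<^sup>+ x y" using assms(3) e \<delta>(1) by (simp add: chain_reach_def)
  then obtain z where z: "(step (min \<epsilon> \<delta>) \<tau>)\<^sup>*\<^sup>* x z" "step (min \<epsilon> \<delta>) \<tau> z y"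
    by (rule tranclpE_rtrancl)
  then obtain v S where v: "v \<in> V" "S \<ge> \<tau>" "dist (\<Phi> S z v) y < \<delta>" "z \<in> M"
    unfolding chain_step_def by auto
  have "S \<ge> 0" using v(2) e by simp
  obtain w where w: "w \<in> V" "\<And>t x. t \<ge> 0 \<Longrightarrow> x \<in> M \<Longrightarrow> \<Phi> (S + t) x w = \<Phi> t (\<Phi> S x v) u"
    using concat[OF v(1) u(1) \<open>S \<ge> 0\<close>] by blast
  have "step \<epsilon> \<tau> z (\<Phi> T y u)"
    unfolding chain_step_def
  proof (intro conjI bexI exI)
    show "dist (\<Phi> (S + T) z w) (\<Phi> T y u) < \<epsilon>"
      using w(2)[OF u(2) v(4)] \<delta>(2)[OF invariant[OF v(4,1)] y u(1) v(3)] by simp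
  qed (use v w e u invariant[OF y u(1)] in auto)
  moreover have "(step \<epsilon> \<tau>)\<^sup>*\<^sup>* x z"
    using e by (intro chain_rtrancl_mono[OF z(1)]) auto
  ultimately show "(step \<epsilon> \<tau>)\<^sup>+\<^sup>+ x (\<Phi> T y u)" by (rule rtranclp_into_tranclp1[rotated])
qed

text \<open>Two segments suffice. The first runs for time \<tau> from \<open>x\<close> and jumps
  back onto the trajectory, the second follows the trajectory until it is close to \<open>y\<close>;
  a link of length 2\<tau> leaves time \<tau> for the second.\<close>

lemma reach_along_trajectory:
  assumes s: "\<And>t. s t \<in> M" "\<And>t1. \<exists>w\<in>V. \<forall>t\<ge>0. s (t1 + t) = \<Phi> t (s t1) w"
    and x: "x \<in> M" and y: "y \<in> M"
    and link: "\<And>\<delta> D. \<delta> > 0 \<Longrightarrow> \<exists>t1 t2. t2 \<ge> t1 + D \<and> dist x (s t1) < \<delta> \<and> dist y (s t2) < \<delta>"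
  shows "x \<leadsto> y"
  unfolding chain_reach_def
proof (intro allI impI)
  fix \<epsilon> \<tau> :: real assume e: "\<epsilon> > 0" "\<tau> > 0"
  obtain \<delta> where \<delta>: "\<delta> > 0" "\<And>x y v. x \<in> M \<Longrightarrow> y \<in> M \<Longrightarrow> v \<in> V \<Longrightarrow> dist x y < \<delta> \<Longrightarrow> dist (\<Phi> \<tau> x v) (\<Phi> \<tau> y v) < \<epsilon>"
    using continuity[of \<tau> \<epsilon>] e by (meson less_imp_le)
  obtain t1 t2 where t: "t2 \<ge> t1 + 2 * \<tau>" "dist x (s t1) < min \<epsilon> \<delta>" "dist y (s t2) < min \<epsilon> \<delta>"
    using link[of "min \<epsilon> \<delta>" "2 * \<tau>"] e \<delta>(1) by auto
  obtain w where w: "w \<in> V" "\<And>t. t \<ge> 0 \<Longrightarrow> s (t1 + t) = \<Phi> t (s t1) w" using s(2)[of t1] by blast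
  obtain w' where w': "w' \<in> V" "\<And>t. t \<ge> 0 \<Longrightarrow> s (t1 + \<tau> + t) = \<Phi> t (s (t1 + \<tau>)) w'"
    using s(2)[of "t1 + \<tau>"] by blast
  have "dist (\<Phi> \<tau> x w) (s (t1 + \<tau>)) < \<epsilon>"
    using \<delta>(2)[OF x s(1) w(1), of t1] w(2)[of \<tau>] t(2) e by simp
  then have "step \<epsilon> \<tau> x (s (t1 + \<tau>))" unfolding chain_step_def using x s(1) w(1) by blast
  moreover have "step \<epsilon> \<tau> (s (t1 + \<tau>)) y"
    unfolding chain_step_def
  proof (intro conjI bexI exI)
    have "\<Phi> (t2 - t1 - \<tau>) (s (t1 + \<tau>)) w' = s t2" using w'(2)[of "t2 - t1 - \<tau>"] t(1) e by simp
    then show "dist (\<Phi> (t2 - t1 - \<tau>) (s (t1 + \<tau>)) w') y < \<epsilon>" using t(3) by (simp add: dist_commute)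
  qed (use t w' s y in auto)
  ultimately show "(step \<epsilon> \<tau>)\<^sup>+\<^sup>+ x y" by (meson tranclp.r_into_trancl tranclp.trancl_into_trancl)
qed

end

section \<open>The induced system on the sphere\<close>

text \<open>Split the difference into (a - b)/|a| and the multiple (|b| - |a|)/|a| of the unit
  vector of b; each has norm at most |a - b|/|a|. With \<open>sgn 0 = 0\<close> the case b = 0 is
  included.\<close>

lemma dist_sgn_le:
  fixes a b :: "'a::real_normed_vector"
  assumes "a \<noteq> 0"
  shows "dist (sgn a) (sgn b) \<le> 2 * norm (a - b) / norm a"
proof (cases "b = 0")
  case True
  then show ?thesis using assms by (simp add: dist_norm norm_sgn)
next
  case False
  have "sgn a - sgn b = (1 / norm a) *\<^sub>R (a - b) + ((norm b - norm a) / norm a) *\<^sub>R sgn b"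
    using assms False by (simp add: sgn_div_norm algebra_simps divide_simps)
      (simp add: scaleR_left_distrib[symmetric] scaleR_left_diff_distrib[symmetric] divide_simps)
  then have "norm (sgn a - sgn b) \<le> norm ((1 / norm a) *\<^sub>R (a - b)) + norm (((norm b - norm a) / norm a) *\<^sub>R sgn b)"
    using norm_triangle_ineq by metis
  also have "\<dots> = norm (a - b) / norm a + \<bar>norm b - norm a\<bar> / norm a"
    using False by (simp add: norm_sgn)
  also have "\<dots> \<le> norm (a - b) / norm a + norm (a - b) / norm a"
    using norm_triangle_ineq3[of b a] by (intro add_left_mono divide_right_mono) (auto simp: norm_minus_commute)
  finally show ?thesis by (simp add: dist_norm)
qed

lemma norm_fst_le': "norm (fst y) \<le> norm y" and norm_snd_le': "norm (snd y) \<le> norm y"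
  using norm_fst_le[of "fst y" "snd y"] norm_snd_le[of "snd y" "fst y"] by simp_all

lemma sgn_pos_scaleR: "c > 0 \<Longrightarrow> sgn (c *\<^sub>R x) = sgn x" for x :: "'a::real_normed_vector"
  by (simp add: sgn_scaleR)

lemma sgn_in_sphere: "x \<noteq> 0 \<Longrightarrow> sgn x \<in> sphere 0 1" for x :: "'a::real_normed_vector"
  by (simp add: norm_sgn)

lemma sgn_unit: "x \<in> sphere 0 1 \<Longrightarrow> sgn x = x" for x :: "'a::real_normed_vector"
  by (simp add: sgn_div_norm)

locale poincare_system = control_range U
  for U :: "(real^'m) set" +
  fixes A :: "real^'n^'n" and B :: "real^'m^'n"
begin

abbreviation "sph \<equiv> sphere (0 :: (real^'n) \<times> real) 1"
abbreviation "lsol \<equiv> lift_sol A B"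
abbreviation "ssol \<equiv> sphere_sol A B"

lemma control_bound:
  obtains M where "M > 0" "\<forall>y\<in>U. norm (B *v y) \<le> M"
  by (rule compact_matrix_bound[OF compact_U, of B])

lemma drive_bound:
  assumes "T \<ge> 0"
  shows "\<exists>D\<ge>0. \<forall>t\<in>{0..T}. \<forall>u\<in>controls. norm (drive A B u t) \<le> D"
proof -
  obtain M where M: "M > 0" "\<forall>y\<in>U. norm (B *v y) \<le> M" by (rule control_bound)
  obtain C where C: "C \<ge> 1" "\<forall>t x. \<bar>t\<bar> \<le> T \<longrightarrow> norm (lflow A t x) \<le> C * norm x"
    using lflow_norm_bound[OF assms, of A] by blast
  have "norm (drive A B u t) \<le> C * M * T" if t: "t \<in> {0..T}" and u: "u \<in> controls" for t u
  proof -
    have "norm (integral {0..t} (\<lambda>s. lflow A (- s) (B *v u s))) \<le> integral {0..t} (\<lambda>_. C * M)"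
    proof (rule control_integral_bound[OF u drive_integrable[OF u]])
      fix s assume s: "s \<in> {0..t}" "u s \<in> U"
      have "norm (lflow A (- s) (B *v u s)) \<le> C * norm (B *v u s)"
        using s t by (intro C(2)[rule_format]) auto
      also have "\<dots> \<le> C * M" using M(2) s(2) C(1) by (intro mult_left_mono) auto
      finally show "norm (lflow A (- s) (B *v u s)) \<le> C * M" .
    qed auto
    also have "\<dots> = C * M * t" using t by simp
    also have "\<dots> \<le> C * M * T" using t C(1) M(1) by (intro mult_left_mono) auto
    finally show ?thesis using t by (simp add: drive_def oint_def)
  qed
  then show ?thesis using C(1) M(1) assms by (intro exI[of _ "C * M * T"]) auto
qed

text \<open>The lower bound comes from solving the explicit formula for the initial value.
  Uniformity in the control yields the uniform continuity required of the system on the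
  sphere.\<close>

lemma lsol_bound:
  assumes "T \<ge> 0"
  shows "\<exists>C\<ge>1. \<forall>t\<in>{0..T}. \<forall>u\<in>controls. \<forall>y. norm (lsol t y u) \<le> C * norm y \<and> norm y \<le> C * norm (lsol t y u)"
proof -
  obtain C where C: "C \<ge> 1" "\<forall>t x. \<bar>t\<bar> \<le> T \<longrightarrow> norm (lflow A t x) \<le> C * norm x"
    using lflow_norm_bound[OF assms, of A] by blast
  obtain D where D: "D \<ge> 0" "\<forall>t\<in>{0..T}. \<forall>u\<in>controls. norm (drive A B u t) \<le> D"
    using drive_bound[OF assms] by blast
  let ?K = "C * (1 + D) + 1"
  have "norm (lsol t y u) \<le> ?K * norm y \<and> norm y \<le> ?K * norm (lsol t y u)"
    if t: "t \<in> {0..T}" and u: "u \<in> controls" for t u y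
  proof
    have scaled: "norm (r *\<^sub>R drive A B u t) \<le> \<bar>r\<bar> * D" for r
      using D(2) t u by (simp add: mult_left_mono)
    note eq = lift_sol_eq[OF u, of A B t y]
    have "norm (lsol t y u) \<le> norm (lflow A t (fst y + snd y *\<^sub>R drive A B u t)) + norm (snd y)"
      unfolding eq by (rule norm_Pair_le)
    also have "\<dots> \<le> C * norm (fst y + snd y *\<^sub>R drive A B u t) + norm (snd y)"
      using C(2) t by (intro add_right_mono) auto
    also have "\<dots> \<le> C * (norm y + norm y * D) + norm y"
    proof (intro add_mono mult_left_mono)
      have "norm (fst y + snd y *\<^sub>R drive A B u t) \<le> norm (fst y) + \<bar>snd y\<bar> * D"
        by (intro order_trans[OF norm_triangle_ineq] add_left_mono scaled)
      also have "\<dots> \<le> norm y + norm y * D"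
        using norm_fst_le'[of y] norm_snd_le'[of y] D(1) by (intro add_mono mult_right_mono) auto
      finally show "norm (fst y + snd y *\<^sub>R drive A B u t) \<le> norm y + norm y * D" .
    qed (use C(1) norm_snd_le'[of y] in auto)
    finally show "norm (lsol t y u) \<le> ?K * norm y" by (simp add: algebra_simps)
    let ?w = "lsol t y u"
    have y: "y = (lflow A (- t) (fst ?w) - snd ?w *\<^sub>R drive A B u t, snd ?w)"
      unfolding eq by simp
    have "norm y \<le> norm (lflow A (- t) (fst ?w) - snd ?w *\<^sub>R drive A B u t) + norm (snd ?w)"
      by (subst y) (rule norm_Pair_le)
    also have "\<dots> \<le> (C * norm (fst ?w) + \<bar>snd ?w\<bar> * D) + norm (snd ?w)"
      using C(2) t by (intro add_right_mono order_trans[OF norm_triangle_ineq4] add_mono scaled) auto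
    also have "\<dots> \<le> (C * norm ?w + norm ?w * D) + norm ?w"
      using norm_fst_le'[of ?w] norm_snd_le'[of ?w] D(1) C(1)
      by (intro add_mono mult_right_mono mult_left_mono) auto
    also have "\<dots> \<le> (C * norm ?w + norm ?w * (C * D)) + norm ?w"
      using C(1) D(1) mult_right_mono[of 1 C D] by (intro add_mono order_refl mult_left_mono) auto
    finally show "norm y \<le> ?K * norm ?w" by (simp add: algebra_simps)
  qed
  moreover have "?K \<ge> 1" using C(1) D(1) by simp
  ultimately show ?thesis by blast
qed

lemma lsol_scaleR: "lsol t (c *\<^sub>R y) u = c *\<^sub>R lsol t y u"
  by (rule linear_scale[OF linear_lift_sol])

lemma lsol_nonzero:
  assumes "u \<in> controls" "y \<noteq> 0"
  shows "lsol t y u \<noteq> 0"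
proof
  assume *: "lsol t y u = 0"
  then have "snd y = 0" by (simp add: lift_sol_eq[OF assms(1)] zero_prod_def)
  moreover from this * have "fst y = 0" by (simp add: lift_sol_eq[OF assms(1)] zero_prod_def)
  ultimately show False using assms(2) by (simp add: prod_eq_iff)
qed

lemma ssol_sgn: "y \<noteq> 0 \<Longrightarrow> ssol t (sgn y) u = sgn (lsol t y u)"
  by (simp add: sphere_sol_def sgn_div_norm[of y] lsol_scaleR sgn_pos_scaleR)

lemma ssol_uminus: "ssol t (- s) u = - ssol t s u"
  using lsol_scaleR[of t "- 1" s u] by (simp add: sphere_sol_def sgn_minus)

lemma ssol_cocycle:
  assumes "u \<in> controls" "t \<ge> 0" "y \<noteq> 0"
  shows "ssol (s + t) y u = ssol t (ssol s y u) (\<lambda>\<sigma>. u (s + \<sigma>))"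
proof -
  have "ssol (s + t) y u = sgn (lsol t (lsol s y u) (\<lambda>\<sigma>. u (s + \<sigma>)))"
    using lift_sol_cocycle[OF assms(1,2), of A B s y] by (simp only: sphere_sol_def)
  also have "\<dots> = ssol t (sgn (lsol s y u)) (\<lambda>\<sigma>. u (s + \<sigma>))"
    by (rule ssol_sgn[OF lsol_nonzero[OF assms(1,3)], symmetric])
  finally show ?thesis by (simp only: sphere_sol_def[of A B s])
qed

sublocale control_system sph controls ssol
proof
  show "ssol T x v \<in> sph" if "x \<in> sph" "v \<in> controls" for x v T
  proof -
    have "x \<noteq> 0" using that by auto
    then show ?thesis using lsol_nonzero[OF that(2)] sgn_in_sphere unfolding sphere_sol_def by blast
  qed
  show "\<exists>w\<in>controls. \<forall>t\<ge>0. \<forall>x\<in>sph. ssol (s + t) x v = ssol t (ssol s x v) w"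
    if v: "v \<in> controls" for v s
  proof (rule bexI[OF _ shift_control[OF v, of s]], intro allI impI ballI)
    fix t :: real and x assume "t \<ge> 0" "x \<in> sph"
    moreover from this have "x \<noteq> 0" by auto
    ultimately show "ssol (s + t) x v = ssol t (ssol s x v) (\<lambda>\<sigma>. v (s + \<sigma>))"
      using ssol_cocycle[OF v] by blast
  qed
  show "\<exists>w\<in>controls. \<forall>t\<ge>0. \<forall>x\<in>sph. ssol (s + t) x w = ssol t (ssol s x u) v"
    if uv: "u \<in> controls" "v \<in> controls" and "s \<ge> 0" for u v s
  proof (rule bexI[OF _ concat_control[OF uv, of s]], intro allI impI ballI)
    fix t :: real and x assume tx: "t \<ge> 0" "x \<in> sph"
    then have "x \<noteq> 0" by auto
    have "ssol (s + t) x (concat_control s u v) = sgn (lsol t (lsol s x u) v)"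
      using lift_sol_concat[OF uv \<open>s \<ge> 0\<close> tx(1), of A B x] by (simp only: sphere_sol_def)
    also have "\<dots> = ssol t (sgn (lsol s x u)) v"
      by (rule ssol_sgn[OF lsol_nonzero[OF uv(1) \<open>x \<noteq> 0\<close>], symmetric])
    finally show "ssol (s + t) x (concat_control s u v) = ssol t (ssol s x u) v"
      by (simp only: sphere_sol_def[of A B s])
  qed
  show "\<exists>\<delta>>0. \<forall>x\<in>sph. \<forall>y\<in>sph. \<forall>v\<in>controls. dist x y < \<delta> \<longrightarrow> dist (ssol T x v) (ssol T y v) < \<epsilon>"
    if T: "T \<ge> 0" and e: "\<epsilon> > 0" for T \<epsilon>
  proof -
    obtain C where C: "C \<ge> 1" "\<forall>t\<in>{0..T}. \<forall>u\<in>controls. \<forall>y. norm (lsol t y u) \<le> C * norm y \<and> norm y \<le> C * norm (lsol t y u)"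
      using lsol_bound[OF T] by blast
    \<comment> \<open>The lifted map expands the difference by at most \<open>C\<close>, and the
      norm in the denominator of \<open>dist_sgn_le\<close> is at least 1 / C.\<close>
    have "dist (ssol T x v) (ssol T y v) \<le> 2 * C * C * dist x y"
      if x: "x \<in> sph" and v: "v \<in> controls" for x y v
    proof -
      have nz: "lsol T x v \<noteq> 0" using x by (intro lsol_nonzero[OF v]) auto
      have low: "1 \<le> C * norm (lsol T x v)" using C(2)[rule_format, of T v x] x v T by simp
      have "dist (ssol T x v) (ssol T y v) \<le> 2 * norm (lsol T x v - lsol T y v) / norm (lsol T x v)"
        unfolding sphere_sol_def by (rule dist_sgn_le[OF nz])
      also have "lsol T x v - lsol T y v = lsol T (x - y) v"
        by (rule linear_diff[OF linear_lift_sol, symmetric])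
      also have "2 * norm (lsol T (x - y) v) / norm (lsol T x v) \<le> 2 * (C * norm (x - y)) * C"
      proof -
        have "2 * norm (lsol T (x - y) v) \<le> 2 * (C * norm (x - y))"
          using C(2)[rule_format, of T v "x - y"] v T by simp
        also have "\<dots> \<le> 2 * (C * norm (x - y)) * (C * norm (lsol T x v))"
          using mult_left_mono[OF low, of "2 * (C * norm (x - y))"] C(1) by simp
        finally show ?thesis using nz by (simp add: divide_le_eq mult_ac)
      qed
      finally show ?thesis by (simp add: dist_norm mult_ac)
    qed
    moreover have "2 * C * C * (\<epsilon> / (2 * C * C + 1)) < \<epsilon>" using C(1) e by (simp add: field_simps add_pos_pos)
    ultimately have "dist (ssol T x v) (ssol T y v) < \<epsilon>"
      if "x \<in> sph" "v \<in> controls" "dist x y < \<epsilon> / (2 * C * C + 1)" for x y v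
      using that mult_left_mono[of "dist x y" "\<epsilon> / (2 * C * C + 1)" "2 * C * C"] C(1)
      by (smt (verit) mult_nonneg_nonneg)
    moreover have "\<epsilon> / (2 * C * C + 1) > 0" using C(1) e by (intro divide_pos_pos add_nonneg_pos) auto
    ultimately show ?thesis by blast
  qed
qed

abbreviation "sstep \<equiv> chain_step sph dist controls ssol"
abbreviation reaches (infix \<open>\<leadsto>\<close> 50) where "x \<leadsto> y \<equiv> chain_reach sph dist controls ssol x y"

lemma step_uminus: "sstep \<epsilon> \<tau> x y \<Longrightarrow> sstep \<epsilon> \<tau> (- x) (- y)"
  unfolding chain_step_def by (auto simp: ssol_uminus dist_minus)

lemma reach_uminus:
  assumes "x \<leadsto> y"
  shows "- x \<leadsto> - y"
  unfolding chain_reach_def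
proof (intro allI impI)
  fix \<epsilon> \<tau> :: real assume "\<epsilon> > 0" "\<tau> > 0"
  then have "(sstep \<epsilon> \<tau>)\<^sup>+\<^sup>+ x y" using assms by (simp add: chain_reach_def)
  then show "(sstep \<epsilon> \<tau>)\<^sup>+\<^sup>+ (- x) (- y)"
    by (induction rule: tranclp_induct) (auto intro: step_uminus tranclp.r_into_trancl tranclp.trancl_into_trancl)
qed

section \<open>The induced system on projective space\<close>

abbreviation "pstep \<equiv> chain_step proj_space proj_dist controls (proj_sol A B)"
abbreviation "preach \<equiv> chain_reach proj_space proj_dist controls (proj_sol A B)"

lemma proj_sgn: "y \<noteq> 0 \<Longrightarrow> proj (sgn y) = proj y"
  unfolding proj_def sgn_div_norm by (simp add: span_image_scale[of "{y}" "\<lambda>_. inverse (norm y)", simplified])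

lemma proj_uminus: "proj (- y) = proj y"
  unfolding proj_def using span_image_scale[of "{y}" "\<lambda>_. - 1"] by simp

lemma proj_eq_iff:
  assumes "x \<in> sph" "y \<in> sph"
  shows "proj x = proj y \<longleftrightarrow> y = x \<or> y = - x"
proof
  have nz: "x \<noteq> 0" "y \<noteq> 0" using assms by auto
  assume "proj x = proj y"
  then have "{sgn x, - sgn x} = {sgn y, - sgn y}"
    using proj_Int_sphere[OF nz(1)] proj_Int_sphere[OF nz(2)] by simp
  then show "y = x \<or> y = - x" using assms by (auto simp: sgn_unit doubleton_eq_iff)
qed (auto simp: proj_uminus)

lemma proj_in_space:
  assumes "y \<in> sph"
  shows "proj y \<in> proj_space"
proof -
  have "y \<noteq> 0" using assms by auto
  then show ?thesis unfolding proj_space_def by blast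
qed

lemma proj_space_cases:
  assumes "p \<in> proj_space"
  obtains y where "y \<in> sph" "p = proj y"
proof -
  obtain y where y: "p = proj y" "y \<noteq> 0" using assms unfolding proj_space_def by blast
  show ?thesis
    by (rule that[of "sgn y"]) (use y proj_sgn[OF y(2)] sgn_in_sphere[OF y(2)] in auto)
qed

lemma proj_dist_ssol:
  assumes "x \<in> sph" "y \<in> sph" "u \<in> controls"
  shows "proj_dist (proj_sol A B t (proj x) u) (proj y) = min (dist (ssol t x u) y) (dist (ssol t x u) (- y))"
proof -
  have "x \<noteq> 0" "y \<noteq> 0" using assms by auto
  then show ?thesis
    using proj_dist_proj[OF lsol_nonzero[OF assms(3)], of x y t] assms(2)
    by (simp add: proj_sol_proj sphere_sol_def sgn_unit dist_norm)
qed

lemma pstep_proj: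
  assumes "sstep \<epsilon> \<tau> x y"
  shows "pstep \<epsilon> \<tau> (proj x) (proj y)"
proof -
  from assms obtain v T where *: "x \<in> sph" "y \<in> sph" "v \<in> controls" "T \<ge> \<tau>" "dist (ssol T x v) y < \<epsilon>"
    unfolding chain_step_def by blast
  then have "proj_dist (proj_sol A B T (proj x) v) (proj y) < \<epsilon>" by (simp add: proj_dist_ssol)
  then show ?thesis unfolding chain_step_def using * proj_in_space by blast
qed

text \<open>A line near the end of the segment contains a unit vector near it. The start is
  prescribed, but which of the two unit vectors is hit is not under control.\<close>

lemma pstep_lift:
  assumes "pstep \<epsilon> \<tau> (proj x) q" "x \<in> sph"
  shows "\<exists>y. q = proj y \<and> sstep \<epsilon> \<tau> x y"
proof -
  from assms obtain v T where *: "q \<in> proj_space" "v \<in> controls" "T \<ge> \<tau>" "proj_dist (proj_sol A B T (proj x) v) q < \<epsilon>"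
    unfolding chain_step_def by blast
  obtain y where y: "y \<in> sph" "q = proj y" using proj_space_cases[OF *(1)] .
  then have "dist (ssol T x v) y < \<epsilon> \<or> dist (ssol T x v) (- y) < \<epsilon>"
    using *(4) proj_dist_ssol[OF assms(2) y(1) *(2)] by auto
  then obtain z where "z = y \<or> z = - y" "dist (ssol T x v) z < \<epsilon>" by blast
  then show ?thesis
    using y * assms(2) by (intro exI[of _ z]) (auto simp: proj_uminus chain_step_def)
qed

lemma ptrancl_lift:
  assumes "(pstep \<epsilon> \<tau>)\<^sup>+\<^sup>+ (proj x) q" "x \<in> sph"
  shows "\<exists>y. q = proj y \<and> (sstep \<epsilon> \<tau>)\<^sup>+\<^sup>+ x y"
  using assms(1)
proof (induction rule: tranclp_induct)
  case (base q)
  then show ?case using pstep_lift[OF _ assms(2)] by blast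
next
  case (step p q)
  then obtain y where y: "p = proj y" "(chain_step sph dist controls ssol \<epsilon> \<tau>)\<^sup>+\<^sup>+ x y" by blast
  then have "y \<in> sph" by (auto elim: tranclpE_rtrancl simp: chain_step_def)
  then show ?case using pstep_lift[of \<epsilon> \<tau> y q] step(2) y by (meson tranclp.trancl_into_trancl)
qed

lemma preach_proj: "x \<leadsto> y \<Longrightarrow> preach (proj x) (proj y)"
  unfolding chain_reach_def
proof (intro allI impI)
  fix \<epsilon> \<tau> :: real assume *: "\<forall>\<epsilon>>0. \<forall>\<tau>>0. (sstep \<epsilon> \<tau>)\<^sup>+\<^sup>+ x y" "\<epsilon> > 0" "\<tau> > 0"
  then have "(sstep \<epsilon> \<tau>)\<^sup>+\<^sup>+ x y" by blast
  then show "(pstep \<epsilon> \<tau>)\<^sup>+\<^sup>+ (proj x) (proj y)"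
    by (induction rule: tranclp_induct) (auto intro: pstep_proj tranclp.r_into_trancl tranclp.trancl_into_trancl)
qed

text \<open>The sign of the lifted end point could vary with \<epsilon> and \<tau>. If each sign
  failed for some parameters, the smaller \<epsilon> and the larger \<tau> would contradict the
  lifted chain, which reaches one of the two points.\<close>

lemma preach_lift:
  assumes "preach (proj x) (proj y)" "x \<in> sph" "y \<in> sph"
  shows "x \<leadsto> y \<or> x \<leadsto> - y"
proof (rule ccontr)
  assume "\<not> ?thesis"
  then obtain \<epsilon>1 \<tau>1 \<epsilon>2 \<tau>2 where *: "\<epsilon>1 > 0" "\<tau>1 > 0" "\<epsilon>2 > 0" "\<tau>2 > 0"
    "\<not> (sstep \<epsilon>1 \<tau>1)\<^sup>+\<^sup>+ x y" "\<not> (sstep \<epsilon>2 \<tau>2)\<^sup>+\<^sup>+ x (- y)"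
    unfolding chain_reach_def by blast
  let ?e = "min \<epsilon>1 \<epsilon>2" and ?t = "max \<tau>1 \<tau>2"
  have "(pstep ?e ?t)\<^sup>+\<^sup>+ (proj x) (proj y)" using assms(1) * by (simp add: chain_reach_def)
  then obtain z where z: "proj y = proj z" "(sstep ?e ?t)\<^sup>+\<^sup>+ x z" using ptrancl_lift[OF _ assms(2)] by blast
  then have "z \<in> sph" by (auto elim: tranclpE_rtrancl simp: chain_step_def)
  with z(1) have "z = y \<or> z = - y" using proj_eq_iff[OF assms(3)] by blast
  moreover have "(sstep \<epsilon>1 \<tau>1)\<^sup>+\<^sup>+ x z"
    by (rule chain_trancl_mono[OF z(2)]) auto
  moreover have "(sstep \<epsilon>2 \<tau>2)\<^sup>+\<^sup>+ x z"
    by (rule chain_trancl_mono[OF z(2)]) auto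
  ultimately show False using * by blast
qed

end

section \<open>Separation by growth rates\<close>

lemma exp_dominated:
  fixes p q C :: real
  assumes "p + q < 0" "C \<ge> 0"
  shows "\<exists>\<tau>\<ge>0. \<forall>t\<ge>\<tau>. C * (exp (p * t) * exp (q * t)) \<le> 1"
proof -
  have "((\<lambda>t. C * exp ((p + q) * t)) \<longlongrightarrow> 0) at_top" using assms(1) by real_asymp
  then have "eventually (\<lambda>t. C * exp ((p + q) * t) < 1) at_top" by (rule order_tendstoD) simp
  then obtain T where T: "\<And>t. t \<ge> T \<Longrightarrow> C * exp ((p + q) * t) < 1"
    unfolding eventually_at_top_linorder by blast
  have "C * (exp (p * t) * exp (q * t)) \<le> 1" if "t \<ge> max T 0" for t
    using T[of t] that by (simp add: distrib_right exp_add)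
  then show ?thesis by (intro exI[of _ "max T 0"]) auto
qed

text \<open>\<open>a\<close> grows at least at rate -p and \<open>b\<close> at most at rate q, with
  q < -p. Over long times b/a shrinks below any prescribed factor, so the level \<theta> of a/(a+b)
  is pushed to a higher level and \<open>chain_separation\<close> applies. Homogeneity lets the
  quotient ignore the normalization on the sphere.\<close>

lemma ratio_separation:
  fixes M :: "'a::real_normed_vector set" and a b :: "'a \<Rightarrow> real"
  assumes M: "compact M" and cont: "continuous_on M a" "continuous_on M b"
    and nonneg: "\<And>x. a x \<ge> 0" "\<And>x. b x \<ge> 0" and pos: "\<And>x. x \<in> M \<Longrightarrow> a x + b x > 0"
    and hom: "\<And>c x. c > 0 \<Longrightarrow> a (c *\<^sub>R x) = c * a x" "\<And>c x. c > 0 \<Longrightarrow> b (c *\<^sub>R x) = c * b x"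
    and sol: "\<And>T x v. x \<in> M \<Longrightarrow> v \<in> V \<Longrightarrow> \<Phi> T x v = sgn (\<Lambda> T x v) \<and> \<Lambda> T x v \<noteq> 0 \<and> \<Phi> T x v \<in> M"
    and growth: "\<And>T x v. T \<ge> 0 \<Longrightarrow> x \<in> M \<Longrightarrow> v \<in> V \<Longrightarrow> a x \<le> C1 * exp (p * T) * a (\<Lambda> T x v)"
      "\<And>T x v. T \<ge> 0 \<Longrightarrow> x \<in> M \<Longrightarrow> v \<in> V \<Longrightarrow> b (\<Lambda> T x v) \<le> C2 * exp (q * T) * b x"
    and C: "C1 > 0" "C2 > 0" and pq: "p + q < 0"
    and xy: "chain_reach M dist V \<Phi> x y" and \<theta>: "0 < \<theta>" "\<theta> < 1" and x: "\<theta> * (a x + b x) \<le> a x"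
  shows "\<theta> * (a y + b y) < a y"
proof -
  define h where "h z = a z / (a z + b z)" for z
  \<comment> \<open>A level \<theta> means b/a \<le> (1 - \<theta>)/\<theta>. If b/a drops to a
    quarter of this, the level becomes 4\<theta>/(1 + 3\<theta>); the time \<tau> below is chosen
    for this factor 4.\<close>
  define \<theta>' where "\<theta>' = 4 * \<theta> / (1 + 3 * \<theta>)"
  have \<theta>': "\<theta> < \<theta>'" using \<theta> by (simp add: \<theta>'_def field_simps)
  obtain \<tau> where \<tau>: "\<tau> \<ge> 0" "\<And>t. t \<ge> \<tau> \<Longrightarrow> (4 * C1 * C2) * (exp (p * t) * exp (q * t)) \<le> 1"
    using exp_dominated[OF pq, of "4 * C1 * C2"] C by auto
  have xM: "x \<in> M" "y \<in> M" using chain_reach_carrier[OF xy] by auto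
  have hM: "\<theta> \<le> h z \<longleftrightarrow> \<theta> * (a z + b z) \<le> a z" "\<theta> < h z \<longleftrightarrow> \<theta> * (a z + b z) < a z" if "z \<in> M" for z
    using pos[OF that] by (simp_all add: h_def pos_le_divide_eq pos_less_divide_eq)
  have "continuous_on M h" unfolding h_def
    by (intro continuous_on_divide continuous_on_add cont) (use pos in fastforce)
  then have "uniformly_continuous_on M h" using M by (rule compact_uniformly_continuous)
  then have unif: "\<exists>\<delta>>0. \<forall>a\<in>M. \<forall>b\<in>M. dist a b < \<delta> \<longrightarrow> \<bar>h a - h b\<bar> < \<eta>" if "\<eta> > 0" for \<eta>
    using that unfolding uniformly_continuous_on_def dist_real_def by (metis dist_commute)
  have raise: "h (\<Phi> T z v) \<ge> \<theta>'" if T: "T \<ge> \<tau>" and z: "z \<in> M" and v: "v \<in> V" and hz: "h z \<ge> \<theta>" for T z v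
  proof -
    let ?w = "\<Lambda> T z v"
    have T0: "T \<ge> 0" using T \<tau>(1) by simp
    have w: "\<Phi> T z v = (1 / norm ?w) *\<^sub>R ?w" "?w \<noteq> 0" "\<Phi> T z v \<in> M"
      using sol[OF z v, of T] by (auto simp: sgn_div_norm inverse_eq_divide)
    have hw: "h (\<Phi> T z v) = a ?w / (a ?w + b ?w)"
      using hom[of "1 / norm ?w" ?w] w(2) by (simp add: h_def w(1) add_divide_distrib[symmetric])
    have sum: "a ?w + b ?w > 0"
      using pos[OF w(3)] hom[of "1 / norm ?w" ?w] w(2)
      by (simp add: w(1) add_divide_distrib[symmetric] zero_less_divide_iff)
    have az: "\<theta> * b z \<le> (1 - \<theta>) * a z" using hz hM(1)[OF z] by (simp add: algebra_simps)
    have "a z > 0"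
    proof (rule ccontr)
      assume "\<not> a z > 0"
      then have "a z = 0" using nonneg(1)[of z] by simp
      with az \<theta> have "b z \<le> 0" by (simp add: mult_le_0_iff)
      with \<open>a z = 0\<close> pos[OF z] show False by simp
    qed
    have "4 * (a z * b ?w) \<le> 4 * ((C1 * exp (p * T) * a ?w) * (C2 * exp (q * T) * b z))"
      using growth(1)[OF T0 z v] growth(2)[OF T0 z v] nonneg C
      by (intro mult_left_mono mult_mono) auto
    also have "\<dots> = ((4 * C1 * C2) * (exp (p * T) * exp (q * T))) * (a ?w * b z)" by (simp add: mult_ac)
    also have "\<dots> \<le> 1 * (a ?w * b z)" using \<tau>(2)[OF T] nonneg by (intro mult_right_mono) auto
    finally have key: "4 * (a z * b ?w) \<le> a ?w * b z" by simp
    have "a z * (4 * \<theta> * b ?w) \<le> \<theta> * (a ?w * b z)" using mult_left_mono[OF key, of \<theta>] \<theta> by (simp add: mult_ac)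
    also have "\<dots> \<le> a z * ((1 - \<theta>) * a ?w)" using mult_left_mono[OF az nonneg(1)[of ?w]] by (simp add: mult_ac)
    finally have "4 * \<theta> * b ?w \<le> (1 - \<theta>) * a ?w" using \<open>a z > 0\<close> by simp
    then have "4 * \<theta> * (a ?w + b ?w) \<le> a ?w * (1 + 3 * \<theta>)" by (simp add: algebra_simps)
    then show ?thesis unfolding hw \<theta>'_def using sum \<theta> by (simp add: field_simps)
  qed
  have inv: "\<Phi> T z v \<in> M" if "z \<in> M" "v \<in> V" for T z v using sol[OF that] by blast
  have "h y > \<theta>"
    by (rule chain_separation[where h = h and \<theta>' = \<theta>', OF unif _ \<theta>' raise xy])
       (use inv hM(1)[OF xM(1)] x in simp_all)
  then show ?thesis using hM(2)[OF xM(2)] by simp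
qed

text \<open>Up to the factor \<open>\<bar>r\<bar>\<close> this is the distance of \<open>p / r\<close> to \<open>K\<close>, but it makes sense for \<open>r = 0\<close>.\<close>

definition hdist :: "'a::real_normed_vector set \<Rightarrow> 'a \<Rightarrow> real \<Rightarrow> real" where
  "hdist K p r = (INF k\<in>K. norm (p - r *\<^sub>R k))"

lemma hdist_nonneg: "K \<noteq> {} \<Longrightarrow> hdist K p r \<ge> 0"
  unfolding hdist_def by (intro cINF_greatest) auto

lemma hdist_le: "k \<in> K \<Longrightarrow> hdist K p r \<le> norm (p - r *\<^sub>R k)"
  unfolding hdist_def by (intro cINF_lower bdd_belowI2[of _ 0]) auto

text \<open>An infimum is compared by matching every point \<open>k\<close> with some point
  \<open>l\<close> of the same set. The slack \<beta> serves continuity; the growth estimates take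
  \<beta> = 0.\<close>

lemma hdist_compare:
  assumes "K \<noteq> {}" "\<alpha> > 0" "\<And>k. k \<in> K \<Longrightarrow> \<exists>l\<in>K. norm (p - r *\<^sub>R l) \<le> \<alpha> * norm (p' - r' *\<^sub>R k) + \<beta>"
  shows "hdist K p r \<le> \<alpha> * hdist K p' r' + \<beta>"
proof -
  have "(hdist K p r - \<beta>) / \<alpha> \<le> hdist K p' r'"
    unfolding hdist_def[of K p' r']
  proof (rule cINF_greatest[OF assms(1)])
    fix k assume "k \<in> K"
    then obtain l where "l \<in> K" "norm (p - r *\<^sub>R l) \<le> \<alpha> * norm (p' - r' *\<^sub>R k) + \<beta>" using assms(3) by blast
    then have "hdist K p r \<le> \<alpha> * norm (p' - r' *\<^sub>R k) + \<beta>" using hdist_le[of l K p r] by simp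
    then show "(hdist K p r - \<beta>) / \<alpha> \<le> norm (p' - r' *\<^sub>R k)" using assms(2) by (simp add: field_simps)
  qed
  then show ?thesis using assms(2) by (simp add: field_simps)
qed

lemma hdist_scale:
  assumes "K \<noteq> {}" "c \<noteq> 0"
  shows "hdist K (c *\<^sub>R p) (c * r) = \<bar>c\<bar> * hdist K p r"
proof -
  have le: "hdist K (c *\<^sub>R p) (c * r) \<le> \<bar>c\<bar> * hdist K p r + 0" if "c \<noteq> 0" for c p r
  proof (rule hdist_compare[OF assms(1)])
    fix k assume "k \<in> K"
    have "c *\<^sub>R p - (c * r) *\<^sub>R k = c *\<^sub>R (p - r *\<^sub>R k)" by (simp add: scaleR_diff_right)
    then show "\<exists>l\<in>K. norm (c *\<^sub>R p - (c * r) *\<^sub>R l) \<le> \<bar>c\<bar> * norm (p - r *\<^sub>R k) + 0"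
      using \<open>k \<in> K\<close> by (intro bexI[of _ k]) auto
  qed (use that in auto)
  have "hdist K ((1 / c) *\<^sub>R (c *\<^sub>R p)) (1 / c * (c * r)) \<le> \<bar>1 / c\<bar> * hdist K (c *\<^sub>R p) (c * r) + 0"
    using assms(2) by (intro le) auto
  then have "\<bar>c\<bar> * hdist K p r \<le> hdist K (c *\<^sub>R p) (c * r)" using assms(2) by (simp add: field_simps)
  with le[OF assms(2), of p r] show ?thesis by simp
qed

lemma hdist_0: "K \<noteq> {} \<Longrightarrow> hdist K p 0 = norm p"
  by (simp add: hdist_def)

text \<open>The bound on \<open>K\<close> makes the distance Lipschitz in the height as
  well.\<close>

lemma continuous_hdist:
  assumes "K \<noteq> {}" "\<And>k. k \<in> K \<Longrightarrow> norm k \<le> D" and f: "bounded_linear f" "bounded_linear g"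
  shows "continuous_on S (\<lambda>y. hdist K (f y) (g y))"
proof -
  obtain k0 where "k0 \<in> K" using assms(1) by blast
  then have D: "D \<ge> 0" using order_trans[OF norm_ge_zero assms(2)] by simp
  have "hdist K p r \<le> 1 * hdist K p' r' + (norm (p - p') + \<bar>r - r'\<bar> * D)" for p r p' r'
  proof (rule hdist_compare[OF assms(1)])
    fix k assume k: "k \<in> K"
    have "p - r *\<^sub>R k = (p' - r' *\<^sub>R k) + ((p - p') + (r' - r) *\<^sub>R k)" by (simp add: algebra_simps)
    also have "norm \<dots> \<le> norm (p' - r' *\<^sub>R k) + (norm (p - p') + norm ((r' - r) *\<^sub>R k))"
      by (rule order_trans[OF norm_triangle_ineq add_left_mono[OF norm_triangle_ineq]])
    also have "\<dots> \<le> 1 * norm (p' - r' *\<^sub>R k) + (norm (p - p') + \<bar>r - r'\<bar> * D)"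
      using assms(2)[OF k] by (simp add: abs_minus_commute mult_left_mono)
    finally show "\<exists>l\<in>K. norm (p - r *\<^sub>R l) \<le> 1 * norm (p' - r' *\<^sub>R k) + (norm (p - p') + \<bar>r - r'\<bar> * D)"
      using k by blast
  qed simp
  note le = this
  have lip: "\<bar>hdist K p r - hdist K p' r'\<bar> \<le> norm (p - p') + \<bar>r - r'\<bar> * D" for p r p' r'
    using le[of p r p' r'] le[of p' r' p r] unfolding norm_minus_commute[of p' p] abs_minus_commute[of r' r]
    by linarith
  show ?thesis
    unfolding continuous_on_def
  proof
    fix x
    let ?e = "\<lambda>y. norm (f y - f x) + \<bar>g y - g x\<bar> * D"
    have f': "(f \<longlongrightarrow> f x) (at x within S)" "(g \<longlongrightarrow> g x) (at x within S)"
      using bounded_linear.tendsto[OF f(1) tendsto_ident_at] bounded_linear.tendsto[OF f(2) tendsto_ident_at] .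
    have "(?e \<longlongrightarrow> norm (f x - f x) + \<bar>g x - g x\<bar> * D) (at x within S)"
      by (rule tendsto_add[OF tendsto_norm[OF tendsto_diff[OF f'(1) tendsto_const]]
            tendsto_mult[OF tendsto_rabs[OF tendsto_diff[OF f'(2) tendsto_const]] tendsto_const]])
    then have z: "(?e \<longlongrightarrow> 0) (at x within S)" by simp
    have "((\<lambda>y. hdist K (f y) (g y) - hdist K (f x) (g x)) \<longlongrightarrow> 0) (at x within S)"
      by (rule Lim_null_comparison[OF _ z], rule always_eventually) (simp only: real_norm_def lip simp_thms)
    then show "((\<lambda>y. hdist K (f y) (g y)) \<longlongrightarrow> hdist K (f x) (g x)) (at x within S)"
      by (simp only: LIM_zero_iff)
  qed
qed

text \<open>A jump that multiplies the height by \<kappa>^2 costs at most 2(\<kappa>^2 - 1) on the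
  sphere. The square leaves one factor \<kappa> per jump to outgrow the state.\<close>

lemma scaling_factor:
  fixes \<epsilon> :: real
  assumes "\<epsilon> > 0"
  obtains \<kappa> where "\<kappa> > 1" "2 * (\<kappa>^2 - 1) < \<epsilon>"
proof -
  define \<eta> where "\<eta> = min 1 (\<epsilon> / 16)"
  have \<eta>: "\<eta> > 0" "\<eta> \<le> 1" "\<eta> \<le> \<epsilon> / 16" using assms by (auto simp: \<eta>_def)
  have "\<eta> * \<eta> \<le> 1 * \<eta>" using \<eta> by (intro mult_right_mono) auto
  moreover have "2 * ((1 + \<eta>)^2 - 1) = 4 * \<eta> + 2 * (\<eta> * \<eta>)" by algebra
  ultimately have "2 * ((1 + \<eta>)^2 - 1) < \<epsilon>" using \<eta> by linarith
  then show ?thesis using \<eta>(1) by (intro that[of "1 + \<eta>"]) simp_all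
qed

lemma scaling_ratio:
  fixes \<kappa> :: real
  assumes "\<kappa> > 1" "2 * (\<kappa>^2 - 1) < \<epsilon>"
  shows "2 * \<bar>\<kappa> ^ (2 * i) - \<kappa> ^ (2 * Suc i)\<bar> / \<kappa> ^ (2 * i) < \<epsilon>"
    "2 * \<bar>\<kappa> ^ (2 * Suc i) - \<kappa> ^ (2 * i)\<bar> / \<kappa> ^ (2 * Suc i) < \<epsilon>"
proof -
  have p: "\<kappa> ^ (2 * i) > 0" "\<kappa> ^ (2 * Suc i) > 0" using assms(1) by auto
  have k2: "\<kappa>^2 \<ge> 1" using assms(1) by (simp add: one_le_power)
  have "\<kappa> ^ (2 * i) - \<kappa> ^ (2 * Suc i) = - (\<kappa> ^ (2 * i) * (\<kappa>^2 - 1))"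
    by (simp add: power2_eq_square algebra_simps)
  moreover have "\<kappa> ^ (2 * i) * (\<kappa>^2 - 1) \<ge> 0" using p k2 by simp
  ultimately have e: "\<bar>\<kappa> ^ (2 * i) - \<kappa> ^ (2 * Suc i)\<bar> = \<kappa> ^ (2 * i) * (\<kappa>^2 - 1)"
    by linarith
  show 1: "2 * \<bar>\<kappa> ^ (2 * i) - \<kappa> ^ (2 * Suc i)\<bar> / \<kappa> ^ (2 * i) < \<epsilon>"
  proof -
    have "2 * (\<kappa> ^ (2 * i) * (\<kappa>^2 - 1)) / \<kappa> ^ (2 * i) = 2 * (\<kappa>^2 - 1)" using p assms(1) by simp
    then show ?thesis unfolding e using assms(2) by linarith
  qed
  have "2 * \<bar>\<kappa> ^ (2 * Suc i) - \<kappa> ^ (2 * i)\<bar> / \<kappa> ^ (2 * Suc i) \<le> 2 * \<bar>\<kappa> ^ (2 * i) - \<kappa> ^ (2 * Suc i)\<bar> / \<kappa> ^ (2 * i)"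
    unfolding abs_minus_commute[of "\<kappa> ^ (2 * Suc i)"]
    using p assms(1) by (intro divide_left_mono power_increasing mult_pos_pos) auto
  with 1 show "2 * \<bar>\<kappa> ^ (2 * Suc i) - \<kappa> ^ (2 * i)\<bar> / \<kappa> ^ (2 * Suc i) < \<epsilon>" by linarith
qed

text \<open>The rate ln \<kappa> / \<tau> lets F gain only a factor \<kappa> in each time \<tau>,
  against \<kappa>^2 for the height, so the quotient decays like \<kappa>^{-i}.\<close>

lemma subexponential_power:
  fixes F :: "real \<Rightarrow> real"
  assumes "\<forall>\<rho>>0. \<exists>C\<ge>0. \<forall>t\<ge>0. F t \<le> C * exp (\<rho> * t)" "\<kappa> > 1" "\<tau> > 0" "\<epsilon> > 0"
  shows "\<exists>i. 2 * F (real (Suc i) * \<tau>) / \<kappa> ^ (2 * i) < \<epsilon>"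
proof -
  have "ln \<kappa> / \<tau> > 0" using assms by simp
  then obtain C where C: "C \<ge> 0" "\<And>t. t \<ge> 0 \<Longrightarrow> F t \<le> C * exp (ln \<kappa> / \<tau> * t)" using assms(1) by blast
  have bnd: "2 * F (real (Suc i) * \<tau>) / \<kappa> ^ (2 * i) \<le> 2 * C * \<kappa> * (1 / \<kappa>) ^ i" for i
  proof -
    have "exp (ln \<kappa> / \<tau> * (real (Suc i) * \<tau>)) = \<kappa> ^ Suc i"
    proof -
      have "ln \<kappa> / \<tau> * (real (Suc i) * \<tau>) = real (Suc i) * ln \<kappa>" using assms by (simp del: of_nat_Suc)
      then show ?thesis using assms(2) exp_of_nat_mult[of "Suc i" "ln \<kappa>"] by (simp del: of_nat_Suc power_Suc)
    qed
    then have "F (real (Suc i) * \<tau>) \<le> C * \<kappa> ^ Suc i" using C(2)[of "real (Suc i) * \<tau>"] assms by simp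
    then have "2 * F (real (Suc i) * \<tau>) / \<kappa> ^ (2 * i) \<le> 2 * (C * \<kappa> ^ Suc i) / \<kappa> ^ (2 * i)"
      using assms by (intro divide_right_mono) auto
    also have "\<dots> = 2 * C * \<kappa> * (1 / \<kappa>) ^ i"
    proof -
      have w: "2 * (C * (\<kappa> * w)) / (w * w) = 2 * C * \<kappa> * (1 / w)" if "w \<noteq> 0" for w
        using that by (simp add: field_simps)
      have "\<kappa> ^ i \<noteq> 0" using assms(2) by simp
      from w[OF this] show ?thesis by (simp only: mult_2 power_add power_one_over power_Suc)
    qed
    finally show ?thesis .
  qed
  have "(\<lambda>i. 2 * C * \<kappa> * (1 / \<kappa>) ^ i) \<longlonglongrightarrow> 2 * C * \<kappa> * 0"
    using assms by (intro tendsto_intros LIMSEQ_power_zero) auto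
  then have "eventually (\<lambda>i. 2 * C * \<kappa> * (1 / \<kappa>) ^ i < \<epsilon>) sequentially"
    using assms by (intro order_tendstoD) auto
  then obtain i where "2 * C * \<kappa> * (1 / \<kappa>) ^ i < \<epsilon>" by (auto simp: eventually_sequentially)
  then show ?thesis using bnd[of i] by (intro exI[of _ i]) linarith
qed

lemma hdist_zero_near:
  assumes "hdist K p r = 0" "K \<noteq> {}" "\<delta> > 0"
  obtains k where "k \<in> K" "norm (p - r *\<^sub>R k) < \<delta>"
proof (rule ccontr)
  assume "\<not> thesis"
  then have "\<forall>k\<in>K. \<delta> \<le> norm (p - r *\<^sub>R k)" using that by force
  then have "\<delta> \<le> hdist K p r" unfolding hdist_def using assms(2) by (intro cINF_greatest) auto
  with assms show False by simp
qed

section \<open>Unstable and stable parts\<close>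

lemma projection_growth:
  fixes P :: "real^'n \<Rightarrow> real^'n"
  assumes P: "linear P" "\<And>x. P x \<in> lyapunov_sum A {c<..}" "\<And>x. x - P x \<in> lyapunov_sum A {..c}"
    and r: "c < r1" "r1 < r2" "\<forall>l\<in>lyapunov_exponents A. l \<le> c \<or> l > r2"
  shows "\<exists>C>0. \<forall>t\<ge>0. \<forall>x. norm (lflow A (- t) (P x)) \<le> C * exp (- r2 * t) * norm x"
    "\<exists>C>0. \<forall>t\<ge>0. \<forall>x. norm (lflow A t (x - P x)) \<le> C * exp (r1 * t) * norm x"
proof -
  have "\<exists>C\<ge>0. \<forall>t\<ge>0. norm (lflow A (- 1 * t) (P x)) \<le> C * exp (- r2 * t)" for x
    using lyapunov_sum_growth_backward[OF P(2)[of x], of r2] r(3) by force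
  from orbit_bound_uniform[OF P(1) this]
  show "\<exists>C>0. \<forall>t\<ge>0. \<forall>x. norm (lflow A (- t) (P x)) \<le> C * exp (- r2 * t) * norm x" by simp
  have "\<exists>C\<ge>0. \<forall>t\<ge>0. norm (lflow A (1 * t) (x - P x)) \<le> C * exp (r1 * t)" for x
    using lyapunov_sum_growth_forward[OF P(3)[of x], of r1] r(1) by force
  from orbit_bound_uniform[OF linear_compose_sub[OF linear_ident P(1)] this]
  show "\<exists>C>0. \<forall>t\<ge>0. \<forall>x. norm (lflow A t (x - P x)) \<le> C * exp (r1 * t) * norm x" by simp
qed

lemma weaken_growth:
  fixes F :: "real \<Rightarrow> 'a \<Rightarrow> real" and g :: "'a \<Rightarrow> 'b::real_normed_vector"
  assumes "\<forall>t\<ge>0. \<forall>x. F t x \<le> C * exp (\<rho> * t) * norm (g x)" "C \<le> D"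
  shows "\<forall>t\<ge>0. \<forall>x. F t x \<le> D * exp (\<rho> * t) * norm (g x)"
proof (intro allI impI)
  fix t :: real and x assume "t \<ge> 0"
  then have "F t x \<le> C * exp (\<rho> * t) * norm (g x)" using assms(1) by blast
  also have "\<dots> \<le> D * exp (\<rho> * t) * norm (g x)" using assms(2) by (intro mult_right_mono) auto
  finally show "F t x \<le> D * exp (\<rho> * t) * norm (g x)" .
qed

text \<open>The gap lies just above 0, so the exponent 0 belongs to the complement, whose growth is
  still slower than that of the range of \<open>P\<close>.\<close>

lemma unstable_projection:
  obtains P :: "real^'n \<Rightarrow> real^'n" and C \<mu> \<nu> where
    "linear P" "\<forall>x. P (P x) = P x" "\<forall>t x. P (lflow A t x) = lflow A t (P x)"
    "\<forall>x. x - P x \<in> lyapunov_sum A {..0}" "0 < \<nu>" "\<nu> < \<mu>" "C > 0"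
    "\<forall>t\<ge>0. \<forall>x. norm (lflow A (- t) (P x)) \<le> C * exp (- \<mu> * t) * norm x"
    "\<forall>t\<ge>0. \<forall>x. norm (lflow A t (x - P x)) \<le> C * exp (\<nu> * t) * norm x"
proof -
  obtain P :: "real^'n \<Rightarrow> real^'n" where P: "linear P" "\<forall>x. P (P x) = P x"
    "\<forall>t x. P (lflow A t x) = lflow A t (P x)"
    "\<forall>x. P x \<in> lyapunov_sum A {0<..}" "\<forall>x. x - P x \<in> lyapunov_sum A {..0}"
    by (rule spectral_projection[of A 0])
  obtain r1 r2 where r: "0 < r1" "r1 < r2" "\<forall>l\<in>lyapunov_exponents A. l \<le> 0 \<or> l > r2"
    by (rule lyapunov_gap[of 0 A])
  obtain C where C: "C > 0" "\<forall>t\<ge>0. \<forall>x. norm (lflow A (- t) (P x)) \<le> C * exp (- r2 * t) * norm x"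
    using projection_growth(1)[OF P(1) spec[OF P(4)] spec[OF P(5)] r] by (elim exE conjE)
  obtain D where D: "D > 0" "\<forall>t\<ge>0. \<forall>x. norm (lflow A t (x - P x)) \<le> D * exp (r1 * t) * norm x"
    using projection_growth(2)[OF P(1) spec[OF P(4)] spec[OF P(5)] r] by (elim exE conjE)
  have "\<forall>t\<ge>0. \<forall>x. norm (lflow A (- t) (P x)) \<le> max C D * exp (- r2 * t) * norm x"
    by (rule weaken_growth[OF C(2)]) simp
  moreover have "\<forall>t\<ge>0. \<forall>x. norm (lflow A t (x - P x)) \<le> max C D * exp (r1 * t) * norm x"
    by (rule weaken_growth[OF D(2)]) simp
  moreover have "max C D > 0" using C(1) by simp
  ultimately show ?thesis using P r by (intro that[of P r1 r2 "max C D"])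
qed

lemma stable_projection:
  obtains N :: "real^'n \<Rightarrow> real^'n" and C \<mu> \<nu> where
    "linear N" "\<forall>x. N (N x) = N x" "\<forall>t x. N (lflow A t x) = lflow A t (N x)"
    "\<forall>x. x - N x \<in> lyapunov_sum A {0..}" "0 < \<nu>" "\<nu> < \<mu>" "C > 0"
    "\<forall>t\<ge>0. \<forall>x. norm (lflow A t (N x)) \<le> C * exp (- \<mu> * t) * norm x"
    "\<forall>t\<ge>0. \<forall>x. norm (lflow A (- t) (x - N x)) \<le> C * exp (\<nu> * t) * norm x"
proof -
  \<comment> \<open>The entry -1 is a default for the case without negative exponents;
    \<open>c\<close> is then still negative with no exponent between it and 0.\<close>
  let ?X = "insert (- 1) {l \<in> lyapunov_exponents A. l < 0}"
  define c where "c = Max ?X"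
  have fin: "finite ?X" using finite_subset[OF _ finite_lyapunov_exponents[of A], of "{l \<in> lyapunov_exponents A. l < 0}"] by auto
  have "c \<in> ?X" unfolding c_def by (rule Max_in[OF fin]) auto
  then have c: "c < 0" by auto
  have gap: "l \<le> c \<or> l \<ge> 0" if "l \<in> lyapunov_exponents A" for l
  proof (cases "l < 0")
    case True
    with that have "l \<in> ?X" by simp
    then show ?thesis unfolding c_def using Max_ge[OF fin] by blast
  qed simp
  obtain P :: "real^'n \<Rightarrow> real^'n" where P: "linear P" "\<forall>x. P (P x) = P x"
    "\<forall>t x. P (lflow A t x) = lflow A t (P x)"
    "\<forall>x. P x \<in> lyapunov_sum A {c<..}" "\<forall>x. x - P x \<in> lyapunov_sum A {..c}"
    by (rule spectral_projection[of A c])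
  let ?N = "\<lambda>x. x - P x"
  \<comment> \<open>The rates trisect the gap from \<open>c\<close> to 0 and become \<mu> = -2c/3
    and \<nu> = -c/3.\<close>
  have r: "c < 2 * c / 3" "2 * c / 3 < c / 3" "\<forall>l\<in>lyapunov_exponents A. l \<le> c \<or> l > c / 3"
    using c gap by force+
  obtain C where C: "C > 0" "\<forall>t\<ge>0. \<forall>x. norm (lflow A (- t) (P x)) \<le> C * exp (- (c / 3) * t) * norm x"
    using projection_growth(1)[OF P(1) spec[OF P(4)] spec[OF P(5)] r] by (elim exE conjE)
  obtain D where D: "D > 0" "\<forall>t\<ge>0. \<forall>x. norm (lflow A t (x - P x)) \<le> D * exp (2 * c / 3 * t) * norm x"
    using projection_growth(2)[OF P(1) spec[OF P(4)] spec[OF P(5)] r] by (elim exE conjE)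
  have "lyapunov_sum A {c<..} \<subseteq> lyapunov_sum A {0..}"
    by (rule lyapunov_sum_mono) (use gap in force)
  then have "\<forall>x. x - ?N x \<in> lyapunov_sum A {0..}" using P(4) by auto
  moreover have "\<forall>t\<ge>0. \<forall>x. norm (lflow A t (?N x)) \<le> max C D * exp (- (- 2 * c / 3) * t) * norm x"
    by (rule weaken_growth[where C = D]) (use D(2) in simp_all)
  moreover have "\<forall>t\<ge>0. \<forall>x. norm (lflow A (- t) (x - ?N x)) \<le> max C D * exp (- (c / 3) * t) * norm x"
    by (rule weaken_growth[where C = C]) (use C(2) in simp_all)
  moreover have "linear ?N" by (intro linear_compose_sub linear_ident P(1))
  moreover have "\<forall>x. ?N (?N x) = ?N x" using P(2) by (simp add: linear_diff[OF P(1)])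
  moreover have "\<forall>t x. ?N (lflow A t x) = lflow A t (?N x)" using P(3) by (simp add: lflow_simps)
  moreover have "0 < - (c / 3)" "- (c / 3) < - 2 * c / 3" "max C D > 0" using c C(1) by auto
  ultimately show ?thesis
    by (intro that[of ?N "- (c / 3)" "- 2 * c / 3" "max C D"])
qed

lemma has_integral_exp:
  fixes \<rho> :: real
  assumes "\<rho> \<noteq> 0" "t \<ge> 0"
  shows "((\<lambda>s. exp (\<rho> * s)) has_integral (exp (\<rho> * t) - 1) / \<rho>) {0..t}"
    "((\<lambda>s. exp (\<rho> * (t - s))) has_integral (exp (\<rho> * t) - 1) / \<rho>) {0..t}"
proof -
  have "((\<lambda>s. exp (\<rho> * s)) has_integral (exp (\<rho> * t) / \<rho> - exp (\<rho> * 0) / \<rho>)) {0..t}"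
    using assms by (intro fundamental_theorem_of_calculus)
      (auto intro!: derivative_eq_intros simp flip: has_real_derivative_iff_has_vector_derivative)
  then show "((\<lambda>s. exp (\<rho> * s)) has_integral (exp (\<rho> * t) - 1) / \<rho>) {0..t}"
    by (simp add: diff_divide_distrib)
  have "((\<lambda>s. exp (\<rho> * (t - s))) has_integral (- exp (\<rho> * (t - t)) / \<rho> - (- exp (\<rho> * (t - 0)) / \<rho>))) {0..t}"
    using assms by (intro fundamental_theorem_of_calculus)
      (auto intro!: derivative_eq_intros simp flip: has_real_derivative_iff_has_vector_derivative)
  then show "((\<lambda>s. exp (\<rho> * (t - s))) has_integral (exp (\<rho> * t) - 1) / \<rho>) {0..t}"
    by (simp add: diff_divide_distrib)
qed

context control_range
begin

text \<open>For \<rho> = -\<mu> < 0 the bound stays below C M / \<mu> at all times, which bounds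
  \<open>unstable_targets\<close>; for \<rho> = \<nu> > 0 it controls the complement of the stable
  part backward in time.\<close>

lemma projected_drive_bound:
  fixes Q :: "real^'n \<Rightarrow> real^'n" and B :: "real^'m^'n"
  assumes Q: "linear Q" and u: "u \<in> controls" and M: "\<forall>y\<in>U. norm (B *v y) \<le> M" and C: "C > 0"
    and \<rho>: "\<rho> \<noteq> 0" and t: "t \<ge> 0"
    and growth: "\<forall>t\<ge>0. \<forall>x. norm (lflow A (- t) (Q x)) \<le> C * exp (\<rho> * t) * norm x"
    and comm: "\<forall>t x. Q (lflow A t x) = lflow A t (Q x)"
  shows "norm (Q (drive A B u t)) \<le> C * M * ((exp (\<rho> * t) - 1) / \<rho>)"
proof -
  have bl: "bounded_linear Q" using Q linear_conv_bounded_linear by blast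
  have "Q (drive A B u t) = integral {0..t} (Q \<circ> (\<lambda>s. lflow A (- s) (B *v u s)))"
    using integral_linear[OF drive_integrable[OF u] bl] t by (simp add: drive_def oint_def)
  also have "norm \<dots> \<le> integral {0..t} (\<lambda>s. C * M * exp (\<rho> * s))"
  proof (rule control_integral_bound[OF u integrable_linear[OF drive_integrable[OF u] bl]])
    show "(\<lambda>s. C * M * exp (\<rho> * s)) integrable_on {0..t}"
      using has_integral_exp(1)[OF \<rho> t] by (intro integrable_on_mult_right) auto
    fix s assume s: "s \<in> {0..t}" "u s \<in> U"
    have "norm (lflow A (- s) (Q (B *v u s))) \<le> C * exp (\<rho> * s) * norm (B *v u s)" using growth s by simp
    also have "\<dots> \<le> C * exp (\<rho> * s) * M" using M s C by (intro mult_left_mono) auto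
    finally show "norm ((Q \<circ> (\<lambda>s. lflow A (- s) (B *v u s))) s) \<le> C * M * exp (\<rho> * s)"
      using comm by (simp add: mult_ac)
  qed
  also have "\<dots> = C * M * ((exp (\<rho> * t) - 1) / \<rho>)"
    using has_integral_mult_right[OF has_integral_exp(1)[OF \<rho> t], of "C * M"] by (rule integral_unique)
  finally show ?thesis .
qed

text \<open>The counterpart at the end time: it bounds \<open>stable_targets\<close> when \<rho> is
  negative and the complement of the unstable part forward in time when \<rho> is positive.\<close>

lemma projected_response_bound:
  fixes Q :: "real^'n \<Rightarrow> real^'n" and B :: "real^'m^'n"
  assumes Q: "linear Q" and u: "u \<in> controls" and M: "\<forall>y\<in>U. norm (B *v y) \<le> M" and C: "C > 0"
    and \<rho>: "\<rho> \<noteq> 0" and t: "t \<ge> 0"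
    and growth: "\<forall>t\<ge>0. \<forall>x. norm (lflow A t (Q x)) \<le> C * exp (\<rho> * t) * norm x"
    and comm: "\<forall>t x. Q (lflow A t x) = lflow A t (Q x)"
  shows "norm (Q (lflow A t (drive A B u t))) \<le> C * M * ((exp (\<rho> * t) - 1) / \<rho>)"
proof -
  let ?L = "\<lambda>x. Q (lflow A t x)"
  have bl: "bounded_linear ?L"
    using linear_compose[OF linear_lflow Q, of A t] linear_conv_bounded_linear by (auto simp: o_def)
  have "?L (drive A B u t) = integral {0..t} (?L \<circ> (\<lambda>s. lflow A (- s) (B *v u s)))"
    using integral_linear[OF drive_integrable[OF u] bl] t by (simp add: drive_def oint_def)
  also have "norm \<dots> \<le> integral {0..t} (\<lambda>s. C * M * exp (\<rho> * (t - s)))"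
  proof (rule control_integral_bound[OF u integrable_linear[OF drive_integrable[OF u] bl]])
    show "(\<lambda>s. C * M * exp (\<rho> * (t - s))) integrable_on {0..t}"
      using has_integral_exp(2)[OF \<rho> t] by (intro integrable_on_mult_right) auto
    fix s assume s: "s \<in> {0..t}" "u s \<in> U"
    have "norm (lflow A (t - s) (Q (B *v u s))) \<le> C * exp (\<rho> * (t - s)) * norm (B *v u s)"
      using growth s by simp
    also have "\<dots> \<le> C * exp (\<rho> * (t - s)) * M" using M s C by (intro mult_left_mono) auto
    finally show "norm ((?L \<circ> (\<lambda>s. lflow A (- s) (B *v u s))) s) \<le> C * M * exp (\<rho> * (t - s))"
      using comm by (simp add: mult_ac lflow_add[symmetric])
  qed
  also have "\<dots> = C * M * ((exp (\<rho> * t) - 1) / \<rho>)"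
    using has_integral_mult_right[OF has_integral_exp(2)[OF \<rho> t], of "C * M"] by (rule integral_unique)
  finally show ?thesis .
qed

lemma drive_concat:
  assumes "u \<in> controls" "w \<in> controls" "t \<ge> 0" "T \<ge> 0"
  shows "drive A B (concat_control t u w) (t + T) = drive A B u t + lflow A (- t) (drive A B w T)"
proof -
  have "drive A B (concat_control t u w) (t + T) = drive A B (concat_control t u w) t
      + lflow A (- t) (drive A B (\<lambda>\<sigma>. concat_control t u w (t + \<sigma>)) T)"
    by (rule drive_shift[OF concat_control[OF assms(1,2)] assms(4)])
  moreover have "drive A B (concat_control t u w) t = drive A B u t"
    by (rule drive_cong[OF assms(3)]) (simp add: concat_control_def)
  moreover have "drive A B (\<lambda>\<sigma>. concat_control t u w (t + \<sigma>)) T = drive A B w T"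
    by (rule drive_cong[OF assms(4)]) (simp add: concat_control_def)
  ultimately show ?thesis by simp
qed

end

context poincare_system
begin

text \<open>The component \<open>Q\<close> alone is not bounded by a multiple of its initial value,
  since the control adds a term proportional to the height. The height is constant along
  trajectories, so adding it restores a homogeneous estimate.\<close>

definition norm_plus_height :: "(real^'n \<Rightarrow> real^'n) \<Rightarrow> (real^'n) \<times> real \<Rightarrow> real" where
  "norm_plus_height Q y = norm (Q (fst y)) + \<bar>snd y\<bar>"

lemma norm_plus_height_scale: "linear Q \<Longrightarrow> c > 0 \<Longrightarrow> norm_plus_height Q (c *\<^sub>R y) = c * norm_plus_height Q y"
  by (simp add: norm_plus_height_def linear_scale[of Q] abs_mult distrib_left)

lemma continuous_norm_plus_height: "linear Q \<Longrightarrow> continuous_on S (norm_plus_height Q)"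
  unfolding norm_plus_height_def[abs_def]
  by (intro continuous_intros linear_continuous_on_compose[of _ "\<lambda>y. fst y"]) auto

lemma affine_growth_arith:
  fixes C M \<nu> e x r :: real
  assumes "C > 0" "M > 0" "\<nu> > 0" "e \<ge> 1" "x \<ge> 0" "r \<ge> 0"
  shows "C * e * x + r * (C * M / \<nu> * e) + r \<le> (C + C * M / \<nu> + 1) * e * (x + r)"
proof -
  define D where "D = C * M / \<nu>"
  have "D \<ge> 0" using assms by (simp add: D_def)
  have "r * 1 \<le> r * e" using assms by (intro mult_left_mono) auto
  moreover have "0 \<le> C * e * r" "0 \<le> D * e * x" "0 \<le> e * x" using assms \<open>D \<ge> 0\<close> by auto
  ultimately show ?thesis unfolding D_def[symmetric] by (simp add: algebra_simps)
qed

lemma hdist_fst_scale: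
  assumes "linear Q" "K \<noteq> {}" "c \<noteq> 0"
  shows "hdist K (Q (fst (c *\<^sub>R y))) (snd (c *\<^sub>R y)) = \<bar>c\<bar> * hdist K (Q (fst y)) (snd y)"
  using hdist_scale[OF assms(2,3)] by (simp add: linear_scale[OF assms(1)])

lemma continuous_hdist_fst:
  fixes Q :: "real^'n \<Rightarrow> real^'n"
  assumes "linear Q" "K \<noteq> {}" "\<And>k. k \<in> K \<Longrightarrow> norm k \<le> D"
  shows "continuous_on S (\<lambda>y :: (real^'n) \<times> real. hdist K (Q (fst y)) (snd y))"
proof (rule continuous_hdist[OF assms(2,3), where f = "\<lambda>y. Q (fst y)" and g = snd])
  show "bounded_linear (\<lambda>y::(real^'n) \<times> real. Q (fst y))"
    using linear_compose[OF linear_fst assms(1)] linear_conv_bounded_linear by (auto simp: o_def)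
qed (auto intro: bounded_linear_snd)

text \<open>If the second function vanishes, the height is 0 and \<open>hdist\<close> is the plain
  norm of the \<open>Q\<close> component, so both cannot vanish at a nonzero vector.\<close>

lemma hdist_norm_plus_height_pos:
  fixes Q :: "real^'n \<Rightarrow> real^'n"
  assumes "linear Q" "K \<noteq> {}" "y \<noteq> 0"
  shows "hdist K (Q (fst y)) (snd y) + norm_plus_height (\<lambda>x. x - Q x) y > 0"
proof (rule ccontr)
  assume "\<not> ?thesis"
  moreover have "hdist K (Q (fst y)) (snd y) \<ge> 0" by (rule hdist_nonneg[OF assms(2)])
  moreover have "norm_plus_height (\<lambda>x. x - Q x) y \<ge> 0" by (simp add: norm_plus_height_def)
  ultimately have *: "hdist K (Q (fst y)) (snd y) = 0" "norm_plus_height (\<lambda>x. x - Q x) y = 0" by linarith+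
  then have "snd y = 0" "fst y - Q (fst y) = 0" by (auto simp: norm_plus_height_def add_nonneg_eq_0_iff)
  moreover from this * have "Q (fst y) = 0" using hdist_0[OF assms(2)] by simp
  ultimately show False using assms(3) by (simp add: prod_eq_iff)
qed

text \<open>The unstable components that can be steered to 0, and the stable components that can be reached
  from 0, in finite time.  They need not be closed, but chains only see their closures.\<close>

definition unstable_targets :: "(real^'n \<Rightarrow> real^'n) \<Rightarrow> (real^'n) set" where
  "unstable_targets P = {- P (drive A B u T) |u T. u \<in> controls \<and> T \<ge> 0}"

definition stable_targets :: "(real^'n \<Rightarrow> real^'n) \<Rightarrow> (real^'n) set" where
  "stable_targets N = {N (lflow A T (drive A B u T)) |u T. u \<in> controls \<and> T \<ge> 0}"

text \<open>Take as threshold the value of f/(f + g) at \<open>s\<close> itself. A chain to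
  \<open>s\<close> or \<open>- s\<close> would raise the quotient strictly, yet evenness makes its
  value there the same; the threshold is admissible unless f vanishes at \<open>s\<close>.\<close>

lemma chain_recurrent_projective_eq:
  assumes "s \<leadsto> s \<or> s \<leadsto> - s" and "\<And>y. f (- y) = f y"
    and "\<And>\<theta> y. s \<leadsto> y \<Longrightarrow> 0 < \<theta> \<Longrightarrow> \<theta> < 1 \<Longrightarrow> \<theta> * (f s + g s) \<le> f s \<Longrightarrow> \<theta> * (f y + g y) < f y"
    and "\<And>y. g (- y) = g y" "f s \<ge> 0" "g s > (0::real)"
  shows "f s = 0"
proof (rule ccontr)
  assume "f s \<noteq> 0"
  then have f: "f s > 0" using assms(5) by simp
  let ?t = "f s / (f s + g s)"
  have t: "0 < ?t" "?t < 1" "?t * (f s + g s) = f s" using f assms(6) by auto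
  from assms(1) obtain y where y: "s \<leadsto> y" "y = s \<or> y = - s" by blast
  then have "?t * (f y + g y) < f y" using assms(3)[OF y(1) t(1,2)] t(3) by simp
  moreover have "f y = f s" "g y = g s" using y(2) assms(2)[of s] assms(4)[of s] by auto
  ultimately show False using t(3) by simp
qed

text \<open>The distance of the unstable component to the steerable ones expands at rate \<mu>,
  whereas complement plus height grows at most at rate \<nu> < \<mu>. Recurrence then forces the
  distance to vanish, since the other function is at least the nonzero height.\<close>

lemma chain_recurrent_unstable:
  fixes P :: "real^'n \<Rightarrow> real^'n"
  assumes P: "linear P" "\<forall>x. P (P x) = P x" "\<forall>t x. P (lflow A t x) = lflow A t (P x)"
    and rates: "0 < \<nu>" "\<nu> < \<mu>" "C > 0"
      "\<forall>t\<ge>0. \<forall>x. norm (lflow A (- t) (P x)) \<le> C * exp (- \<mu> * t) * norm x"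
      "\<forall>t\<ge>0. \<forall>x. norm (lflow A t (x - P x)) \<le> C * exp (\<nu> * t) * norm x"
    and s: "s \<leadsto> s \<or> s \<leadsto> - s" "snd s \<noteq> 0"
  shows "hdist (unstable_targets P) (P (fst s)) (snd s) = 0"
proof -
  obtain M where M: "M > 0" "\<forall>y\<in>U. norm (B *v y) \<le> M" by (rule control_bound)
  let ?K = "unstable_targets P" and ?Q = "\<lambda>x. x - P x"
  have Q: "linear ?Q" by (intro linear_compose_sub linear_ident P(1))
  have Qcomm: "\<forall>t x. ?Q (lflow A t x) = lflow A t (?Q x)" using P(3) by (simp add: lflow_simps)
  have QQ: "?Q (?Q x) = ?Q x" for x using P(2) by (simp add: linear_diff[OF P(1)])
  have K: "?K \<noteq> {}" unfolding unstable_targets_def using zero_control by blast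
  have bnd: "norm k \<le> C * M / \<mu>" if kK: "k \<in> ?K" for k
  proof -
    obtain u T where k: "k = - P (drive A B u T)" "u \<in> controls" "T \<ge> 0"
      using kK unfolding unstable_targets_def by blast
    have "norm k \<le> C * M * ((exp (- \<mu> * T) - 1) / - \<mu>)"
      unfolding k(1) norm_minus_cancel using rates
      by (intro projected_drive_bound[OF P(1) k(2) M(2) _ _ k(3)] P(3)) auto
    also have "\<dots> \<le> C * M * (1 / \<mu>)" using rates M(1) by (intro mult_left_mono) (auto simp: field_simps)
    finally show ?thesis by simp
  qed
  let ?a = "\<lambda>y. hdist ?K (P (fst y)) (snd y)" and ?b = "norm_plus_height ?Q"
  have growth_a: "?a y \<le> C * exp (- \<mu> * t) * ?a (lsol t y u)"
    if t: "t \<ge> 0" and u: "u \<in> controls" for t u y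
  proof -
    note eq = lift_sol_eq[OF u, of A B t y]
    have "hdist ?K (P (fst y)) (snd y) \<le> (C * exp (- \<mu> * t)) * hdist ?K (P (fst (lsol t y u))) (snd y) + 0"
    proof (rule hdist_compare[OF K])
      fix k assume "k \<in> ?K"
      then obtain w T where k: "k = - P (drive A B w T)" "w \<in> controls" "T \<ge> 0"
        unfolding unstable_targets_def by blast
      \<comment> \<open>If \<open>w\<close> steers the target \<open>k\<close> at the end of the
        segment to 0, then \<open>u\<close> followed by \<open>w\<close> steers \<open>?l\<close> at
        its start; the flow transports one difference into the other.\<close>
      let ?l = "- P (drive A B (concat_control t u w) (t + T))"
      have l: "?l \<in> ?K" unfolding unstable_targets_def using concat_control[OF u k(2)] t k(3) by fastforce
      have Pk: "P k = k" unfolding k(1) using P(2) by (simp add: linear_neg[OF P(1)])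
      have "P (fst y) - snd y *\<^sub>R ?l = lflow A (- t) (P (P (fst (lsol t y u)) - snd y *\<^sub>R k))"
        using P(2,3) Pk unfolding drive_concat[OF u k(2) t k(3)] eq
        by (simp add: k(1) linear_add[OF P(1)] linear_diff[OF P(1)] linear_scale[OF P(1)] lflow_simps algebra_simps
            linear_neg[OF P(1)])
      then have "norm (P (fst y) - snd y *\<^sub>R ?l) \<le> C * exp (- \<mu> * t) * norm (P (fst (lsol t y u)) - snd y *\<^sub>R k) + 0"
        using rates(4) t by simp
      then show "\<exists>l\<in>?K. norm (P (fst y) - snd y *\<^sub>R l) \<le> C * exp (- \<mu> * t) * norm (P (fst (lsol t y u)) - snd y *\<^sub>R k) + 0"
        using l by blast
    qed (use rates in auto)
    then show ?thesis unfolding eq by simp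
  qed
  have growth_b: "?b (lsol t y u) \<le> (C + C * M / \<nu> + 1) * exp (\<nu> * t) * ?b y"
    if t: "t \<ge> 0" and u: "u \<in> controls" for t u y
  proof -
    have e1: "exp (\<nu> * t) \<ge> 1" using rates t by simp
    note eq = lift_sol_eq[OF u, of A B t y]
    have r: "norm (?Q (lflow A t (drive A B u t))) \<le> C * M / \<nu> * exp (\<nu> * t)"
    proof -
      have "norm (?Q (lflow A t (drive A B u t))) \<le> C * M * ((exp (\<nu> * t) - 1) / \<nu>)"
        using rates by (intro projected_response_bound[OF Q u M(2) _ _ t] Qcomm) auto
      also have "\<dots> \<le> C * M * (exp (\<nu> * t) / \<nu>)"
        using rates M(1) by (intro mult_left_mono divide_right_mono) auto
      finally show ?thesis by simp
    qed
    have h: "norm (lflow A t (?Q (fst y))) \<le> C * exp (\<nu> * t) * norm (?Q (fst y))"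
      using spec[OF mp[OF spec[OF rates(5)] t], of "?Q (fst y)"] unfolding QQ .
    have "?Q (fst (lsol t y u)) = lflow A t (?Q (fst y)) + snd y *\<^sub>R ?Q (lflow A t (drive A B u t))"
      using P(3) unfolding eq by (simp add: lflow_simps linear_add[OF P(1)] linear_scale[OF P(1)] algebra_simps)
    then have "norm (?Q (fst (lsol t y u))) \<le> norm (lflow A t (?Q (fst y))) + \<bar>snd y\<bar> * norm (?Q (lflow A t (drive A B u t)))"
      using norm_triangle_ineq[of "lflow A t (?Q (fst y))" "snd y *\<^sub>R ?Q (lflow A t (drive A B u t))"] by simp
    also have "\<dots> \<le> C * exp (\<nu> * t) * norm (?Q (fst y)) + \<bar>snd y\<bar> * (C * M / \<nu> * exp (\<nu> * t))"
      using h r by (intro add_mono mult_left_mono) auto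
    finally have "?b (lsol t y u) \<le> C * exp (\<nu> * t) * norm (?Q (fst y)) + \<bar>snd y\<bar> * (C * M / \<nu> * exp (\<nu> * t)) + \<bar>snd y\<bar>"
      by (simp add: norm_plus_height_def eq)
    also have "\<dots> \<le> (C + C * M / \<nu> + 1) * exp (\<nu> * t) * (norm (?Q (fst y)) + \<bar>snd y\<bar>)"
      by (rule affine_growth_arith[OF _ _ _ e1]) (use rates M(1) in auto)
    finally show ?thesis by (simp add: norm_plus_height_def algebra_simps)
  qed
  have Cb: "C + C * M / \<nu> + 1 > 0" using rates M(1) by (intro add_nonneg_pos) auto
  show ?thesis
  proof (rule chain_recurrent_projective_eq[where f = ?a and g = ?b, OF s(1)])
    show "hdist ?K (P (fst (- y))) (snd (- y)) = ?a y" for y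
      using hdist_fst_scale[OF P(1) K, of "- 1" y] by simp
    show "?b (- y) = ?b y" for y by (simp add: norm_plus_height_def linear_neg[OF P(1)]) (metis minus_diff_eq norm_minus_cancel minus_diff_minus)
    show "?a s \<ge> 0" by (rule hdist_nonneg[OF K])
    show "?b s > 0" using s(2) by (simp add: norm_plus_height_def add_nonneg_pos)
    fix \<theta> y assume "s \<leadsto> y" "0 < \<theta>" "\<theta> < 1" "\<theta> * (?a s + ?b s) \<le> ?a s"
    then show "\<theta> * (?a y + ?b y) < ?a y"
    proof (rule ratio_separation[where M = sph and V = controls and \<Phi> = ssol and \<Lambda> = lsol and p = "- \<mu>" and q = \<nu>
        and ?C1.0 = C and ?C2.0 = "C + C * M / \<nu> + 1", rotated -4])
      show "continuous_on sph ?a" by (rule continuous_hdist_fst[OF P(1) K bnd])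
      show "continuous_on sph ?b" by (rule continuous_norm_plus_height[OF Q])
      show "ssol T x v = sgn (lsol T x v) \<and> lsol T x v \<noteq> 0 \<and> ssol T x v \<in> sph" if "x \<in> sph" "v \<in> controls" for T x v
      proof -
        have "x \<noteq> 0" using that by auto
        then show ?thesis using lsol_nonzero[OF that(2)] invariant[OF that] by (simp add: sphere_sol_def)
      qed
      show "?a x + ?b x > 0" if "x \<in> sph" for x using that by (intro hdist_norm_plus_height_pos[OF P(1) K]) auto
    qed (use growth_a growth_b hdist_nonneg[OF K] hdist_fst_scale[OF P(1) K] norm_plus_height_scale[OF Q] Cb rates in
        \<open>auto simp: norm_plus_height_def[of _ x for x]\<close>)
  qed
qed

text \<open>The mirror image with the roles of \<open>a\<close> and \<open>b\<close> exchanged: now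
  the distance contracts at rate \<mu>, and complement plus height decreases at most at rate
  \<nu>.\<close>

lemma chain_recurrent_stable:
  fixes N :: "real^'n \<Rightarrow> real^'n"
  assumes N: "linear N" "\<forall>x. N (N x) = N x" "\<forall>t x. N (lflow A t x) = lflow A t (N x)"
    and rates: "0 < \<nu>" "\<nu> < \<mu>" "C > 0"
      "\<forall>t\<ge>0. \<forall>x. norm (lflow A t (N x)) \<le> C * exp (- \<mu> * t) * norm x"
      "\<forall>t\<ge>0. \<forall>x. norm (lflow A (- t) (x - N x)) \<le> C * exp (\<nu> * t) * norm x"
    and s: "s \<leadsto> s \<or> s \<leadsto> - s" "snd s \<noteq> 0"
  shows "hdist (stable_targets N) (N (fst s)) (snd s) = 0"
proof -
  obtain M where M: "M > 0" "\<forall>y\<in>U. norm (B *v y) \<le> M" by (rule control_bound)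
  let ?K = "stable_targets N" and ?Q = "\<lambda>x. x - N x"
  have Q: "linear ?Q" by (intro linear_compose_sub linear_ident N(1))
  have Qcomm: "\<forall>t x. ?Q (lflow A t x) = lflow A t (?Q x)" using N(3) by (simp add: lflow_simps)
  have QQ: "?Q (?Q x) = ?Q x" for x using N(2) by (simp add: linear_diff[OF N(1)])
  have K: "?K \<noteq> {}" unfolding stable_targets_def using zero_control by blast
  have bnd: "norm k \<le> C * M / \<mu>" if kK: "k \<in> ?K" for k
  proof -
    obtain u T where k: "k = N (lflow A T (drive A B u T))" "u \<in> controls" "T \<ge> 0"
      using kK unfolding stable_targets_def by blast
    have "norm k \<le> C * M * ((exp (- \<mu> * T) - 1) / - \<mu>)"
      unfolding k(1) using rates
      by (intro projected_response_bound[OF N(1) k(2) M(2) _ _ k(3)] N(3)) auto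
    also have "\<dots> \<le> C * M * (1 / \<mu>)" using rates M(1) by (intro mult_left_mono) (auto simp: field_simps)
    finally show ?thesis by simp
  qed
  let ?b = "\<lambda>y. hdist ?K (N (fst y)) (snd y)" and ?a = "norm_plus_height ?Q"
  have growth_b: "?b (lsol t y u) \<le> C * exp (- \<mu> * t) * ?b y"
    if t: "t \<ge> 0" and u: "u \<in> controls" for t u y
  proof -
    note eq = lift_sol_eq[OF u, of A B t y]
    have "hdist ?K (N (fst (lsol t y u))) (snd y) \<le> (C * exp (- \<mu> * t)) * hdist ?K (N (fst y)) (snd y) + 0"
    proof (rule hdist_compare[OF K])
      fix k assume "k \<in> ?K"
      then obtain w T where k: "k = N (lflow A T (drive A B w T))" "w \<in> controls" "T \<ge> 0"
        unfolding stable_targets_def by blast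
      \<comment> \<open>Reachability from 0 is prolonged at the end, so here \<open>w\<close> comes
        first and \<open>u\<close> follows.\<close>
      let ?l = "N (lflow A (T + t) (drive A B (concat_control T w u) (T + t)))"
      have l: "?l \<in> ?K" unfolding stable_targets_def using concat_control[OF k(2) u] t k(3) by fastforce
      have Nk: "N k = k" unfolding k(1) using N(2) by simp
      have fl: "lflow A (T + t) x = lflow A t (lflow A T x)" for x
        using lflow_add[of A t T x] by (simp only: add.commute)
      have "?l = lflow A t k + N (lflow A t (drive A B u t))"
        unfolding drive_concat[OF k(2) u k(3) t] fl using N(3)
        by (simp add: k(1) lflow_simps linear_add[OF N(1)])
      then have "N (fst (lsol t y u)) - snd y *\<^sub>R ?l = lflow A t (N (N (fst y) - snd y *\<^sub>R k))"
        using N(2,3) Nk unfolding eq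
        by (simp add: linear_add[OF N(1)] linear_diff[OF N(1)] linear_scale[OF N(1)] lflow_simps algebra_simps)
      then have "norm (N (fst (lsol t y u)) - snd y *\<^sub>R ?l) \<le> C * exp (- \<mu> * t) * norm (N (fst y) - snd y *\<^sub>R k) + 0"
        using rates(4) t by simp
      then show "\<exists>l\<in>?K. norm (N (fst (lsol t y u)) - snd y *\<^sub>R l) \<le> C * exp (- \<mu> * t) * norm (N (fst y) - snd y *\<^sub>R k) + 0"
        using l by blast
    qed (use rates in auto)
    then show ?thesis unfolding eq by simp
  qed
  have growth_a: "?a y \<le> (C + C * M / \<nu> + 1) * exp (\<nu> * t) * ?a (lsol t y u)"
    if t: "t \<ge> 0" and u: "u \<in> controls" for t u y
  proof -
    have e1: "exp (\<nu> * t) \<ge> 1" using rates t by simp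
    let ?x = "fst (lsol t y u)"
    have eq: "fst y = lflow A (- t) ?x - snd y *\<^sub>R drive A B u t" "snd (lsol t y u) = snd y"
      unfolding lift_sol_eq[OF u, of A B t y] by simp_all
    have r: "norm (?Q (drive A B u t)) \<le> C * M / \<nu> * exp (\<nu> * t)"
    proof -
      have "norm (?Q (drive A B u t)) \<le> C * M * ((exp (\<nu> * t) - 1) / \<nu>)"
        using rates by (intro projected_drive_bound[OF Q u M(2) _ _ t] Qcomm) auto
      also have "\<dots> \<le> C * M * (exp (\<nu> * t) / \<nu>)"
        using rates M(1) by (intro mult_left_mono divide_right_mono) auto
      finally show ?thesis by simp
    qed
    have h: "norm (lflow A (- t) (?Q ?x)) \<le> C * exp (\<nu> * t) * norm (?Q ?x)"
      using spec[OF mp[OF spec[OF rates(5)] t], of "?Q ?x"] unfolding QQ .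
    have "?Q (fst y) = lflow A (- t) (?Q ?x) - snd y *\<^sub>R ?Q (drive A B u t)"
      using N(3) by (subst (1 2) eq(1)) (simp add: lflow_simps linear_diff[OF N(1)] linear_scale[OF N(1)] algebra_simps)
    then have "norm (?Q (fst y)) \<le> norm (lflow A (- t) (?Q ?x)) + \<bar>snd y\<bar> * norm (?Q (drive A B u t))"
      using norm_triangle_ineq4[of "lflow A (- t) (?Q ?x)" "snd y *\<^sub>R ?Q (drive A B u t)"] by simp
    also have "\<dots> \<le> C * exp (\<nu> * t) * norm (?Q ?x) + \<bar>snd y\<bar> * (C * M / \<nu> * exp (\<nu> * t))"
      using h r by (intro add_mono mult_left_mono) auto
    finally have "?a y \<le> C * exp (\<nu> * t) * norm (?Q ?x) + \<bar>snd y\<bar> * (C * M / \<nu> * exp (\<nu> * t)) + \<bar>snd y\<bar>"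
      by (simp add: norm_plus_height_def)
    also have "\<dots> \<le> (C + C * M / \<nu> + 1) * exp (\<nu> * t) * (norm (?Q ?x) + \<bar>snd y\<bar>)"
      by (rule affine_growth_arith[OF _ _ _ e1]) (use rates M(1) in auto)
    finally show ?thesis by (simp add: norm_plus_height_def eq(2) algebra_simps)
  qed
  have Ca: "C + C * M / \<nu> + 1 > 0" using rates M(1) by (intro add_nonneg_pos) auto
  have a0: "?a s > 0" using s(2) by (simp add: norm_plus_height_def add_nonneg_pos)
  \<comment> \<open>Were the distance positive, recurrence would make the growing function vanish;
    it contains the nonzero height, so the distance is 0.\<close>
  have "?a s = 0" if bs: "?b s > 0"
  proof (rule chain_recurrent_projective_eq[where f = ?a and g = ?b, OF s(1)])
    show "hdist ?K (N (fst (- y))) (snd (- y)) = ?b y" for y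
      using hdist_fst_scale[OF N(1) K, of "- 1" y] by simp
    show "?a (- y) = ?a y" for y by (simp add: norm_plus_height_def linear_neg[OF N(1)]) (metis minus_diff_eq norm_minus_cancel minus_diff_minus)
    show "?a s \<ge> 0" using a0 by simp
    show "?b s > 0" by (rule bs)
    fix \<theta> y assume "s \<leadsto> y" "0 < \<theta>" "\<theta> < 1" "\<theta> * (?a s + ?b s) \<le> ?a s"
    then show "\<theta> * (?a y + ?b y) < ?a y"
    proof (rule ratio_separation[where M = sph and V = controls and \<Phi> = ssol and \<Lambda> = lsol and p = \<nu> and q = "- \<mu>"
        and ?C1.0 = "C + C * M / \<nu> + 1" and ?C2.0 = C, rotated -4])
      show "continuous_on sph ?b" by (rule continuous_hdist_fst[OF N(1) K bnd])
      show "continuous_on sph ?a" by (rule continuous_norm_plus_height[OF Q])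
      show "ssol T x v = sgn (lsol T x v) \<and> lsol T x v \<noteq> 0 \<and> ssol T x v \<in> sph" if "x \<in> sph" "v \<in> controls" for T x v
      proof -
        have "x \<noteq> 0" using that by auto
        then show ?thesis using lsol_nonzero[OF that(2)] invariant[OF that] by (simp add: sphere_sol_def)
      qed
      show "?a x + ?b x > 0" if "x \<in> sph" for x
      proof -
        have "?b x + ?a x > 0" using that by (intro hdist_norm_plus_height_pos[OF N(1) K]) auto
        then show ?thesis by simp
      qed
    qed (use growth_a growth_b hdist_nonneg[OF K] hdist_fst_scale[OF N(1) K] norm_plus_height_scale[OF Q] Ca rates in
        \<open>auto simp: norm_plus_height_def[of _ x for x]\<close>)
  qed
  then show ?thesis using a0 hdist_nonneg[OF K, of "N (fst s)" "snd s"] by force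
qed

section \<open>Connection with the north pole\<close>

definition pole :: "(real^'n) \<times> real" where "pole = (0, 1)"

lemma sgn_pole: "r > 0 \<Longrightarrow> sgn (0 :: real^'n, r) = pole"
  by (simp add: pole_def sgn_div_norm norm_Pair)

lemma height_nonzero: "(r::real) > 0 \<Longrightarrow> (x :: real^'n, r) \<noteq> 0"
  by (auto simp: zero_prod_def)

lemma norm_ge_height: "\<bar>r\<bar> \<le> norm (x, r)" for x :: "real^'n" and r :: real
  using norm_snd_le'[of "(x, r)"] by simp

lemma dist_sgn_height:
  fixes x :: "real^'n"
  assumes "r > 0"
  shows "dist (sgn (x, r)) (sgn (x, r')) \<le> 2 * \<bar>r - r'\<bar> / r"
proof -
  have "(x, r) \<noteq> 0" using assms by (auto simp: zero_prod_def)
  then have "dist (sgn (x, r)) (sgn (x, r')) \<le> 2 * norm ((x, r) - (x, r')) / norm (x, r)"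
    by (rule dist_sgn_le)
  also have "\<dots> = 2 * \<bar>r - r'\<bar> / norm (x, r)" by (simp add: norm_Pair)
  also have "\<dots> \<le> 2 * \<bar>r - r'\<bar> / r"
    using norm_ge_height[of r x] assms by (intro divide_left_mono mult_pos_pos) auto
  finally show ?thesis .
qed

lemma dist_pole:
  fixes x :: "real^'n"
  assumes "r > 0"
  shows "dist pole (sgn (x, r)) \<le> 2 * norm x / r"
proof -
  have "dist (sgn (0, r)) (sgn (x, r)) \<le> 2 * norm ((0, r) - (x, r)) / norm (0 :: real^'n, r)"
    using assms by (intro dist_sgn_le) (auto simp: zero_prod_def)
  then show ?thesis using assms by (simp add: norm_Pair sgn_pole)
qed

text \<open>Under the zero control the point \<open>(x, r)\<close> moves by \<open>lflow\<close> in \<open>x\<close> alone, so the height \<open>r\<close> may be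
  multiplied by a factor close to 1 in every jump; this beats any subexponential growth of \<open>x\<close>.\<close>

lemma scaling_step:
  assumes "r > 0" "r' > 0" "2 * \<bar>r - r'\<bar> / r < \<epsilon>"
  shows "sstep \<epsilon> \<tau> (sgn (x, r)) (sgn (lflow A \<tau> x, r'))"
proof -
  define x' where x': "x' = lflow A \<tau> x"
  have nz: "(x, r) \<noteq> 0" "(lflow A \<tau> x, r') \<noteq> 0" using assms by (auto simp: zero_prod_def)
  have "ssol \<tau> (sgn (x, r)) (\<lambda>_. 0) = sgn (lflow A \<tau> x, r)"
    using ssol_sgn[OF nz(1)] by (simp add: lift_sol_zero_control)
  then have "dist (ssol \<tau> (sgn (x, r)) (\<lambda>_. 0)) (sgn (lflow A \<tau> x, r')) < \<epsilon>"
    using le_less_trans[OF dist_sgn_height[OF assms(1), of x' r'] assms(3)] x' by simp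
  then show ?thesis
    unfolding chain_step_def using sgn_in_sphere[OF nz(1)] sgn_in_sphere[OF nz(2)] zero_control by blast
qed

text \<open>Multiplying the height instead of shrinking the state gives the same point of the sphere
  but keeps the chain explicit: the state just follows the free flow.\<close>

lemma subexponential_reach_pole:
  assumes q: "\<forall>\<rho>>0. \<exists>C\<ge>0. \<forall>t\<ge>0. norm (lflow A t q) \<le> C * exp (\<rho> * t)"
  shows "sgn (q, 1) \<leadsto> pole"
  unfolding chain_reach_def
proof (intro allI impI)
  fix \<epsilon> \<tau> :: real assume e: "\<epsilon> > 0" "\<tau> > 0"
  obtain \<kappa> where \<kappa>: "\<kappa> > 1" "2 * (\<kappa>^2 - 1) < \<epsilon>" by (rule scaling_factor[OF e(1)])
  have "\<exists>N. 2 * norm (lflow A (real (Suc N) * \<tau>) q) / \<kappa> ^ (2 * N) < \<epsilon>"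
    by (rule subexponential_power[where F = "\<lambda>t. norm (lflow A t q)", OF q \<kappa>(1) e(2,1)])
  then obtain N where N: "2 * norm (lflow A (real (Suc N) * \<tau>) q) / \<kappa> ^ (2 * N) < \<epsilon>" ..
  \<comment> \<open>In R^n these points are e^{i\<tau>A}q / \<kappa>^{2i}; they approach 0, and
    \<open>N\<close> is where the pole is within one jump.\<close>
  let ?p = "\<lambda>i. sgn (lflow A (real i * \<tau>) q, \<kappa> ^ (2 * i))"
  have flow: "lflow A \<tau> (lflow A (real i * \<tau>) q) = lflow A (real (Suc i) * \<tau>) q" for i
    by (simp add: lflow_add[symmetric] distrib_right)
  have pos: "\<kappa> ^ j > 0" for j using \<kappa>(1) by simp
  have step: "sstep \<epsilon> \<tau> (?p i) (?p (Suc i))" for i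
    using scaling_step[OF pos pos scaling_ratio(1)[OF \<kappa>, of i], of \<tau> "lflow A (real i * \<tau>) q"]
    unfolding flow .
  have "(sstep \<epsilon> \<tau>)\<^sup>*\<^sup>* (?p 0) (?p i)" for i
  proof (induction i)
    case (Suc i)
    then show ?case using step[of i] by (rule rtranclp.rtrancl_into_rtrancl)
  qed simp
  moreover have "sstep \<epsilon> \<tau> (?p N) pole"
  proof -
    have r: "\<kappa> ^ (2 * N) > 0" using \<kappa>(1) by simp
    have nz: "(lflow A (real N * \<tau>) q, \<kappa> ^ (2 * N)) \<noteq> 0" by (rule height_nonzero[OF r])
    have "ssol \<tau> (?p N) (\<lambda>_. 0) = sgn (lflow A (real (Suc N) * \<tau>) q, \<kappa> ^ (2 * N))"
      using ssol_sgn[OF nz] flow by (simp add: lift_sol_zero_control)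
    then have "dist (ssol \<tau> (?p N) (\<lambda>_. 0)) pole < \<epsilon>"
      using le_less_trans[OF dist_pole[OF r] N] by (simp only: dist_commute)
    then show ?thesis
      unfolding chain_step_def using sgn_in_sphere[OF nz] zero_control by (auto simp: pole_def norm_Pair)
  qed
  ultimately have "(sstep \<epsilon> \<tau>)\<^sup>+\<^sup>+ (?p 0) pole" by (rule rtranclp_into_tranclp1)
  then show "(sstep \<epsilon> \<tau>)\<^sup>+\<^sup>+ (sgn (q, 1)) pole" by simp
qed

text \<open>The same construction run backward: the chain leaves the pole, which the zero control
  fixes, for a far backward iterate of \<open>q\<close> at great height, and each step lowers the
  height until it is 1.\<close>

lemma pole_reach_subexponential:
  assumes q: "\<forall>\<rho>>0. \<exists>C\<ge>0. \<forall>t\<ge>0. norm (lflow A (- t) q) \<le> C * exp (\<rho> * t)"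
  shows "pole \<leadsto> sgn (q, 1)"
  unfolding chain_reach_def
proof (intro allI impI)
  fix \<epsilon> \<tau> :: real assume e: "\<epsilon> > 0" "\<tau> > 0"
  obtain \<kappa> where \<kappa>: "\<kappa> > 1" "2 * (\<kappa>^2 - 1) < \<epsilon>" by (rule scaling_factor[OF e(1)])
  have "\<exists>N. 2 * norm (lflow A (- (real (Suc N) * \<tau>)) q) / \<kappa> ^ (2 * N) < \<epsilon>"
    by (rule subexponential_power[where F = "\<lambda>t. norm (lflow A (- t) q)", OF q \<kappa>(1) e(2,1)])
  then obtain N where "2 * norm (lflow A (- (real (Suc N) * \<tau>)) q) / \<kappa> ^ (2 * N) < \<epsilon>" ..
  \<comment> \<open>The chain is entered at index \<open>Suc N\<close>, so the estimate is passed on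
    to the larger height belonging to that index.\<close>
  moreover have "2 * norm (lflow A (- (real (Suc N) * \<tau>)) q) / \<kappa> ^ (2 * Suc N)
      \<le> 2 * norm (lflow A (- (real (Suc N) * \<tau>)) q) / \<kappa> ^ (2 * N)"
    using \<kappa>(1) by (intro divide_left_mono power_increasing mult_pos_pos) auto
  ultimately have N: "2 * norm (lflow A (- (real (Suc N) * \<tau>)) q) / \<kappa> ^ (2 * Suc N) < \<epsilon>" by linarith
  let ?p = "\<lambda>i. sgn (lflow A (- (real i * \<tau>)) q, \<kappa> ^ (2 * i))"
  have flow: "lflow A \<tau> (lflow A (- (real (Suc i) * \<tau>)) q) = lflow A (- (real i * \<tau>)) q" for i
    by (simp add: lflow_add[symmetric] algebra_simps)
  have pos: "\<kappa> ^ j > 0" for j using \<kappa>(1) by simp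
  have step: "sstep \<epsilon> \<tau> (?p (Suc i)) (?p i)" for i
    using scaling_step[OF pos pos scaling_ratio(2)[OF \<kappa>, of i], of \<tau> "lflow A (- (real (Suc i) * \<tau>)) q"]
    unfolding flow .
  have "(sstep \<epsilon> \<tau>)\<^sup>*\<^sup>* (?p i) (?p 0)" for i
  proof (induction i)
    case (Suc i)
    show ?case by (rule converse_rtranclp_into_rtranclp[where r = "sstep \<epsilon> \<tau>", OF step[of i] Suc.IH])
  qed simp
  moreover have "sstep \<epsilon> \<tau> pole (?p (Suc N))"
  proof -
    have r: "\<kappa> ^ (2 * Suc N) > 0" using \<kappa>(1) by simp
    have nz: "(lflow A (- (real (Suc N) * \<tau>)) q, \<kappa> ^ (2 * Suc N)) \<noteq> 0" by (rule height_nonzero[OF r])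
    have "ssol \<tau> pole (\<lambda>_. 0) = pole"
      using sgn_pole[of 1] by (simp add: sphere_sol_def lift_sol_zero_control lflow_simps pole_def)
    then have "dist (ssol \<tau> pole (\<lambda>_. 0)) (?p (Suc N)) < \<epsilon>"
      using le_less_trans[OF dist_pole[OF r] N] by (simp only:)
    then show ?thesis
      unfolding chain_step_def using sgn_in_sphere[OF nz] zero_control by (auto simp: pole_def norm_Pair)
  qed
  ultimately have "(sstep \<epsilon> \<tau>)\<^sup>+\<^sup>+ pole (?p 0)" by (rule rtranclp_into_tranclp2[rotated])
  then show "(sstep \<epsilon> \<tau>)\<^sup>+\<^sup>+ pole (sgn (q, 1))" by simp
qed

lemma northern_sgn:
  assumes "s \<in> sph" "snd s > 0"
  shows "s = sgn ((1 / snd s) *\<^sub>R fst s, 1)" and "s = snd s *\<^sub>R ((1 / snd s) *\<^sub>R fst s, 1)"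
proof -
  show *: "s = snd s *\<^sub>R ((1 / snd s) *\<^sub>R fst s, 1)" using assms(2) by (simp add: prod_eq_iff)
  have "sgn s = sgn ((1 / snd s) *\<^sub>R fst s, 1)" by (subst *) (rule sgn_pos_scaleR[OF assms(2)])
  then show "s = sgn ((1 / snd s) *\<^sub>R fst s, 1)" using sgn_unit[OF assms(1)] by simp
qed

lemma dist_chart: "dist (sgn (z, 1 :: real)) (sgn (z', 1)) \<le> 2 * norm (z - z')" for z z' :: "real^'n"
proof -
  have "dist (sgn (z, 1 :: real)) (sgn (z', 1)) \<le> 2 * norm ((z, 1 :: real) - (z', 1)) / norm (z, 1 :: real)"
    by (rule dist_sgn_le[OF height_nonzero]) simp
  also have "\<dots> \<le> 2 * norm ((z, 1 :: real) - (z', 1)) / 1"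
    using norm_ge_height[of 1 z] by (intro divide_left_mono) auto
  finally show ?thesis by (simp add: norm_Pair)
qed

lemma chart_in_sphere: "sgn (z, 1) \<in> sph"
  by (rule sgn_in_sphere[OF height_nonzero]) simp

lemma ssol_chart: "u \<in> controls \<Longrightarrow> ssol t (sgn (z, 1)) u = sgn (affine_sol A B t z u, 1)"
  by (simp only: ssol_sgn[OF height_nonzero[OF zero_less_one]] lift_sol_affine)

lemma recurrent_reach_pole:
  assumes s: "s \<in> sph" "snd s > 0" "s \<leadsto> s \<or> s \<leadsto> - s"
  shows "s \<leadsto> pole"
proof -
  obtain P :: "real^'n \<Rightarrow> real^'n" and C \<mu> \<nu> where P: "linear P" "\<forall>x. P (P x) = P x" "\<forall>t x. P (lflow A t x) = lflow A t (P x)"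
    "\<forall>x. x - P x \<in> lyapunov_sum A {..0}" "0 < \<nu>" "\<nu> < \<mu>" "C > 0"
    "\<forall>t\<ge>0. \<forall>x. norm (lflow A (- t) (P x)) \<le> C * exp (- \<mu> * t) * norm x"
    "\<forall>t\<ge>0. \<forall>x. norm (lflow A t (x - P x)) \<le> C * exp (\<nu> * t) * norm x"
    by (rule unstable_projection[of A])
  let ?K = "unstable_targets P" and ?z = "(1 / snd s) *\<^sub>R fst s"
  have K: "?K \<noteq> {}" unfolding unstable_targets_def using zero_control by blast
  have "hdist ?K (P (fst s)) (snd s) = 0"
    by (rule chain_recurrent_unstable[OF P(1-3,5-9) s(3)]) (use s(2) in simp)
  then have z: "hdist ?K (P ?z) 1 = 0"
    using hdist_scale[OF K, of "1 / snd s" "P (fst s)" "snd s"] s(2) by (simp add: linear_scale[OF P(1)])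
  have reach: "sgn (z', 1) \<leadsto> pole" if k: "P z' \<in> ?K" for z'
  proof -
    obtain u T where u: "P z' = - P (drive A B u T)" "u \<in> controls" "T \<ge> 0"
      using k unfolding unstable_targets_def by blast
    let ?q = "affine_sol A B T z' u"
    \<comment> \<open>This is the purpose of the minus sign in \<open>unstable_targets\<close>:
      steering adds the drive to \<open>z'\<close> before the flow acts, and the unstable components
      cancel.\<close>
    have "P ?q = 0" using P(3) u(1) by (simp add: affine_sol_def linear_add[OF P(1)] lflow_simps)
    then have q: "?q \<in> lyapunov_sum A {..0}" using spec[OF P(4), of ?q] by simp
    have "\<forall>\<rho>>0. \<exists>C\<ge>0. \<forall>t\<ge>0. norm (lflow A t ?q) \<le> C * exp (\<rho> * t)"
      by (intro allI impI lyapunov_sum_growth_forward[OF q]) auto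
    then have "ssol T (sgn (z', 1)) u \<leadsto> pole"
      unfolding ssol_chart[OF u(2)] by (rule subexponential_reach_pole)
    then show ?thesis by (rule reach_flow_source[OF chart_in_sphere u(2,3)])
  qed
  have "sgn (?z, 1) \<leadsto> pole"
  proof (rule reach_limit_source[OF chart_in_sphere])
    fix \<delta> :: real assume "\<delta> > 0"
    then obtain k where k: "k \<in> ?K" "norm (P ?z - 1 *\<^sub>R k) < \<delta> / 2"
      using hdist_zero_near[OF z K, of "\<delta> / 2"] by auto
    have Pk: "P k = k" using k(1) P(2) unfolding unstable_targets_def by (auto simp: linear_neg[OF P(1)])
    \<comment> \<open>Only the unstable component is corrected, so that it becomes the target
      \<open>k\<close> exactly while the point moves by less than \<delta>/2.\<close>
    let ?z' = "?z - (P ?z - k)"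
    have "P ?z' = k" using P(2) Pk by (simp add: linear_diff[OF P(1)])
    then have "sgn (?z', 1) \<leadsto> pole" using reach k(1) by simp
    moreover have "dist (sgn (?z, 1 :: real)) (sgn (?z', 1)) < \<delta>"
      using dist_chart[of ?z ?z'] k(2) by simp
    ultimately show "\<exists>x'\<in>sph. dist (sgn (?z, 1)) x' < \<delta> \<and> x' \<leadsto> pole"
      using chart_in_sphere by blast
  qed
  then show ?thesis using northern_sgn(1)[OF s(1,2)] by simp
qed

lemma pole_reach_recurrent:
  assumes s: "s \<in> sph" "snd s > 0" "s \<leadsto> s \<or> s \<leadsto> - s"
  shows "pole \<leadsto> s"
proof -
  obtain N :: "real^'n \<Rightarrow> real^'n" and C \<mu> \<nu> where N: "linear N" "\<forall>x. N (N x) = N x" "\<forall>t x. N (lflow A t x) = lflow A t (N x)"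
    "\<forall>x. x - N x \<in> lyapunov_sum A {0..}" "0 < \<nu>" "\<nu> < \<mu>" "C > 0"
    "\<forall>t\<ge>0. \<forall>x. norm (lflow A t (N x)) \<le> C * exp (- \<mu> * t) * norm x"
    "\<forall>t\<ge>0. \<forall>x. norm (lflow A (- t) (x - N x)) \<le> C * exp (\<nu> * t) * norm x"
    by (rule stable_projection[of A])
  let ?K = "stable_targets N" and ?z = "(1 / snd s) *\<^sub>R fst s"
  have K: "?K \<noteq> {}" unfolding stable_targets_def using zero_control by blast
  have "hdist ?K (N (fst s)) (snd s) = 0"
    by (rule chain_recurrent_stable[OF N(1-3,5-9) s(3)]) (use s(2) in simp)
  then have z: "hdist ?K (N ?z) 1 = 0"
    using hdist_scale[OF K, of "1 / snd s" "N (fst s)" "snd s"] s(2) by (simp add: linear_scale[OF N(1)])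
  have reach: "pole \<leadsto> sgn (z', 1)" if k: "N z' \<in> ?K" for z'
  proof -
    obtain u T where u: "N z' = N (lflow A T (drive A B u T))" "u \<in> controls" "T \<ge> 0"
      using k unfolding stable_targets_def by blast
    \<comment> \<open>The point that \<open>u\<close> steers to \<open>z'\<close> in time
      \<open>T\<close>. Its stable component vanishes because that of \<open>z'\<close> is reached
      from 0 by the same control.\<close>
    let ?q = "lflow A (- T) z' - drive A B u T"
    have "N ?q = lflow A (- T) (N z' - N (lflow A T (drive A B u T)))"
      using N(3) by (simp add: linear_diff[OF N(1)] lflow_simps)
    then have "N ?q = 0" unfolding u(1) by (simp add: lflow_simps)
    then have q: "?q \<in> lyapunov_sum A {0..}" using spec[OF N(4), of ?q] by simp
    have "\<exists>C\<ge>0. \<forall>t\<ge>0. norm (lflow A (- t) ?q) \<le> C * exp (- (- \<rho>) * t)" if "\<rho> > 0" for \<rho>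
      using that by (intro lyapunov_sum_growth_backward[OF q]) auto
    then have "\<forall>\<rho>>0. \<exists>C\<ge>0. \<forall>t\<ge>0. norm (lflow A (- t) ?q) \<le> C * exp (\<rho> * t)" by simp
    then have "pole \<leadsto> sgn (?q, 1)" by (rule pole_reach_subexponential)
    then have "pole \<leadsto> ssol T (sgn (?q, 1)) u" by (rule reach_flow_target[OF u(2,3)])
    then show ?thesis unfolding ssol_chart[OF u(2)] by (simp add: affine_sol_def)
  qed
  have "pole \<leadsto> sgn (?z, 1)"
  proof (rule reach_limit_target[OF chart_in_sphere])
    fix \<delta> :: real assume "\<delta> > 0"
    then obtain k where k: "k \<in> ?K" "norm (N ?z - 1 *\<^sub>R k) < \<delta> / 2"
      using hdist_zero_near[OF z K, of "\<delta> / 2"] by auto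
    have Nk: "N k = k" using k(1) N(2) unfolding stable_targets_def by auto
    let ?z' = "?z - (N ?z - k)"
    have "N ?z' = k" using N(2) Nk by (simp add: linear_diff[OF N(1)])
    then have "pole \<leadsto> sgn (?z', 1)" using reach k(1) by simp
    moreover have "dist (sgn (?z, 1 :: real)) (sgn (?z', 1)) < \<delta>"
      using dist_chart[of ?z ?z'] k(2) by simp
    ultimately show "\<exists>y'\<in>sph. dist (sgn (?z, 1)) y' < \<delta> \<and> pole \<leadsto> y'"
      using chart_in_sphere by blast
  qed
  then show ?thesis using northern_sgn(1)[OF s(1,2)] by simp
qed

lemma center_growth:
  assumes "v \<in> lyapunov_sum A {0}"
  shows "\<forall>\<rho>>0. \<exists>C\<ge>0. \<forall>t\<ge>0. norm (lflow A t v) \<le> C * exp (\<rho> * t)"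
    "\<forall>\<rho>>0. \<exists>C\<ge>0. \<forall>t\<ge>0. norm (lflow A (- t) v) \<le> C * exp (\<rho> * t)"
proof -
  show "\<forall>\<rho>>0. \<exists>C\<ge>0. \<forall>t\<ge>0. norm (lflow A t v) \<le> C * exp (\<rho> * t)"
    by (intro allI impI lyapunov_sum_growth_forward[OF assms]) auto
  have "\<exists>C\<ge>0. \<forall>t\<ge>0. norm (lflow A (- t) v) \<le> C * exp (- (- \<rho>) * t)" if "\<rho> > 0" for \<rho>
    using that by (intro lyapunov_sum_growth_backward[OF assms]) auto
  then show "\<forall>\<rho>>0. \<exists>C\<ge>0. \<forall>t\<ge>0. norm (lflow A (- t) v) \<le> C * exp (\<rho> * t)" by simp
qed

lemma pole_in_sphere: "pole \<in> sph"
  by (simp add: pole_def norm_Pair)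

lemma pole_recurrent: "pole \<leadsto> pole"
  using subexponential_reach_pole[OF center_growth(1)[OF subspace_0[OF subspace_lyapunov_sum]]] sgn_pole[of 1]
  by simp

text \<open>The ray through \<open>v\<close> consists of vectors of L(0), each connected with the
  pole in both directions, and on the sphere it converges to (v, 0).\<close>

lemma center_pole:
  assumes v: "v \<in> lyapunov_sum A {0}" "norm v = 1"
  shows "(v, 0) \<leadsto> pole" "pole \<leadsto> (v, 0)"
proof -
  have sph: "(v, 0) \<in> sph" using v(2) by (simp add: norm_Pair)
  have near: "\<exists>k>0. dist (v, 0 :: real) (sgn (k *\<^sub>R v, 1)) < \<delta>" if \<delta>: "\<delta> > 0" for \<delta>
  proof -
    \<comment> \<open>Up to a positive factor (k v, 1) is (v, \<delta>/4), whose projection has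
      distance at most \<delta>/2 from (v, 0).\<close>
    let ?k = "4 / \<delta>"
    have k: "?k > 0" using \<delta> by simp
    have "?k *\<^sub>R (v, \<delta> / 4) = (?k *\<^sub>R v, 1)" using \<delta> by simp
    then have e: "sgn (?k *\<^sub>R v, 1) = sgn (v, \<delta> / 4)" using sgn_pos_scaleR[OF k, of "(v, \<delta> / 4)"] by simp
    have "(v, 0 :: real) \<noteq> 0" using v(2) by (auto simp: zero_prod_def)
    then have "dist (sgn (v, 0)) (sgn (v, \<delta> / 4)) \<le> 2 * norm ((v, 0) - (v, \<delta> / 4)) / norm (v, 0 :: real)"
      by (rule dist_sgn_le)
    then have "dist (v, 0) (sgn (v, \<delta> / 4)) \<le> \<delta> / 2"
      using v(2) sgn_unit[OF sph] \<delta> by (simp add: norm_Pair)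
    then show ?thesis using k \<delta> e by (intro exI[of _ ?k]) auto
  qed
  have kv: "k *\<^sub>R v \<in> lyapunov_sum A {0}" for k using subspace_scale[OF subspace_lyapunov_sum v(1)] .
  show "(v, 0) \<leadsto> pole"
  proof (rule reach_limit_source[OF sph])
    fix \<delta> :: real assume "\<delta> > 0"
    then obtain k where "dist (v, 0 :: real) (sgn (k *\<^sub>R v, 1)) < \<delta>" using near by blast
    then show "\<exists>x'\<in>sph. dist (v, 0) x' < \<delta> \<and> x' \<leadsto> pole"
      using subexponential_reach_pole[OF center_growth(1)[OF kv]] chart_in_sphere by blast
  qed
  show "pole \<leadsto> (v, 0)"
  proof (rule reach_limit_target[OF sph])
    fix \<delta> :: real assume "\<delta> > 0"
    then obtain k where "dist (v, 0 :: real) (sgn (k *\<^sub>R v, 1)) < \<delta>" using near by blast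
    then show "\<exists>y'\<in>sph. dist (v, 0) y' < \<delta> \<and> pole \<leadsto> y'"
      using pole_reach_subexponential[OF center_growth(2)[OF kv]] chart_in_sphere by blast
  qed
qed

section \<open>The central chain control sets\<close>

abbreviation "pole_class \<equiv> chain_class sph dist controls ssol pole"
abbreviation "proj_pole_class \<equiv> chain_class proj_space proj_dist controls (proj_sol A B) (proj pole)"

text \<open>Both halves of the description are settled here. Any competitor contains a line through
  a point of positive height; this point is recurrent on the sphere up to sign, hence chain
  equivalent to the pole.\<close>

lemma central_proj_eq: "central_proj A B U = proj_pole_class"
  unfolding central_proj_def
proof (rule the_equality)
  have rec: "preach (proj pole) (proj pole)" by (rule preach_proj[OF pole_recurrent])
  have "proj pole \<in> proj_pole_class"
    using rec proj_in_space[OF pole_in_sphere] by (simp add: chain_class_def)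
  moreover have "proj pole \<in> proj_space1" unfolding pole_def proj_space1_def by force
  ultimately show "chain_control_set proj_space proj_dist controls (proj_sol A B) proj_pole_class \<and>
      proj_pole_class \<inter> proj_space1 \<noteq> {}"
    using chain_control_set_class[OF rec] by blast
next
  fix E assume E: "chain_control_set proj_space proj_dist controls (proj_sol A B) E \<and> E \<inter> proj_space1 \<noteq> {}"
  then obtain x :: "real^'n" and r where xr: "proj (x, r) \<in> E" "r \<noteq> 0" unfolding proj_space1_def by blast
  define y where "y = (if r > 0 then (x, r) else - (x, r))"
  have y: "proj y = proj (x, r)" "snd y > 0" using xr(2) proj_uminus[of "(x, r)"] by (auto simp: y_def)
  then have "y \<noteq> 0" by auto
  let ?s = "sgn y"
  have s: "?s \<in> sph" "snd ?s > 0" "proj ?s \<in> E"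
    using sgn_in_sphere[OF \<open>y \<noteq> 0\<close>] y xr(1) proj_sgn[OF \<open>y \<noteq> 0\<close>] \<open>y \<noteq> 0\<close> by (auto simp: sgn_div_norm)
  note cls = chain_control_set_eq_class[OF conjunct1[OF E] s(3)]
  have rec: "?s \<leadsto> ?s \<or> ?s \<leadsto> - ?s" by (rule preach_lift[OF cls(1) s(1,1)])
  have "preach (proj ?s) (proj pole)" "preach (proj pole) (proj ?s)"
    by (intro preach_proj recurrent_reach_pole[OF s(1,2) rec] pole_reach_recurrent[OF s(1,2) rec])+
  then have "proj pole \<in> E"
    unfolding cls(2) chain_class_def using proj_in_space[OF pole_in_sphere] by blast
  then show "E = proj_pole_class" by (rule chain_control_set_eq_class(2)[OF conjunct1[OF E]])
qed

text \<open>The signs left open by lifting are repaired by the antipodal symmetry: if y leads to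
  -pole, then -pole leads to -y and -y leads to the pole.\<close>

lemma proj_pole_class_eq: "proj ` pole_class = proj_pole_class"
proof (intro equalityI subsetI)
  fix p assume "p \<in> proj ` pole_class"
  then obtain y where "p = proj y" "y \<in> sph" "pole \<leadsto> y" "y \<leadsto> pole" unfolding chain_class_def by blast
  then show "p \<in> proj_pole_class" unfolding chain_class_def using proj_in_space preach_proj by blast
next
  fix p assume p: "p \<in> proj_pole_class"
  then obtain y0 where y0: "y0 \<in> sph" "p = proj y0" using proj_space_cases unfolding chain_class_def by blast
  have "pole \<leadsto> y0 \<or> pole \<leadsto> - y0"
    using p unfolding chain_class_def y0(2) by (intro preach_lift pole_in_sphere y0(1)) auto
  then obtain y where y: "y \<in> sph" "p = proj y" "pole \<leadsto> y"
    using y0 proj_uminus[of y0] by (metis chain_reach_carrier(2))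
  have "y \<leadsto> pole \<or> y \<leadsto> - pole"
    using p unfolding chain_class_def y(2) by (intro preach_lift pole_in_sphere y(1)) auto
  then have "y \<leadsto> pole"
  proof
    assume 1: "y \<leadsto> - pole"
    have "- pole \<leadsto> - y" using reach_uminus[OF y(3)] .
    moreover have "- y \<leadsto> pole" using reach_uminus[OF 1] by simp
    ultimately show "y \<leadsto> pole" by (rule chain_reach_trans[OF 1 chain_reach_trans])
  qed
  with y show "p \<in> proj ` pole_class" unfolding chain_class_def by blast
qed

lemma pole_class_central: "is_central_chain_control_set A B U pole_class"
  unfolding is_central_chain_control_set_def central_proj_eq proj_pole_class_eq
  using chain_control_set_class[OF pole_recurrent] by blast

end

section \<open>Chain transitive sets on the equator\<close>

abbreviation equator_reach :: "real^'n^'n \<Rightarrow> (real^'n) \<times> real \<Rightarrow> (real^'n) \<times> real \<Rightarrow> bool" where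
  "equator_reach A \<equiv> chain_reach equator dist {()} (\<lambda>t x _. equator_flow A t x)"

lemma norm_Pair_zero: "norm (v, 0 :: real) = norm v"
  by (simp add: norm_Pair)

lemma equator_iff: "x \<in> equator \<longleftrightarrow> norm (fst x) = 1 \<and> snd x = 0"
  by (cases x) (auto simp: equator_def norm_Pair_zero)

lemma equator_flow_eq: "equator_flow A t x = sgn (lflow A t (fst x), 0)"
  by (simp add: equator_flow_def lflow_def)

lemma sgn_equator: "v \<noteq> 0 \<Longrightarrow> sgn (v, 0) \<in> equator"
  by (simp add: equator_iff sgn_div_norm norm_Pair_zero)

lemma compact_equator: "compact equator"
proof -
  have "equator = sphere 0 1 \<inter> {x :: (real^'n) \<times> real. snd x = 0}" by (auto simp: equator_def)
  moreover have "closed {x :: (real^'n) \<times> real. snd x = 0}" by (intro closed_Collect_eq continuous_intros)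
  ultimately show ?thesis by (metis compact_Int_closed compact_sphere)
qed

text \<open>No control acts on the equator, so plain norms of the two spectral components are
  already homogeneous functions with separated rates, for a gap anywhere in the spectrum.\<close>

lemma equator_separation:
  fixes A :: "real^'n^'n" and P :: "real^'n \<Rightarrow> real^'n"
  assumes P: "linear P" "\<forall>x. P (P x) = P x" "\<forall>t x. P (lflow A t x) = lflow A t (P x)"
    and C: "C > 0" "\<forall>t\<ge>0. \<forall>x. norm (lflow A (- t) (P x)) \<le> C * exp (- r2 * t) * norm x"
    and D: "D > 0" "\<forall>t\<ge>0. \<forall>x. norm (lflow A t (x - P x)) \<le> D * exp (r1 * t) * norm x"
    and r: "r1 < r2" and xy: "equator_reach A x y" and \<theta>: "0 < \<theta>" "\<theta> < 1"
    and x: "\<theta> * (norm (P (fst x)) + norm (fst x - P (fst x))) \<le> norm (P (fst x))"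
  shows "\<theta> * (norm (P (fst y)) + norm (fst y - P (fst y))) < norm (P (fst y))"
proof -
  let ?a = "\<lambda>y :: (real^'n) \<times> real. norm (P (fst y))" and ?b = "\<lambda>y :: (real^'n) \<times> real. norm (fst y - P (fst y))"
  have cP: "continuous_on S (\<lambda>y :: (real^'n) \<times> real. P (fst y))" for S
    by (rule linear_continuous_on_compose[OF continuous_on_fst[OF continuous_on_id] P(1)])
  show ?thesis
  proof (rule ratio_separation[where a = ?a and b = ?b and M = equator and V = "{()}"
      and \<Phi> = "\<lambda>t x _. equator_flow A t x" and \<Lambda> = "\<lambda>t x _. (lflow A t (fst x), 0)"
      and p = "- r2" and q = r1 and ?C1.0 = C and ?C2.0 = D, OF _ _ _ _ _ _ _ _ _ _ _ _ _ _ xy \<theta> x])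
    show "continuous_on equator ?a" by (intro continuous_on_norm cP)
    show "continuous_on equator ?b" by (intro continuous_on_norm continuous_on_diff cP continuous_intros)
    show "?a z + ?b z > 0" if z: "z \<in> equator" for z
    proof -
      have "norm (fst z) \<le> ?a z + ?b z" using norm_triangle_ineq[of "P (fst z)" "fst z - P (fst z)"] by simp
      then show ?thesis using z by (simp add: equator_iff)
    qed
    show "equator_flow A T z = sgn (lflow A T (fst z), 0) \<and> (lflow A T (fst z), 0 :: real) \<noteq> 0 \<and> equator_flow A T z \<in> equator"
      if z: "z \<in> equator" for T z
    proof -
      have "fst z \<noteq> 0" using z by (auto simp: equator_iff)
      then have "lflow A T (fst z) \<noteq> 0" by simp
      then show ?thesis using sgn_equator[of "lflow A T (fst z)"] by (auto simp: equator_flow_eq zero_prod_def)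
    qed
    show "?a z \<le> C * exp (- r2 * T) * ?a (lflow A T (fst z), 0)" if T: "T \<ge> 0" for T z
    proof -
      have "norm (lflow A (- T) (P (P (lflow A T (fst z))))) \<le> C * exp (- r2 * T) * norm (P (lflow A T (fst z)))"
        using C(2) T by blast
      moreover have "lflow A (- T) (P (P (lflow A T (fst z)))) = P (fst z)" using P(2,3) by simp
      ultimately show ?thesis by simp
    qed
    show "?b (lflow A T (fst z), 0) \<le> D * exp (r1 * T) * ?b z" if T: "T \<ge> 0" for T z
    proof -
      let ?w = "fst z - P (fst z)"
      have "norm (lflow A T (?w - P ?w)) \<le> D * exp (r1 * T) * norm ?w" using D(2) T by blast
      moreover have "lflow A T (?w - P ?w) = lflow A T (fst z) - P (lflow A T (fst z))"
        using P(2,3) by (simp add: linear_diff[OF P(1)] lflow_simps)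
      ultimately show ?thesis by simp
    qed
    show "?a (c *\<^sub>R z) = c * ?a z" if "c > 0" for c z using that by (simp add: linear_scale[OF P(1)])
    show "?b (c *\<^sub>R z) = c * ?b z" if "c > 0" for c z
    proof -
      have "fst (c *\<^sub>R z) - P (fst (c *\<^sub>R z)) = c *\<^sub>R (fst z - P (fst z))"
        by (simp add: linear_scale[OF P(1)] scaleR_diff_right)
      then show ?thesis using that by simp
    qed
  qed (use compact_equator C(1) D(1) r in auto)
qed

text \<open>A recurrent point cannot have an intermediate ratio of its two components, since that
  ratio would have to rise strictly. A point with ratio 1 cannot reach one with ratio 0, so all
  points of \<open>F\<close> are at the same end.\<close>

lemma equator_dichotomy:
  fixes A :: "real^'n^'n"
  assumes F: "\<forall>x\<in>F. \<forall>y\<in>F. equator_reach A x y"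
  shows "(\<forall>x\<in>F. fst x \<in> lyapunov_sum A {..c}) \<or> (\<forall>x\<in>F. fst x \<in> lyapunov_sum A {c<..})"
proof -
  obtain P :: "real^'n \<Rightarrow> real^'n" where P: "linear P" "\<forall>x. P (P x) = P x"
    "\<forall>t x. P (lflow A t x) = lflow A t (P x)"
    "\<forall>x. P x \<in> lyapunov_sum A {c<..}" "\<forall>x. x - P x \<in> lyapunov_sum A {..c}"
    by (rule spectral_projection[of A c])
  obtain r1 r2 where r: "c < r1" "r1 < r2" "\<forall>l\<in>lyapunov_exponents A. l \<le> c \<or> l > r2"
    by (rule lyapunov_gap[of c A])
  obtain C where C: "C > 0" "\<forall>t\<ge>0. \<forall>x. norm (lflow A (- t) (P x)) \<le> C * exp (- r2 * t) * norm x"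
    using projection_growth(1)[OF P(1) spec[OF P(4)] spec[OF P(5)] r] by (elim exE conjE)
  obtain D where D: "D > 0" "\<forall>t\<ge>0. \<forall>x. norm (lflow A t (x - P x)) \<le> D * exp (r1 * t) * norm x"
    using projection_growth(2)[OF P(1) spec[OF P(4)] spec[OF P(5)] r] by (elim exE conjE)
  note sep = equator_separation[OF P(1-3) C D r(2)]
  let ?a = "\<lambda>x :: (real^'n) \<times> real. norm (P (fst x))" and ?b = "\<lambda>x :: (real^'n) \<times> real. norm (fst x - P (fst x))"
  have ends: "?a x = 0 \<or> ?b x = 0" if x: "x \<in> F" for x
  proof (rule ccontr)
    assume "\<not> ?thesis"
    then have ab: "?a x > 0" "?b x > 0" by auto
    let ?t = "?a x / (?a x + ?b x)"
    have "0 < a / (a + b) \<and> a / (a + b) < 1 \<and> a / (a + b) * (a + b) = a" if "a > 0" "b > 0" for a b :: real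
      using that by (simp add: field_simps)
    from this[OF ab] have t: "0 < ?t" "?t < 1" "?t * (?a x + ?b x) = ?a x" by blast+
    have "equator_reach A x x" using F x by blast
    from sep[OF this t(1,2)] t(3) show False by simp
  qed
  have "?a x = 0" if xy: "x \<in> F" "y \<in> F" "?a y = 0" for x y
  proof (rule ccontr)
    assume "?a x \<noteq> 0"
    then have "?b x = 0" using ends[OF xy(1)] by blast
    have "equator_reach A x y" using F xy by blast
    \<comment> \<open>Any level strictly between 0 and 1 separates the two ends.\<close>
    from sep[OF this, of "1 / 2"] \<open>?b x = 0\<close> xy(3) show False by simp
  qed
  then consider "\<forall>x\<in>F. ?a x = 0" | "\<forall>x\<in>F. ?b x = 0" using ends by blast
  then show ?thesis
  proof cases
    case 1
    have "fst x \<in> lyapunov_sum A {..c}" if "x \<in> F" for x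
      using 1 that spec[OF P(5), of "fst x"] by simp
    then show ?thesis by blast
  next
    case 2
    have "fst x \<in> lyapunov_sum A {c<..}" if "x \<in> F" for x
      using 2 that spec[OF P(4), of "fst x"] by simp
    then show ?thesis by blast
  qed
qed

lemma lyapunov_sum_split:
  assumes "x \<in> lyapunov_sum A (insert m S)" "\<forall>l\<in>S. l > m"
  shows "x \<in> lyapunov_sum A {..m} \<Longrightarrow> x \<in> lyapunov_sum A {m}"
    "x \<in> lyapunov_sum A {m<..} \<Longrightarrow> x \<in> lyapunov_sum A S"
proof -
  have "x \<in> lyapunov_sum A ({m} \<union> S)" using assms(1) by simp
  then obtain y z where yz: "x = y + z" "y \<in> lyapunov_sum A {m}" "z \<in> lyapunov_sum A S"
    unfolding lyapunov_sum_Un by blast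
  have y: "y \<in> lyapunov_sum A {..m}" using lyapunov_sum_mono[of "{m}" A "{..m}"] yz(2) by auto
  have z: "z \<in> lyapunov_sum A {m<..}" using lyapunov_sum_mono[of S A "{m<..}"] yz(3) assms(2) by auto
  show "x \<in> lyapunov_sum A {m}" if "x \<in> lyapunov_sum A {..m}"
  proof -
    have "z \<in> lyapunov_sum A {..m}" using subspace_diff[OF subspace_lyapunov_sum that y] yz(1) by simp
    then have "z = 0" using lyapunov_sum_disjoint z by blast
    then show ?thesis using yz by simp
  qed
  show "x \<in> lyapunov_sum A S" if "x \<in> lyapunov_sum A {m<..}"
  proof -
    have "y \<in> lyapunov_sum A {m<..}" using subspace_diff[OF subspace_lyapunov_sum that z] yz(1) by simp
    then have "y = 0" using lyapunov_sum_disjoint y by blast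
    then show ?thesis using yz by simp
  qed
qed

text \<open>The dichotomy at the smallest remaining exponent either settles the matter or removes
  that exponent. The set of exponents cannot become empty because the vectors are nonzero.\<close>

lemma equator_single_exponent:
  fixes A :: "real^'n^'n"
  assumes F: "\<forall>x\<in>F. \<forall>y\<in>F. equator_reach A x y" "F \<noteq> {}" "F \<subseteq> equator"
  shows "\<exists>lam\<in>lyapunov_exponents A. \<forall>x\<in>F. fst x \<in> lyapunov_space A lam"
proof -
  have "\<exists>lam\<in>S. \<forall>x\<in>F. fst x \<in> lyapunov_sum A {lam}"
    if "finite S" "\<forall>x\<in>F. fst x \<in> lyapunov_sum A S" for S
    using that
  proof (induction S rule: finite_psubset_induct)
    case (psubset S)
    obtain x0 where x0: "x0 \<in> F" using F(2) by blast
    then have "fst x0 \<noteq> 0" using F(3) by (auto simp: equator_iff)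
    then have "S \<noteq> {}" using psubset.prems x0 by (auto simp: lyapunov_sum_def)
    define m where "m = Min S"
    have m: "m \<in> S" "\<forall>l\<in>S - {m}. l > m"
      using Min_in[OF psubset.hyps \<open>S \<noteq> {}\<close>] Min_le[OF psubset.hyps] by (force simp: m_def)+
    have split: "fst x \<in> lyapunov_sum A (insert m (S - {m}))" if "x \<in> F" for x
      using psubset.prems that m(1) by (simp add: insert_absorb)
    from equator_dichotomy[OF F(1), of m] show ?case
    proof
      assume "\<forall>x\<in>F. fst x \<in> lyapunov_sum A {..m}"
      then show ?thesis using lyapunov_sum_split(1)[OF split m(2)] m(1) by blast
    next
      assume "\<forall>x\<in>F. fst x \<in> lyapunov_sum A {m<..}"
      then have "\<forall>x\<in>F. fst x \<in> lyapunov_sum A (S - {m})" using lyapunov_sum_split(2)[OF split m(2)] by blast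
      then show ?thesis using psubset.IH[of "S - {m}"] m(1) by blast
    qed
  qed
  moreover have "\<forall>x\<in>F. fst x \<in> lyapunov_sum A (lyapunov_exponents A)"
    using lyapunov_sum_mono[of UNIV A "lyapunov_exponents A"] lyapunov_sum_UNIV[of A] by auto
  ultimately show ?thesis using finite_lyapunov_exponents[of A] by (simp add: lyapunov_sum_singleton)
qed

section \<open>Limit sets\<close>

definition equator_proj :: "(real^'n) \<times> real \<Rightarrow> (real^'n) \<times> real" where
  "equator_proj s = sgn (fst s, 0)"

lemma equator_proj_in_equator:
  assumes "s \<in> sphere 0 1" "\<bar>snd s\<bar> < 1"
  shows "equator_proj s \<in> equator"
proof -
  have "norm s \<le> norm (fst s) + norm (snd s)" using norm_Pair_le[of "fst s" "snd s"] by simp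
  then have "fst s \<noteq> 0" using assms by auto
  then show ?thesis unfolding equator_proj_def by (rule sgn_equator)
qed

lemma dist_sgn_zero_height:
  fixes v w :: "real^'n"
  assumes "v \<noteq> 0"
  shows "dist (sgn (v, 0 :: real)) (sgn (w, 0)) \<le> 2 * norm (v - w) / norm v"
proof -
  have "(v, 0 :: real) \<noteq> 0" using assms by (simp add: zero_prod_def)
  from dist_sgn_le[OF this, of "(w, 0)"] show ?thesis by (simp add: norm_Pair)
qed

lemma norm_quotient_le:
  fixes a b K C :: real
  assumes "b > 0" "1 \<le> K * b" "a \<ge> 0"
  shows "a / b \<le> K * a"
  using mult_right_mono[OF assms(2,3)] assms(1) by (simp add: divide_le_eq mult_ac)

context poincare_system
begin

lemma fst_sphere_ge_half:
  assumes "s \<in> sph" "\<bar>snd s\<bar> \<le> 1 / 2"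
  shows "norm (fst s) \<ge> 1 / 2"
proof -
  have "norm s \<le> norm (fst s) + norm (snd s)" using norm_Pair_le[of "fst s" "snd s"] by simp
  then show ?thesis using assms by simp
qed

text \<open>The control displaces the state by a multiple of the height, so near the equator the
  vertical projection of a trajectory almost follows the equator flow. The constant depends only on
  the bound \<open>T0\<close> for the time.\<close>

lemma equator_flow_near:
  assumes "T0 \<ge> 0"
  shows "\<exists>K>0. \<forall>T\<in>{0..T0}. \<forall>u\<in>controls. \<forall>s\<in>sph. \<bar>snd s\<bar> \<le> 1 / 2 \<longrightarrow>
    dist (equator_flow A T (equator_proj s)) (equator_proj (ssol T s u)) \<le> K * \<bar>snd s\<bar> \<and>
    (\<forall>x\<in>equator. dist (equator_flow A T x) (equator_flow A T (equator_proj s)) \<le> K * dist x s \<and>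
       dist x (equator_proj s) \<le> K * dist x s)"
proof -
  obtain C where C: "C \<ge> 1" "\<forall>t x. \<bar>t\<bar> \<le> T0 \<longrightarrow> norm (lflow A t x) \<le> C * norm x"
    using lflow_norm_bound[OF assms, of A] by blast
  obtain D where D: "D \<ge> 0" "\<forall>t\<in>{0..T0}. \<forall>u\<in>controls. norm (drive A B u t) \<le> D"
    using drive_bound[OF assms] by blast
  \<comment> \<open>A factor 2 from \<open>dist_sgn_le\<close>, 2C from dividing by a norm that is
    at least 1/(2C), and C(D + 1) for the control term; the other two estimates need only 2C^2 and
    2.\<close>
  define K where "K = 4 * C * C * (D + 1)"
  have C2: "C * C \<ge> 1" using mult_mono[of 1 C 1 C] C(1) by simp
  have K1: "K \<ge> 2" "2 * C * C \<le> K"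
    using mult_mono[of 1 "C * C" 1 "D + 1"] mult_mono[of "C * C" "C * C" 1 "D + 1"] C2 C(1) D(1)
    by (auto simp: K_def mult.assoc)
  have main: "dist (equator_flow A T (equator_proj s)) (equator_proj (ssol T s u)) \<le> K * \<bar>snd s\<bar>"
    "x \<in> equator \<Longrightarrow> dist (equator_flow A T x) (equator_flow A T (equator_proj s)) \<le> K * dist x s"
    "x \<in> equator \<Longrightarrow> dist x (equator_proj s) \<le> K * dist x s"
    if T: "T \<in> {0..T0}" and u: "u \<in> controls" and s: "s \<in> sph" "\<bar>snd s\<bar> \<le> 1 / 2"
    for T u s and x :: "(real^'n) \<times> real"
  proof -
    have half: "norm (fst s) \<ge> 1 / 2" by (rule fst_sphere_ge_half[OF s])
    have recov: "norm y \<le> C * norm (lflow A T y)" for y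
      using C(2)[rule_format, of "- T" "lflow A T y"] T by simp
    have flow_s: "equator_flow A T (equator_proj s) = sgn (lflow A T (fst s), 0)"
    proof -
      have "lflow A T (fst (sgn (fst s, 0 :: real))) = inverse (norm (fst s)) *\<^sub>R lflow A T (fst s)"
        by (simp add: sgn_div_norm norm_Pair lflow_simps)
      then have "equator_flow A T (equator_proj s) = sgn (inverse (norm (fst s)) *\<^sub>R (lflow A T (fst s), 0))"
        by (simp add: equator_flow_eq equator_proj_def)
      also have "\<dots> = sgn (lflow A T (fst s), 0)" using half by (intro sgn_pos_scaleR) auto
      finally show ?thesis .
    qed
    have sol: "equator_proj (ssol T s u) = sgn (lflow A T (fst s + snd s *\<^sub>R drive A B u T), 0)"
    proof -
      have nz: "lsol T s u \<noteq> 0" using s(1) by (intro lsol_nonzero[OF u]) auto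
      have "(fst (ssol T s u), 0) = inverse (norm (lsol T s u)) *\<^sub>R (fst (lsol T s u), 0 :: real)"
        by (simp add: sphere_sol_def sgn_div_norm)
      then have "equator_proj (ssol T s u) = sgn (fst (lsol T s u), 0)"
        using nz by (simp only: equator_proj_def) (intro sgn_pos_scaleR, simp)
      then show ?thesis by (simp add: lift_sol_eq[OF u])
    qed
    have nz: "lflow A T (fst s) \<noteq> 0" using half by auto
    have low: "1 \<le> (2 * C) * norm (lflow A T (fst s))" using recov[of "fst s"] half by linarith
    have "dist (equator_flow A T (equator_proj s)) (equator_proj (ssol T s u))
        \<le> 2 * norm (lflow A T (fst s) - lflow A T (fst s + snd s *\<^sub>R drive A B u T)) / norm (lflow A T (fst s))"
      unfolding flow_s sol by (rule dist_sgn_zero_height[OF nz])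
    also have "\<dots> \<le> (2 * C) * (2 * norm (lflow A T (fst s) - lflow A T (fst s + snd s *\<^sub>R drive A B u T)))"
      using nz low by (intro norm_quotient_le) auto
    also have "norm (lflow A T (fst s) - lflow A T (fst s + snd s *\<^sub>R drive A B u T)) = \<bar>snd s\<bar> * norm (lflow A T (drive A B u T))"
      by (simp add: lflow_simps)
    also have "(2 * C) * (2 * (\<bar>snd s\<bar> * norm (lflow A T (drive A B u T)))) \<le> (2 * C) * (2 * (\<bar>snd s\<bar> * (C * (D + 1))))"
    proof -
      have "norm (lflow A T (drive A B u T)) \<le> C * norm (drive A B u T)" using C(2) T by simp
      also have "\<dots> \<le> C * (D + 1)" using D(2)[rule_format, OF T u] C(1) by (intro mult_left_mono) auto
      finally show ?thesis using C(1) by (intro mult_left_mono) auto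
    qed
    also have "\<dots> = K * \<bar>snd s\<bar>" by (simp add: K_def mult_ac)
    finally show "dist (equator_flow A T (equator_proj s)) (equator_proj (ssol T s u)) \<le> K * \<bar>snd s\<bar>" .
    assume x: "x \<in> equator"
    have nx: "norm (fst x) = 1" "x = (fst x, 0)" using x by (auto simp: equator_iff prod_eq_iff)
    have fx: "norm (fst x - fst s) \<le> dist x s" using norm_fst_le'[of "x - s"] by (simp add: dist_norm)
    have nzx: "lflow A T (fst x) \<noteq> 0" "fst x \<noteq> 0" using nx by auto
    have "dist (equator_flow A T x) (equator_flow A T (equator_proj s))
        \<le> 2 * norm (lflow A T (fst x) - lflow A T (fst s)) / norm (lflow A T (fst x))"
      unfolding flow_s equator_flow_eq[of A T x] by (rule dist_sgn_zero_height[OF nzx(1)])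
    also have "\<dots> \<le> C * (2 * norm (lflow A T (fst x) - lflow A T (fst s)))"
      using nzx recov[of "fst x"] nx by (intro norm_quotient_le) auto
    also have "\<dots> \<le> C * (2 * (C * dist x s))"
    proof -
      have "norm (lflow A T (fst x - fst s)) \<le> C * norm (fst x - fst s)" using C(2) T by simp
      also have "\<dots> \<le> C * dist x s" using fx C(1) by (intro mult_left_mono) auto
      finally show ?thesis using C(1) by (intro mult_left_mono) (auto simp: lflow_simps)
    qed
    also have "\<dots> = (2 * C * C) * dist x s" by simp
    also have "\<dots> \<le> K * dist x s" using K1 by (intro mult_right_mono) auto
    finally show "dist (equator_flow A T x) (equator_flow A T (equator_proj s)) \<le> K * dist x s" .
    have "sgn x = x" using x by (intro sgn_unit) (simp add: equator_def)
    then have "x = sgn (fst x, 0)" by (simp only: nx(2)[symmetric])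
    then have "dist x (equator_proj s) \<le> 2 * norm (fst x - fst s) / norm (fst x)"
      using dist_sgn_zero_height[OF nzx(2), of "fst s"] unfolding equator_proj_def by simp
    also have "\<dots> \<le> 2 * dist x s" using fx nx by simp
    also have "\<dots> \<le> K * dist x s" using K1 by (intro mult_right_mono) auto
    finally show "dist x (equator_proj s) \<le> K * dist x s" .
  qed
  show ?thesis using K1(1) main by (intro exI[of _ K]) auto
qed

end

text \<open>What the argument for limit sets needs to know about the direction of time.\<close>

definition time_end :: "real filter \<Rightarrow> bool" where
  "time_end F \<longleftrightarrow>
     (\<forall>P. frequently P F \<longrightarrow> (\<exists>t :: nat \<Rightarrow> real. filterlim t F sequentially \<and> (\<forall>k. P (t k)))) \<and>
     (\<forall>Q R S D. eventually Q F \<longrightarrow> frequently R F \<longrightarrow> frequently S F \<longrightarrow>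
        (\<exists>t1 t2. t2 \<ge> t1 + D \<and> R t1 \<and> S t2 \<and> (\<forall>t\<in>{t1..t2}. Q t)))"

lemma time_end_at_top: "time_end at_top"
  unfolding time_end_def
proof (intro conjI allI impI)
  fix P :: "real \<Rightarrow> bool" assume "frequently P at_top"
  then have "\<forall>k. \<exists>t. t > real k \<and> P t"
    unfolding frequently_def eventually_at_top_dense by blast
  then obtain t where t: "\<And>k. t k > real k" "\<And>k. P (t k)" by metis
  have "filterlim t at_top sequentially"
    by (rule filterlim_at_top_mono[OF filterlim_real_sequentially always_eventually]) (use t(1) less_imp_le in blast)
  with t(2) show "\<exists>t :: nat \<Rightarrow> real. filterlim t at_top sequentially \<and> (\<forall>k. P (t k))" by blast
next
  fix Q R S :: "real \<Rightarrow> bool" and D :: real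
  assume "eventually Q at_top" and R: "frequently R at_top" and S: "frequently S at_top"
  then obtain T where T: "\<And>t. t \<ge> T \<Longrightarrow> Q t" by (auto simp: eventually_at_top_linorder)
  obtain t1 where t1: "t1 > T" "R t1" using R unfolding frequently_def eventually_at_top_dense by blast
  obtain t2 where t2: "t2 > t1 + D" "S t2" using S unfolding frequently_def eventually_at_top_dense by blast
  show "\<exists>t1 t2. t2 \<ge> t1 + D \<and> R t1 \<and> S t2 \<and> (\<forall>t\<in>{t1..t2}. Q t)"
    using t1 t2 T by (intro exI[of _ t1] exI[of _ t2]) auto
qed

lemma time_end_at_bot: "time_end at_bot"
  unfolding time_end_def
proof (intro conjI allI impI)
  fix P :: "real \<Rightarrow> bool" assume "frequently P at_bot"
  then have "\<forall>k. \<exists>t. t < - real k \<and> P t"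
    unfolding frequently_def eventually_at_bot_dense by blast
  then obtain t where t: "\<And>k. t k < - real k" "\<And>k. P (t k)" by metis
  have "real k \<le> - t k" for k using t(1)[of k] by linarith
  then have "filterlim (\<lambda>k. - t k) at_top sequentially"
    by (intro filterlim_at_top_mono[OF filterlim_real_sequentially always_eventually]) blast
  then have "filterlim t at_bot sequentially" by (simp add: filterlim_uminus_at_bot)
  with t(2) show "\<exists>t :: nat \<Rightarrow> real. filterlim t at_bot sequentially \<and> (\<forall>k. P (t k))" by blast
next
  fix Q R S :: "real \<Rightarrow> bool" and D :: real
  assume "eventually Q at_bot" and R: "frequently R at_bot" and S: "frequently S at_bot"
  then obtain T where T: "\<And>t. t \<le> T \<Longrightarrow> Q t" by (auto simp: eventually_at_bot_linorder)
  obtain t2 where t2: "t2 < T" "S t2" using S unfolding frequently_def eventually_at_bot_dense by blast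
  obtain t1 where t1: "t1 < t2 - D" "R t1" using R unfolding frequently_def eventually_at_bot_dense by blast
  show "\<exists>t1 t2. t2 \<ge> t1 + D \<and> R t1 \<and> S t2 \<and> (\<forall>t\<in>{t1..t2}. Q t)"
    using t1 t2 T by (intro exI[of _ t1] exI[of _ t2]) auto
qed

lemma time_end_sequence:
  assumes "time_end F" "frequently P F"
  shows "\<exists>t :: nat \<Rightarrow> real. filterlim t F sequentially \<and> (\<forall>k. P (t k))"
  using conjunct1[OF assms(1)[unfolded time_end_def]] assms(2) by simp

lemma time_endD:
  assumes "time_end F" "eventually Q F" "frequently R F" "frequently S F"
  shows "\<exists>t1 t2. t2 \<ge> t1 + D \<and> R t1 \<and> S t2 \<and> (\<forall>t\<in>{t1..t2}. Q t)"
  using conjunct2[OF assms(1)[unfolded time_end_def]] assms(2-4) by simp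

definition limit_points :: "real filter \<Rightarrow> (real \<Rightarrow> 'a::metric_space) \<Rightarrow> 'a set" where
  "limit_points F s = {x. \<exists>t :: nat \<Rightarrow> real. filterlim t F sequentially \<and> (\<lambda>k. s (t k)) \<longlonglongrightarrow> x}"

lemma limit_points_frequently:
  assumes "x \<in> limit_points F s" "\<delta> > 0"
  shows "frequently (\<lambda>t. dist x (s t) < \<delta>) F"
  unfolding frequently_def
proof
  assume ev: "eventually (\<lambda>t. \<not> dist x (s t) < \<delta>) F"
  obtain t where t: "filterlim t F sequentially" "(\<lambda>k. s (t k)) \<longlonglongrightarrow> x"
    using assms(1) unfolding limit_points_def by blast
  have "eventually (\<lambda>k. \<not> dist x (s (t k)) < \<delta>) sequentially"
    using t(1) ev unfolding filterlim_iff by blast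
  moreover have "eventually (\<lambda>k. dist x (s (t k)) < \<delta>) sequentially"
    using tendstoD[OF t(2) assms(2)] by (simp add: dist_commute)
  ultimately have "eventually (\<lambda>k. False) sequentially" by eventually_elim simp
  then show False by simp
qed

context poincare_system
begin

text \<open>The piece of the trajectory between visits near \<open>x\<close> and near
  \<open>y\<close> is cut into equal parts, and the cutting points are projected vertically to the
  equator. Small height makes each part an admissible segment of the equator flow.\<close>

lemma equator_chain_of_trajectory:
  assumes F: "time_end F" and s0: "s0 \<in> sph" and u: "u \<in> controls"
    and height: "\<And>\<eta>. \<eta> > 0 \<Longrightarrow> eventually (\<lambda>t. \<bar>snd (ssol t s0 u)\<bar> < \<eta>) F"
    and x: "x \<in> limit_points F (\<lambda>t. ssol t s0 u)" "x \<in> equator"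
    and y: "y \<in> limit_points F (\<lambda>t. ssol t s0 u)" "y \<in> equator"
  shows "equator_reach A x y"
  unfolding chain_reach_def
proof (intro allI impI)
  fix \<epsilon> \<tau> :: real assume e: "\<epsilon> > 0" "\<tau> > 0"
  let ?s = "\<lambda>t. ssol t s0 u"
  let ?st = "chain_step equator dist {()} (\<lambda>t x _. equator_flow A t x) \<epsilon> \<tau>"
  have nz: "s0 \<noteq> 0" using s0 by auto
  have sS: "?s t \<in> sph" for t by (rule invariant[OF s0 u])
  have "2 * \<tau> \<ge> 0" using e by simp
  from equator_flow_near[OF this] obtain K where K: "K > 0" and
    near: "\<forall>T\<in>{0..2 * \<tau>}. \<forall>u\<in>controls. \<forall>s\<in>sph. \<bar>snd s\<bar> \<le> 1 / 2 \<longrightarrow>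
      dist (equator_flow A T (equator_proj s)) (equator_proj (ssol T s u)) \<le> K * \<bar>snd s\<bar> \<and>
      (\<forall>x\<in>equator. dist (equator_flow A T x) (equator_flow A T (equator_proj s)) \<le> K * dist x s \<and>
         dist x (equator_proj s) \<le> K * dist x s)"
    by (elim exE conjE)
  define \<eta> where "\<eta> = min (1 / 2) (\<epsilon> / (2 * K))"
  have \<eta>: "\<eta> > 0" "\<eta> \<le> 1 / 2" "K * \<eta> \<le> \<epsilon> / 2"
  proof -
    show "\<eta> > 0" "\<eta> \<le> 1 / 2" using e K by (auto simp: \<eta>_def)
    have "K * \<eta> \<le> K * (\<epsilon> / (2 * K))" using K by (intro mult_left_mono) (auto simp: \<eta>_def)
    then show "K * \<eta> \<le> \<epsilon> / 2" using K by simp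
  qed
  have small: "K * r < \<epsilon> / 2" if "r < \<eta>" for r
    using mult_strict_left_mono[OF that K] \<eta>(3) by linarith
  have "\<exists>t1 t2. t2 \<ge> t1 + 2 * \<tau> \<and> dist x (?s t1) < \<eta> \<and> dist y (?s t2) < \<eta> \<and>
      (\<forall>t\<in>{t1..t2}. \<bar>snd (?s t)\<bar> < \<eta>)"
    by (rule time_endD[OF F height[OF \<eta>(1)] limit_points_frequently[OF x(1) \<eta>(1)] limit_points_frequently[OF y(1) \<eta>(1)]])
  then obtain t1 t2 where t: "t2 \<ge> t1 + 2 * \<tau>" "dist x (?s t1) < \<eta>" "dist y (?s t2) < \<eta>"
    "\<forall>t\<in>{t1..t2}. \<bar>snd (?s t)\<bar> < \<eta>"
    by (elim exE conjE)
  \<comment> \<open>Rounding down makes the common duration at least \<tau>, and at most 2\<tau>,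
    the range in which \<open>K\<close> is valid. N \<ge> 2 keeps the corrections at
    \<open>x\<close> and at \<open>y\<close> in different segments, each with \<epsilon>/2 to
    spare.\<close>
  define N where "N = nat \<lfloor>(t2 - t1) / \<tau>\<rfloor>"
  have q: "(t2 - t1) / \<tau> \<ge> 2" using t(1) e by (simp add: field_simps)
  then have "real N = of_int \<lfloor>(t2 - t1) / \<tau>\<rfloor>" by (simp add: N_def)
  then have N12: "real N \<le> (t2 - t1) / \<tau>" "(t2 - t1) / \<tau> < real N + 1" by linarith+
  then have "real N > 1" using q by linarith
  then have N: "real N \<le> (t2 - t1) / \<tau>" "(t2 - t1) / \<tau> < real N + 1" "N \<ge> 2" using N12 by auto
  define T where "T = (t2 - t1) / real N"
  have T: "T \<ge> \<tau>" "T \<le> 2 * \<tau>" "t1 + real N * T = t2"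
  proof -
    have Np: "real N > 0" using N(3) by simp
    show "T \<ge> \<tau>" using N(1) Np e by (simp add: T_def field_simps)
    have "t2 - t1 < (real N + 1) * \<tau>" using N(2) e by (simp add: field_simps)
    also have "\<dots> \<le> (2 * \<tau>) * real N" using N(3) e by (simp add: algebra_simps)
    finally show "T \<le> 2 * \<tau>" using Np by (simp add: T_def field_simps)
    show "t1 + real N * T = t2" using Np by (simp add: T_def)
  qed
  have T0: "T \<in> {0..2 * \<tau>}" using T e by simp
  let ?t = "\<lambda>i::nat. t1 + real i * T"
  let ?p = "\<lambda>i. equator_proj (?s (?t i))"
  have h: "\<bar>snd (?s (?t i))\<bar> < \<eta>" if "i \<le> N" for i
  proof (rule t(4)[rule_format])
    have "real i * T \<le> real N * T" using that T e by (intro mult_right_mono) auto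
    moreover have "0 \<le> real i * T" using T e by simp
    ultimately show "?t i \<in> {t1..t2}" using T(3) by simp
  qed
  have pE: "?p i \<in> equator" if "i \<le> N" for i
    by (rule equator_proj_in_equator[OF sS]) (use h[OF that] \<eta>(2) in linarith)
  have follow: "dist (equator_flow A T (?p i)) (?p (Suc i)) < \<epsilon> / 2" if i: "i \<le> N" for i
  proof -
    have "?s (?t (Suc i)) = ?s (?t i + T)" by (simp add: algebra_simps)
    also have "\<dots> = ssol T (?s (?t i)) (\<lambda>\<sigma>. u (?t i + \<sigma>))"
      using T0 by (intro ssol_cocycle[OF u _ nz]) simp
    finally have "dist (equator_flow A T (?p i)) (?p (Suc i)) \<le> K * \<bar>snd (?s (?t i))\<bar>"
      using near[rule_format, OF T0 shift_control[OF u, of "?t i"] sS[of "?t i"]] h[OF i] \<eta>(2) by simp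
    then show ?thesis using small[OF h[OF i]] by linarith
  qed
  have step: "?st a b" if "a \<in> equator" "b \<in> equator" "dist (equator_flow A T a) b < \<epsilon>" for a b
    unfolding chain_step_def using that T(1) by blast
  have first: "?st x (?p 1)"
  proof (rule step[OF x(2) pE])
    have "dist (equator_flow A T x) (equator_flow A T (?p 0)) \<le> K * dist x (?s t1)"
      using near[rule_format, OF T0 u sS[of t1]] h[of 0] \<eta>(2) x(2) by simp
    then have "dist (equator_flow A T x) (equator_flow A T (?p 0)) < \<epsilon> / 2"
      using small[OF t(2)] by linarith
    with follow[of 0] show "dist (equator_flow A T x) (?p 1) < \<epsilon>"
      using dist_triangle[of "equator_flow A T x" "?p 1" "equator_flow A T (?p 0)"] by simp
  qed (use N(3) in simp)
  have "?st\<^sup>*\<^sup>* (?p 1) (?p (Suc i))" if "Suc i < N" for i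
    using that
  proof (induction i)
    case (Suc i)
    have "?st (?p (Suc i)) (?p (Suc (Suc i)))"
      using follow[of "Suc i"] Suc.prems e(1) by (intro step pE) auto
    moreover have "?st\<^sup>*\<^sup>* (?p 1) (?p (Suc i))" using Suc.IH Suc.prems by simp
    ultimately show ?case by (rule rtranclp.rtrancl_into_rtrancl[rotated])
  qed simp
  from this[of "N - 2"] have middle: "?st\<^sup>*\<^sup>* (?p 1) (?p (Suc (N - 2)))" using N(3) by simp
  have last: "?st (?p (Suc (N - 2))) y"
  proof (rule step[OF pE y(2)])
    have N': "Suc (Suc (N - 2)) = N" using N(3) by simp
    have "dist y (?p N) \<le> K * dist y (?s t2)"
      using near[rule_format, OF T0 u sS[of t2]] h[of N] \<eta>(2) y(2) T(3) by simp
    then have "dist y (?p N) < \<epsilon> / 2" using small[OF t(3)] by linarith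
    moreover have "dist (equator_flow A T (?p (Suc (N - 2)))) (?p N) < \<epsilon> / 2"
      using follow[of "Suc (N - 2)"] N(3) unfolding N' by linarith
    ultimately show "dist (equator_flow A T (?p (Suc (N - 2)))) y < \<epsilon>"
      using dist_triangle2[of "equator_flow A T (?p (Suc (N - 2)))" y "?p N"] by linarith
  qed (use N(3) in simp)
  show "?st\<^sup>+\<^sup>+ x y"
    by (rule rtranclp_into_tranclp1[OF converse_rtranclp_into_rtranclp[where r = ?st, OF first middle] last])
qed

lemma limit_points_in_component:
  assumes F: "time_end F" and s0: "s0 \<in> sph" "snd s0 > 0" and u: "u \<in> controls"
  defines "L \<equiv> limit_points F (\<lambda>t. ssol t s0 u)"
  shows "L \<subseteq> pole_class \<or>
    (\<exists>lam E. lam \<in> lyapunov_exponents A \<and> lam \<noteq> 0 \<and> is_lyapunov_component A lam E \<and> L \<subseteq> E)"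
proof -
  let ?s = "\<lambda>t. ssol t s0 u"
  have nz: "s0 \<noteq> 0" using s0(1) by auto
  have sS: "?s t \<in> sph" for t by (rule invariant[OF s0(1) u])
  have LS: "x \<in> sph" if xL: "x \<in> L" for x
  proof -
    obtain t where t: "(\<lambda>k. ?s (t k)) \<longlonglongrightarrow> x" using xL unfolding L_def limit_points_def by blast
    show ?thesis by (rule closed_sequentially[OF closed_sphere sS t])
  qed
  \<comment> \<open>The lifted height is constant and positive, so the trajectory stays in the upper
    hemisphere.\<close>
  have LP: "snd x \<ge> 0" if xL: "x \<in> L" for x
  proof -
    obtain t where "(\<lambda>k. ?s (t k)) \<longlonglongrightarrow> x" using xL unfolding L_def limit_points_def by blast
    then have "(\<lambda>k. snd (?s (t k))) \<longlonglongrightarrow> snd x" by (rule tendsto_snd)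
    moreover have "snd (?s t) \<ge> 0" for t
      using s0(2) by (simp add: sphere_sol_def sgn_div_norm lift_sol_eq[OF u])
    ultimately show ?thesis by (intro LIMSEQ_le_const) auto
  qed
  have reach: "x \<leadsto> y" if x: "x \<in> L" and y: "y \<in> L" for x y
  proof (rule reach_along_trajectory[of ?s, OF sS _ LS[OF x] LS[OF y]])
    fix t1
    show "\<exists>w\<in>controls. \<forall>t\<ge>0. ?s (t1 + t) = ssol t (?s t1) w"
      using ssol_cocycle[OF u _ nz] shift_control[OF u, of t1] by blast
  next
    fix \<delta> D :: real assume "\<delta> > 0"
    note freq = limit_points_frequently[OF x[unfolded L_def] this] limit_points_frequently[OF y[unfolded L_def] this]
    have "\<exists>t1 t2. t2 \<ge> t1 + D \<and> dist x (?s t1) < \<delta> \<and> dist y (?s t2) < \<delta> \<and> (\<forall>t\<in>{t1..t2}. True)"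
      by (rule time_endD[OF F _ freq]) simp
    then show "\<exists>t1 t2. t2 \<ge> t1 + D \<and> dist x (?s t1) < \<delta> \<and> dist y (?s t2) < \<delta>" by simp
  qed
  show ?thesis
  proof (cases "\<exists>x\<in>L. snd x \<noteq> 0")
    case True
    then obtain x where x: "x \<in> L" "snd x > 0" using LP by fastforce
    have "x \<leadsto> pole" "pole \<leadsto> x"
      using recurrent_reach_pole[OF LS[OF x(1)] x(2)] pole_reach_recurrent[OF LS[OF x(1)] x(2)] reach[OF x(1) x(1)]
      by blast+
    then have "y \<in> pole_class" if "y \<in> L" for y
      unfolding chain_class_def
      using chain_reach_trans[OF _ reach[OF x(1) that]] chain_reach_trans[OF reach[OF that x(1)]] LS[OF that] by simp
    then have "L \<subseteq> pole_class" by (rule subsetI)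
    then show ?thesis ..
  next
    case False
    then have L0: "L \<subseteq> equator" using LS by (auto simp: equator_def)
    \<comment> \<open>Otherwise heights at least \<eta> recur along a sequence of times, and by
      compactness a subsequence converges to a limit point off the equator.\<close>
    have height: "eventually (\<lambda>t. \<bar>snd (?s t)\<bar> < \<eta>) F" if \<eta>: "\<eta> > 0" for \<eta>
    proof (rule ccontr)
      assume "\<not> ?thesis"
      then have "frequently (\<lambda>t. \<not> \<bar>snd (?s t)\<bar> < \<eta>) F" unfolding frequently_def not_not .
      from time_end_sequence[OF F this] obtain t :: "nat \<Rightarrow> real" where t: "filterlim t F sequentially" "\<forall>k. \<not> \<bar>snd (?s (t k))\<bar> < \<eta>"
        by (elim exE conjE)
      have "\<exists>l\<in>sph. \<exists>r :: nat \<Rightarrow> nat. strict_mono r \<and> ((\<lambda>k. ?s (t k)) \<circ> r) \<longlonglongrightarrow> l"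
        by (rule compact_sphere[unfolded compact_def, rule_format]) (rule sS)
      then obtain l r where lr: "l \<in> sph" "strict_mono (r :: nat \<Rightarrow> nat)" "((\<lambda>k. ?s (t k)) \<circ> r) \<longlonglongrightarrow> l"
        by (elim bexE exE conjE)
      have "filterlim (t \<circ> r) F sequentially"
        using filterlim_compose[OF t(1) filterlim_subseq[OF lr(2)]] by (simp add: o_def)
      then have "l \<in> L" using lr(3) unfolding L_def limit_points_def by (auto simp: o_def)
      then have "snd l = 0" using False by blast
      moreover have "(\<lambda>k. \<bar>snd (?s (t (r k)))\<bar>) \<longlonglongrightarrow> \<bar>snd l\<bar>"
        using tendsto_rabs[OF tendsto_snd[OF lr(3)]] by (simp add: o_def)
      then have "\<bar>snd l\<bar> \<ge> \<eta>" by (rule LIMSEQ_le_const) (use t(2) not_less in auto)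
      ultimately show False using \<eta> by simp
    qed
    have ereach: "equator_reach A x y" if x: "x \<in> L" and y: "y \<in> L" for x y
      by (rule equator_chain_of_trajectory[OF F s0(1) u height x[unfolded L_def] subsetD[OF L0 x]
            y[unfolded L_def] subsetD[OF L0 y]])
    show ?thesis
    proof (cases "L = {}")
      case False
      then obtain x where x: "x \<in> L" by blast
      \<comment> \<open>The exponent is determined for the whole class rather than for
        \<open>L\<close>, because the maximal set must itself lie in one Lyapunov space.\<close>
      let ?E = "chain_class equator dist {()} (\<lambda>t x _. equator_flow A t x) x"
      have ccs: "chain_control_set equator dist {()} (\<lambda>t x _. equator_flow A t x) ?E"
        by (rule chain_control_set_class[OF ereach[OF x x]])
      have LE: "L \<subseteq> ?E" unfolding chain_class_def using L0 ereach x by blast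
      have E: "?E \<noteq> {}" "?E \<subseteq> equator" "\<forall>a\<in>?E. \<forall>b\<in>?E. equator_reach A a b"
        using ccs unfolding chain_control_set_def chain_controllable_on_iff by blast+
      obtain lam where lam: "lam \<in> lyapunov_exponents A" "\<forall>a\<in>?E. fst a \<in> lyapunov_space A lam"
        using equator_single_exponent[OF E(3,1,2)] by blast
      show ?thesis
      proof (cases "lam = 0")
        case True
        \<comment> \<open>Exponent 0 yields no Lyapunov component of the required kind; instead each
          limit point is chain equivalent to the pole in the controlled system.\<close>
        have "a \<in> pole_class" if a: "a \<in> L" for a
        proof -
          have "fst a \<in> lyapunov_sum A {0}" "norm (fst a) = 1" "a = (fst a, 0)"
            using lam(2) LE L0 a True by (auto simp: lyapunov_sum_singleton equator_iff prod_eq_iff)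
          then show ?thesis
            using center_pole[of "fst a"] LS[OF a] unfolding chain_class_def by auto
        qed
        then show ?thesis by blast
      next
        case False
        have "?E \<subseteq> lyapunov_space_inf A lam \<inter> poincare_sphere"
        proof
          fix a assume a: "a \<in> ?E"
          then have "fst a \<in> lyapunov_space A lam" "snd a = 0" "a \<in> poincare_sphere"
            using lam(2) E(2) by (auto simp: equator_def)
          then show "a \<in> lyapunov_space_inf A lam \<inter> poincare_sphere"
            by (simp add: lyapunov_space_inf_def mem_Times_iff)
        qed
        then have "is_lyapunov_component A lam ?E"
          using ccs unfolding is_lyapunov_component_def maximal_chain_transitive_def by blast
        then show ?thesis using lam(1) False LE by blast
      qed
    qed simp
  qed
qed

end

theorem corollary1:
  fixes A :: "real^'n^'n" and B :: "real^'m^'n" and U :: "(real^'m) set"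
    and u :: "real \<Rightarrow> real^'m" and x0 :: "real^'n" and s0 :: "(real^'n) \<times> real"
  assumes "compact U" and "convex U" and "0 \<in> interior U"
    and "u \<in> admissible_controls U"
    and "s0 = h1 x0"
  shows "(\<forall>t. sphere_sol A B t s0 u = h1 (lin_sol A B t x0 u)) \<and>
    (\<forall>L \<in> {alpha_limit_set A B s0 u, omega_limit_set A B s0 u}.
       (\<exists>E. is_central_chain_control_set A B U E \<and> L \<subseteq> E) \<or>
       (\<exists>lam E. lam \<in> lyapunov_exponents A \<and> lam \<noteq> 0 \<and> is_lyapunov_component A lam E \<and> L \<subseteq> E))"
proof -
  interpret poincare_system U A B
    by unfold_locales (use assms(1,3) interior_subset in auto)
  have s0: "s0 \<in> poincare_sphere" "snd s0 > 0"
  proof -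
    show "s0 \<in> poincare_sphere" unfolding assms(5) h1_def by (rule chart_in_sphere)
    have "(x0, 1 :: real) \<noteq> 0" by (rule height_nonzero) simp
    then show "snd s0 > 0" unfolding assms(5) h1_def by (simp add: sgn_div_norm)
  qed
  have sub: "alpha_limit_set A B s0 u \<subseteq> limit_points at_bot (\<lambda>t. sphere_sol A B t s0 u)"
    "omega_limit_set A B s0 u \<subseteq> limit_points at_top (\<lambda>t. sphere_sol A B t s0 u)"
    unfolding alpha_limit_set_def omega_limit_set_def limit_points_def by blast+
  have "(\<exists>E. is_central_chain_control_set A B U E \<and> L \<subseteq> E) \<or>
       (\<exists>lam E. lam \<in> lyapunov_exponents A \<and> lam \<noteq> 0 \<and> is_lyapunov_component A lam E \<and> L \<subseteq> E)"
    \<comment> \<open>Stated for both ends of time at once; in the first alternative the central set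
      is the class of the north pole, whichever number of central sets exists.\<close>
    if "L \<subseteq> limit_points F (\<lambda>t. sphere_sol A B t s0 u)" "time_end F" for L F
    using limit_points_in_component[OF that(2) s0 assms(4)] that(1) pole_class_central by (meson subset_trans)
  then have "\<forall>L \<in> {alpha_limit_set A B s0 u, omega_limit_set A B s0 u}.
       (\<exists>E. is_central_chain_control_set A B U E \<and> L \<subseteq> E) \<or>
       (\<exists>lam E. lam \<in> lyapunov_exponents A \<and> lam \<noteq> 0 \<and> is_lyapunov_component A lam E \<and> L \<subseteq> E)"
    using sub time_end_at_top time_end_at_bot by blast
  moreover have "sphere_sol A B t s0 u = h1 (lin_sol A B t x0 u)" for t
    unfolding assms(5) h1_def lin_sol_eq[OF assms(4)] by (rule ssol_chart[OF assms(4)])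
  ultimately show ?thesis by blast
qed

end
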